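(* Let $T:\operatorname{Mat}_{n\times n}(\mathbb{C})\to\operatorname{Mat}_{m\times m}(\mathbb{C})$ be a completely positive map, and let $P=\operatorname{diag}(p_1,\dots,p_n)$, $Q=\operatorname{diag}(q_1,\dots,q_m)$ where $\mathbf p$, $\mathbf q$ are nonincreasing sequences of nonnegative reals with $\operatorname{Tr}P=\operatorname{Tr}Q$. The following are equivalent: (1) $T$ is $(P,Q)$-rank-nondecreasing; (2) $\operatorname{cap}(T,P,Q)>0$; (3) $T$ is approximately $\operatorname{GL}(E_\bullet)\times\operatorname{GL}(F_\bullet)$-scalable to $(I_n\to Q,\ I_m\to P)$.
   Context: $T(X)=\sum_{i=1}^r A_iXA_i^\dagger$ with $A_i\in\operatorname{Mat}_{m\times n}(\mathbb{C})$, and $T^*(Y)=\sum_i A_i^\dagger YA_i$. For $g\in\operatorname{Mat}_{m\times m}(\mathbb{C})$, $h\in\operatorname{Mat}_{n\times n}(\mathbb{C})$, $T_{g,h}(X)=g^\dagger T(hXh^\dagger)g$. For subgroups $G\subset \operatorname{GL}_m(\mathbb{C})$, $H\subset\operatorname{GL}_n(\mathbb{C})$, $T$ is approximately $G\times H$-scalable to $(A\to B, C\to D)$ if for every $\epsilon>0$ there is $(g,h)\in G\times H$ with $\|T_{g,h}(A)-B\|\le\epsilon$ and $\|T_{g,h}^*(C)-D\|\le\epsilon$, where $\|X\|=\sqrt{\operatorname{Tr}XX^\dagger}$. $E_i\subset\mathbb{C}^m$ (resp. $F_j\subset\mathbb{C}^n$) is the span of the first $i$ (resp. $j$) standard basis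 vectors; $\operatorname{GL}(E_\bullet)$, $\operatorname{GL}(F_\bullet)$ are the groups of invertible upper-triangular $m\times m$, resp. $n\times n$, matrices. For a nonincreasing sequence $\mathbf a=(a_1,\dots,a_k)$, $\Delta a_i=a_i-a_{i+1}$ with $a_{k+1}=0$. $\eta_j$ denotes the $j\times k$ matrix $[I_j\ 0]$ (projection onto the first $j$ coordinates). For $A=\operatorname{diag}(\mathbf a)$ with $\mathbf a$ nonincreasing nonnegative and $X\in\operatorname{Mat}_{k\times k}(\mathbb{C})$, $\det(A,X)=\prod_{j=1}^k(\det\eta_jX\eta_j^\dagger)^{\Delta a_j}$, with $0^0=1$. Capacity: $\operatorname{cap}(T,P,Q)=\inf_{h\in\operatorname{GL}(F_\bullet)}\frac{\det(Q,T(hPh^\dagger))}{\det(P,h^\dagger h)}$. A pair of subspaces $(L\subset\mathbb{C}^m,R\subset\mathbb{C}^n)$ is $T$-independent if $L\subset(A_iR)^\perp$ for all $i$. $T$ is $(P,Q)$-rank-nondecreasing if for every $T$-independent pair $(L,R)$: $\sum_{i=1}^m\Delta q_i\dim(E_i\cap L)+\sum_{j=1}^n\Delta p_j\dim(F_j\cap R)\le\operatorname{Tr}P$. *)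

theory Defs
  imports "HOL-Analysis.Complex_Transcendental" "Jordan_Normal_Form.Schur_Decomposition"
begin

definition mat_trace :: "complex mat \<Rightarrow> complex" where
  "mat_trace X = (\<Sum>i<dim_row X. X $$ (i, i))"

definition hs_norm :: "complex mat \<Rightarrow> real" where
  "hs_norm X = sqrt (Re (mat_trace (X * mat_adjoint X)))"

text \<open>
  Sequences of length \<open>k\<close> are indexed by \<open>1, \<dots>, k\<close>; their values at other indices are never
  used. Matrix and vector entries are indexed from \<open>0\<close>.
\<close>

definition seq_diag :: "nat \<Rightarrow> (nat \<Rightarrow> real) \<Rightarrow> complex mat" where
  "seq_diag k a = mat_diag k (\<lambda>i. complex_of_real (a (Suc i)))"

definition seq_diff :: "nat \<Rightarrow> (nat \<Rightarrow> real) \<Rightarrow> nat \<Rightarrow> real" where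
  "seq_diff k a i = a i - (if i = k then 0 else a (Suc i))"

definition eta :: "nat \<Rightarrow> nat \<Rightarrow> complex mat" where
  "eta j k = mat j k (\<lambda>(a, b). if a = b then 1 else 0)"

text \<open>
  \<open>det(A, X)\<close> for \<open>A = diag(a)\<close>. Complex \<open>powr\<close> uses the principal branch and has
  \<open>0 powr s = 0\<close> for every \<open>s\<close>, so the convention \<open>0\<^sup>0 = 1\<close> needs the case distinction.
\<close>

definition rel_det :: "nat \<Rightarrow> (nat \<Rightarrow> real) \<Rightarrow> complex mat \<Rightarrow> complex" where
  "rel_det k a X =
     (\<Prod>j = 1..k. if seq_diff k a j = 0 then 1
       else Determinant.det (eta j k * X * mat_adjoint (eta j k)) powr complex_of_real (seq_diff k a j))"

definition GL_flag :: "nat \<Rightarrow> complex mat set" where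
  "GL_flag k = {g \<in> carrier_mat k k. invertible_mat g \<and> upper_triangular g}"

text \<open>
  A completely positive map from \<open>n\<close> by \<open>n\<close> to \<open>m\<close> by \<open>m\<close> matrices is given by \<open>m\<close> by \<open>n\<close> Kraus
  operators \<open>A 1, \<dots>, A r\<close>; the sums of matrices are written entrywise because matrices
  of unspecified dimension do not form an additive monoid.
\<close>

definition cp_map :: "nat \<Rightarrow> nat \<Rightarrow> (nat \<Rightarrow> complex mat) \<Rightarrow> complex mat \<Rightarrow> complex mat" where
  "cp_map m r A X = mat m m (\<lambda>ab. \<Sum>i = 1..r. (A i * X * mat_adjoint (A i)) $$ ab)"

definition cp_dual :: "nat \<Rightarrow> nat \<Rightarrow> (nat \<Rightarrow> complex mat) \<Rightarrow> complex mat \<Rightarrow> complex mat" where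
  "cp_dual n r A Y = mat n n (\<lambda>ab. \<Sum>i = 1..r. (mat_adjoint (A i) * Y * A i) $$ ab)"

definition scaled_map ::
  "complex mat \<Rightarrow> complex mat \<Rightarrow> (complex mat \<Rightarrow> complex mat) \<Rightarrow> complex mat \<Rightarrow> complex mat" where
  "scaled_map g h T X = mat_adjoint g * T (h * X * mat_adjoint h) * g"

definition scaled_kraus ::
  "complex mat \<Rightarrow> complex mat \<Rightarrow> (nat \<Rightarrow> complex mat) \<Rightarrow> nat \<Rightarrow> complex mat" where
  "scaled_kraus g h A i = mat_adjoint g * A i * h"

lemma mat_adjoint_carrier: "X \<in> carrier_mat a b \<Longrightarrow> mat_adjoint X \<in> carrier_mat b a"
  by (auto simp: mat_adjoint_def)

lemma mat_adjoint_index: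
  assumes "X \<in> carrier_mat a b" "i < b" "j < a"
  shows "mat_adjoint X $$ (i, j) = conjugate (X $$ (j, i))"
  using assms by (auto simp: mat_adjoint_def mat_of_rows_def)

lemma mat_adjoint_mult:
  fixes X Y :: "complex mat"
  assumes X: "X \<in> carrier_mat a b" and Y: "Y \<in> carrier_mat b c"
  shows "mat_adjoint (X * Y) = mat_adjoint Y * mat_adjoint X"
proof (rule eq_matI)
  note [simp] = mat_adjoint_carrier[OF X] mat_adjoint_carrier[OF Y]
  have XY: "X * Y \<in> carrier_mat a c" using X Y by simp
  fix i j assume "i < dim_row (mat_adjoint Y * mat_adjoint X)"
    "j < dim_col (mat_adjoint Y * mat_adjoint X)"
  then have i: "i < c" and j: "j < a"
    using mat_adjoint_carrier[OF X] mat_adjoint_carrier[OF Y] by auto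
  have "mat_adjoint (X * Y) $$ (i, j) = cnj (\<Sum>k<b. X $$ (j, k) * Y $$ (k, i))"
    using mat_adjoint_index[OF XY i j] X Y i j by (simp add: scalar_prod_def lessThan_atLeast0)
  also have "\<dots> = (\<Sum>k<b. mat_adjoint Y $$ (i, k) * mat_adjoint X $$ (k, j))"
    using mat_adjoint_index[OF X _ j] mat_adjoint_index[OF Y i] by (simp add: mult.commute)
  also have "\<dots> = (mat_adjoint Y * mat_adjoint X) $$ (i, j)"
    using carrier_matD[OF mat_adjoint_carrier[OF X]] carrier_matD[OF mat_adjoint_carrier[OF Y]] i j
    by (simp add: scalar_prod_def lessThan_atLeast0)
  finally show "mat_adjoint (X * Y) $$ (i, j) = (mat_adjoint Y * mat_adjoint X) $$ (i, j)" .
next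
  show "dim_row (mat_adjoint (X * Y)) = dim_row (mat_adjoint Y * mat_adjoint X)"
    "dim_col (mat_adjoint (X * Y)) = dim_col (mat_adjoint Y * mat_adjoint X)"
    using X Y by (auto simp: mat_adjoint_def)
qed

lemma mat_mult3_index:
  fixes X Y Z :: "complex mat"
  assumes "X \<in> carrier_mat a b" "Y \<in> carrier_mat b c" "Z \<in> carrier_mat c d" "i < a" "j < d"
  shows "(X * Y * Z) $$ (i, j) = (\<Sum>l<c. (\<Sum>k<b. X $$ (i, k) * Y $$ (k, l)) * Z $$ (l, j))"
proof -
  have "(X * Y * Z) $$ (i, j) = (\<Sum>l<c. (X * Y) $$ (i, l) * Z $$ (l, j))"
    using assms by (simp add: scalar_prod_def lessThan_atLeast0 del: assoc_mult_mat)
  also have "\<dots> = (\<Sum>l<c. (\<Sum>k<b. X $$ (i, k) * Y $$ (k, l)) * Z $$ (l, j))"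
    using assms by (intro sum.cong) (simp_all add: scalar_prod_def lessThan_atLeast0)
  finally show ?thesis .
qed

text \<open>The map \<open>T\<^sub>g\<^sub>,\<^sub>h\<close> has Kraus operators \<open>g\<^sup>\<dagger> A\<^sub>i h\<close>; these give its adjoint.\<close>

lemma cp_map_scaled_kraus:
  assumes A: "\<And>i. i \<in> {1..r} \<Longrightarrow> A i \<in> carrier_mat m n"
    and g: "g \<in> carrier_mat m m" and h: "h \<in> carrier_mat n n" and X: "X \<in> carrier_mat n n"
  shows "cp_map m r (scaled_kraus g h A) X = scaled_map g h (cp_map m r A) X"
proof -
  let ?Z = "h * X * mat_adjoint h"
  let ?B = "\<lambda>i. A i * ?Z * mat_adjoint (A i)"
  note g' = mat_adjoint_carrier[OF g] and h' = mat_adjoint_carrier[OF h]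
  have Z: "?Z \<in> carrier_mat n n" using h X h' by simp
  have B: "?B i \<in> carrier_mat m m" if "i \<in> {1..r}" for i
    using A[OF that] mat_adjoint_carrier[OF A[OF that]] Z by simp
  have gg: "mat_adjoint (mat_adjoint g) = g"
    by (rule eq_matI) (use g g' mat_adjoint_carrier[OF g'] in
        \<open>auto simp: mat_adjoint_index[OF g'] mat_adjoint_index[OF g]\<close>)
  have eq: "scaled_kraus g h A i * X * mat_adjoint (scaled_kraus g h A i)
      = mat_adjoint g * ?B i * g" if i: "i \<in> {1..r}" for i
  proof -
    note a = A[OF i] and a' = mat_adjoint_carrier[OF A[OF i]]
    have "mat_adjoint (mat_adjoint g * A i * h)
        = mat_adjoint h * (mat_adjoint (A i) * g)"
      using mat_adjoint_mult[OF mult_carrier_mat[OF g' a] h] mat_adjoint_mult[OF g' a] gg by simp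
    then show ?thesis
      unfolding scaled_kraus_def
      using g g' h h' a a' X
      by (simp add: assoc_mult_mat[of _ _ m _ m _ m] assoc_mult_mat[of _ _ n _ n _ n]
          assoc_mult_mat[of _ m m _ n _ n] assoc_mult_mat[of _ m n _ n _ n]
          assoc_mult_mat[of _ m n _ n _ m] assoc_mult_mat[of _ n n _ n _ m]
          assoc_mult_mat[of _ m m _ n _ m] assoc_mult_mat[of _ n n _ m _ m]
          assoc_mult_mat[of _ m n _ m _ m])
  qed
  let ?S = "cp_map m r A ?Z"
  have S: "?S \<in> carrier_mat m m" by (simp add: cp_map_def)
  show ?thesis
  proof (rule eq_matI)
    fix a b assume "a < dim_row (scaled_map g h (cp_map m r A) X)"
      "b < dim_col (scaled_map g h (cp_map m r A) X)"
    then have a: "a < m" and b: "b < m" using g g' by (auto simp: scaled_map_def)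
    have "cp_map m r (scaled_kraus g h A) X $$ (a, b)
        = (\<Sum>i = 1..r. \<Sum>l<m. (\<Sum>k<m. mat_adjoint g $$ (a, k) * ?B i $$ (k, l)) * g $$ (l, b))"
      using a b by (simp add: cp_map_def eq mat_mult3_index[OF g' B g a b] del: index_mult_mat)
    also have "\<dots> = (\<Sum>l<m. (\<Sum>k<m. mat_adjoint g $$ (a, k) * (\<Sum>i = 1..r. ?B i $$ (k, l))) * g $$ (l, b))"
      by (simp only: sum_distrib_left sum_distrib_right
          sum.swap[of _ "{..<m}" "{1..r}"])
    also have "\<dots> = (\<Sum>l<m. (\<Sum>k<m. mat_adjoint g $$ (a, k) * ?S $$ (k, l)) * g $$ (l, b))"
      by (simp add: cp_map_def del: index_mult_mat)
    also have "\<dots> = scaled_map g h (cp_map m r A) X $$ (a, b)"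
      using mat_mult3_index[OF g' S g a b] by (simp add: scaled_map_def)
    finally show "cp_map m r (scaled_kraus g h A) X $$ (a, b)
        = scaled_map g h (cp_map m r A) X $$ (a, b)" .
  qed (use g g' in \<open>auto simp: scaled_map_def cp_map_def\<close>)
qed

definition approx_scalable ::
  "nat \<Rightarrow> nat \<Rightarrow> nat \<Rightarrow> (nat \<Rightarrow> complex mat) \<Rightarrow> complex mat set \<Rightarrow> complex mat set \<Rightarrow>
    complex mat \<Rightarrow> complex mat \<Rightarrow> complex mat \<Rightarrow> complex mat \<Rightarrow> bool" where
  "approx_scalable m n r A G H X Y Z W \<longleftrightarrow>
     (\<forall>\<epsilon>>0. \<exists>g\<in>G. \<exists>h\<in>H.
        hs_norm (scaled_map g h (cp_map m r A) X - Y) \<le> \<epsilon> \<and>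
        hs_norm (cp_dual n r (scaled_kraus g h A) Z - W) \<le> \<epsilon>)"

text \<open>
  For \<open>h \<in> GL_flag n\<close> both relative determinants are taken at positive semidefinite matrices, so
  they are nonnegative reals, and the denominator is positive. The real part only changes the type.
\<close>

definition capacity ::
  "nat \<Rightarrow> nat \<Rightarrow> (complex mat \<Rightarrow> complex mat) \<Rightarrow> (nat \<Rightarrow> real) \<Rightarrow> (nat \<Rightarrow> real) \<Rightarrow> real" where
  "capacity m n T p q =
     (INF h\<in>GL_flag n. Re (rel_det m q (T (h * seq_diag n p * mat_adjoint h))
                            / rel_det n p (mat_adjoint h * h)))"

abbreviation cvec_space :: "nat \<Rightarrow> (complex, complex vec) module" where
  "cvec_space k \<equiv> module_vec TYPE(complex) k"

definition csubspace :: "nat \<Rightarrow> complex vec set \<Rightarrow> bool" where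
  "csubspace k L \<longleftrightarrow> VectorSpace.subspace class_ring L (cvec_space k)"

definition subspace_dim :: "nat \<Rightarrow> complex vec set \<Rightarrow> nat" where
  "subspace_dim k L = vectorspace.dim class_ring (cvec_space k\<lparr>carrier := L\<rparr>)"

definition flag_space :: "nat \<Rightarrow> nat \<Rightarrow> complex vec set" where
  "flag_space k i = LinearCombinations.module.span class_ring (cvec_space k) (unit_vec k ` {..<i})"

definition orth_compl :: "nat \<Rightarrow> complex vec set \<Rightarrow> complex vec set" where
  "orth_compl k S = {x \<in> carrier_vec k. \<forall>y\<in>S. x \<bullet>c y = 0}"

definition cp_independent ::
  "nat \<Rightarrow> nat \<Rightarrow> nat \<Rightarrow> (nat \<Rightarrow> complex mat) \<Rightarrow> complex vec set \<Rightarrow> complex vec set \<Rightarrow> bool" where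
  "cp_independent m n r A L R \<longleftrightarrow>
     csubspace m L \<and> csubspace n R \<and> (\<forall>i\<in>{1..r}. L \<subseteq> orth_compl m ((\<lambda>v. A i *\<^sub>v v) ` R))"

definition rank_nondecreasing ::
  "nat \<Rightarrow> nat \<Rightarrow> nat \<Rightarrow> (nat \<Rightarrow> complex mat) \<Rightarrow> (nat \<Rightarrow> real) \<Rightarrow> (nat \<Rightarrow> real) \<Rightarrow> bool" where
  "rank_nondecreasing m n r A p q \<longleftrightarrow>
     (\<forall>L R. cp_independent m n r A L R \<longrightarrow>
        (\<Sum>i = 1..m. seq_diff m q i * real (subspace_dim m (flag_space m i \<inter> L)))
        + (\<Sum>j = 1..n. seq_diff n p j * real (subspace_dim n (flag_space n j \<inter> R)))
        \<le> Re (mat_trace (seq_diag n p)))"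

end

theory Submission
  imports Defs
begin

text \<open>
  (3) implies (1): in orthonormal bases of \<open>g\<^sup>-\<^sup>1L\<close> and \<open>h\<^sup>-\<^sup>1R\<close> adapted to the flags, independence says
  that the Kraus operators of \<open>T\<^sub>g\<^sub>,\<^sub>h\<close> have a zero block; comparing traces gives the inequality up to \<open>\<epsilon>\<close>.

  (2) implies (3): by Fischer's inequality, positive capacity bounds
  \<open>Tr T\<^sub>g\<^sub>,\<^sub>h(I) - \<Sum> q\<^sub>i log |g\<^sub>i\<^sub>i|\<^sup>2 - \<Sum> p\<^sub>j log |h\<^sub>j\<^sub>j|\<^sup>2\<close> from below.  The derivative of this function
  along \<open>g \<mapsto> g(1 + Z)\<close> and \<open>h \<mapsto> h(1 + Z)\<close> with \<open>Z\<close> upper triangular is given by \<open>T\<^sub>g\<^sub>,\<^sub>h(I) - Q\<close> and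
  \<open>T\<^sub>g\<^sub>,\<^sub>h\<^sup>*(I) - P\<close>, so near-minimisers scale approximately.

  (1) implies (2): pivoted Gram--Schmidt writes \<open>hPh\<^sup>\<dagger> = \<Sum> s\<^sub>k\<^sup>2 u\<^sub>k u\<^sub>k\<^sup>\<dagger>\<close> with \<open>s\<^sub>1 \<ge> s\<^sub>2 \<ge> \<dots>\<close> and \<open>(u\<^sub>k)\<close> in a
  compact set of bases.  Choosing minors greedily, the leading minors of \<open>T(hPh\<^sup>\<dagger>)\<close> are bounded below and
  those of \<open>h\<close> above by monomials in the \<open>s\<^sub>k\<^sup>2\<close> whose exponents are dimensions, and Abel summation compares
  the monomials by means of (1) for \<open>R = span(u\<^sub>1, \<dots>, u\<^sub>t)\<close>.  The choice of minors is fixed at a limit point of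
  the bases, where the chosen minors do not vanish, so the constants are uniform.
\<close>


section \<open>Determinants of matrices given by their entries\<close>

text \<open>The obstacle is (1) implies (2): \<open>h\<close> runs through a noncompact group, and
  the scales \<open>s k\<close> may tend to 0 or to infinity at unrelated rates. The factorisation
  separates them from directions that stay bounded. Only the directions pass to a limit; the scales
  enter through an inequality between monomials that is valid for every nonincreasing tuple.
  Equality of the two traces makes the total degrees agree, so that no power of the smallest scale
  is left over. Pivoting on the longest row replaces singular values: it keeps all multipliers at
  most 1 and so bounds both the basis and its inverse in terms of n alone.

  Weights may be zero, so \<open>P\<close> may be singular.

  For (2) implies (3) no minimiser is sought. One explicit descent step shows that a minimiser up to
  \<delta> has squared gradient O(\<delta>); the constant depends only on Tr Q, because the trace at
  such a point is bounded.\<close>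

definition fdet :: "nat \<Rightarrow> (nat \<Rightarrow> nat \<Rightarrow> complex) \<Rightarrow> complex" where
  "fdet k M = Determinant.det (mat k k (\<lambda>(i, j). M i j))"

lemma fdet_cong: "(\<And>i j. i < k \<Longrightarrow> j < k \<Longrightarrow> M i j = N i j) \<Longrightarrow> fdet k M = fdet k N"
  unfolding fdet_def by (intro arg_cong[of _ _ Determinant.det] eq_matI) auto

lemma fdet_0 [simp]: "fdet 0 M = 1"
  unfolding fdet_def by (rule det_dim_zero) auto

lemma fdet_leibniz:
  "fdet k M = (\<Sum>\<pi> | \<pi> permutes {0..<k}. signof \<pi> * (\<Prod>i = 0..<k. M i (\<pi> i)))"
proof -
  have "(\<Prod>i = 0..<k. mat k k (\<lambda>(i, j). M i j) $$ (i, \<pi> i)) = (\<Prod>i = 0..<k. M i (\<pi> i))"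
    if "\<pi> permutes {0..<k}" for \<pi>
    using permutes_in_image[OF that] by (intro prod.cong) auto
  then show ?thesis
    unfolding fdet_def by (subst det_def'[of _ k]) (auto intro!: sum.cong)
qed

lemma fdet_mult: "fdet k (\<lambda>i j. \<Sum>l<k. M i l * N l j) = fdet k M * fdet k N"
proof -
  have "mat k k (\<lambda>(i, j). \<Sum>l<k. M i l * N l j)
      = mat k k (\<lambda>(i, j). M i j) * mat k k (\<lambda>(i, j). N i j)"
    by (rule eq_matI) (auto simp: scalar_prod_def lessThan_atLeast0)
  then show ?thesis
    unfolding fdet_def by (simp add: Determinant.det_mult[of _ k])
qed

lemma fdet_transpose: "fdet k (\<lambda>i j. M j i) = fdet k M"
proof -
  have "mat k k (\<lambda>(i, j). M j i) = transpose_mat (mat k k (\<lambda>(i, j). M i j))"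
    by (rule eq_matI) auto
  then show ?thesis unfolding fdet_def by (simp add: Determinant.det_transpose[of _ k])
qed

lemma fdet_cnj: "fdet k (\<lambda>i j. cnj (M i j)) = cnj (fdet k M)"
proof -
  have "cnj (signof \<pi>) = signof \<pi>" for \<pi> :: "nat \<Rightarrow> nat"
    by (simp add: sign_def)
  then show ?thesis by (simp add: fdet_leibniz)
qed

lemma fdet_upper_triangular:
  assumes "\<And>i j. j < i \<Longrightarrow> i < k \<Longrightarrow> M i j = 0"
  shows "fdet k M = (\<Prod>i<k. M i i)"
proof -
  have "upper_triangular (mat k k (\<lambda>(i, j). M i j))"
    using assms by (auto simp: upper_triangular_def)
  then have "fdet k M = prod_list (diag_mat (mat k k (\<lambda>(i, j). M i j)))"
    unfolding fdet_def by (rule det_upper_triangular) auto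
  also have "\<dots> = (\<Prod>i<k. M i i)"
    by (simp add: prod_list_diag_prod lessThan_atLeast0)
  finally show ?thesis .
qed

lemma fdet_lower_triangular:
  assumes "\<And>i j. i < j \<Longrightarrow> j < k \<Longrightarrow> M i j = 0"
  shows "fdet k M = (\<Prod>i<k. M i i)"
proof -
  have "fdet k M = fdet k (\<lambda>i j. M j i)" by (rule fdet_transpose[symmetric])
  also have "\<dots> = (\<Prod>i<k. M i i)" using assms by (intro fdet_upper_triangular)
  finally show ?thesis .
qed

lemma fdet_scale_rows: "fdet k (\<lambda>i j. c i * M i j) = (\<Prod>i<k. c i) * fdet k M"
  by (simp add: fdet_leibniz sum_distrib_left prod.distrib lessThan_atLeast0 mult.left_commute)

lemma fdet_zero_row:
  assumes "i < k" "\<And>j. j < k \<Longrightarrow> M i j = 0"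
  shows "fdet k M = 0"
proof -
  have "(\<Prod>i = 0..<k. M i (\<pi> i)) = 0" if "\<pi> permutes {0..<k}" for \<pi>
    using assms permutes_in_image[OF that, of i] by (intro prod_zero bexI[of _ i]) auto
  then show ?thesis unfolding fdet_leibniz by (intro sum.neutral) simp
qed

lemma fdet_zero_column:
  assumes "j < k" "\<And>i. i < k \<Longrightarrow> M i j = 0"
  shows "fdet k M = 0"
proof -
  have "fdet k M = fdet k (\<lambda>i j. M j i)" by (rule fdet_transpose[symmetric])
  also have "\<dots> = 0" using assms by (intro fdet_zero_row[of j])
  finally show ?thesis .
qed

lemma fdet_bound:
  assumes "\<And>i j. i < k \<Longrightarrow> j < k \<Longrightarrow> cmod (M i j) \<le> 1"
  shows "cmod (fdet k M) \<le> fact k"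
proof -
  have "cmod (signof \<pi> * (\<Prod>i = 0..<k. M i (\<pi> i))) \<le> 1" if "\<pi> permutes {0..<k}" for \<pi>
  proof -
    have "cmod (\<Prod>i = 0..<k. M i (\<pi> i)) \<le> 1"
      unfolding prod_norm[symmetric]
      using assms permutes_in_image[OF that] by (intro prod_le_1) auto
    then show ?thesis by (simp add: norm_mult sign_def)
  qed
  then have "cmod (fdet k M) \<le> (\<Sum>\<pi> | \<pi> permutes {0..<k}. 1)"
    unfolding fdet_leibniz by (intro sum_norm_le) auto
  also have "\<dots> = fact k"
    by (simp add: card_permutations[of "{0..<k}" k])
  finally show ?thesis .
qed

lemma fdet_tendsto:
  assumes "\<And>i j. i < k \<Longrightarrow> j < k \<Longrightarrow> ((\<lambda>x. M x i j) \<longlongrightarrow> N i j) F"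
  shows "((\<lambda>x. fdet k (M x)) \<longlongrightarrow> fdet k N) F"
  unfolding fdet_leibniz
proof (intro tendsto_sum tendsto_mult tendsto_const tendsto_prod)
  fix \<pi> i assume "\<pi> \<in> {\<pi>. \<pi> permutes {0..<k}}" "i \<in> {0..<k}"
  then show "((\<lambda>x. M x i (\<pi> i)) \<longlongrightarrow> N i (\<pi> i)) F"
    using assms[of i "\<pi> i"] permutes_in_image[of \<pi> "{0..<k}" i] by auto
qed

section \<open>Positive semidefinite matrices\<close>

definition schur :: "(nat \<Rightarrow> nat \<Rightarrow> complex) \<Rightarrow> nat \<Rightarrow> nat \<Rightarrow> complex" where
  "schur M i j = M (Suc i) (Suc j) - M (Suc i) 0 * M 0 (Suc j) / M 0 0"

text \<open>One step of Gaussian elimination: the unit lower triangular \<open>L\<close> clears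
  column 0 below the corner and leaves \<open>schur M\<close> as trailing block.\<close>

lemma fdet_schur:
  assumes "M 0 0 \<noteq> 0"
  shows "fdet (Suc k) M = M 0 0 * fdet k (schur M)"
proof -
  define L where "L i j = (if i = j then 1 else if j = 0 then - M i 0 / M 0 0 else 0)" for i j
  define N where "N i j = (\<Sum>l<Suc k. L i l * M l j)" for i j
  have N0: "N 0 j = M 0 j" for j
    unfolding N_def L_def by (simp add: if_distrib[of "\<lambda>x. x * _"] sum.delta cong: if_cong)
  have NS: "N (Suc i) j = M (Suc i) j - M (Suc i) 0 / M 0 0 * M 0 j" if "i < k" for i j
  proof -
    have "N (Suc i) j = L (Suc i) 0 * M 0 j + (\<Sum>l<k. L (Suc i) (Suc l) * M (Suc l) j)"
      unfolding N_def by (simp add: sum.lessThan_Suc_shift del: sum.lessThan_Suc)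
    also have "(\<Sum>l<k. L (Suc i) (Suc l) * M (Suc l) j) = M (Suc i) j"
      using that unfolding L_def by (simp add: if_distrib[of "\<lambda>x. x * _"] sum.delta cong: if_cong)
    finally show ?thesis by (simp add: L_def)
  qed
  have "fdet (Suc k) N = fdet (Suc k) L * fdet (Suc k) M"
    unfolding N_def by (rule fdet_mult)
  moreover have "fdet (Suc k) L = 1"
    by (subst fdet_lower_triangular) (auto simp: L_def)
  moreover have "fdet (Suc k) N = M 0 0 * fdet k (schur M)"
  proof -
    have "mat (Suc k) (Suc k) (\<lambda>(i, j). N i j)
        = four_block_mat (mat 1 1 (\<lambda>_. M 0 0)) (mat 1 k (\<lambda>(i, j). M 0 (Suc j))) (0\<^sub>m k 1)
            (mat k k (\<lambda>(i, j). schur M i j))"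
    proof (rule eq_matI)
      fix i j assume "i < dim_row (four_block_mat (mat 1 1 (\<lambda>_. M 0 0)) (mat 1 k (\<lambda>(i, j). M 0 (Suc j))) (0\<^sub>m k 1)
            (mat k k (\<lambda>(i, j). schur M i j)))" "j < dim_col (four_block_mat (mat 1 1 (\<lambda>_. M 0 0)) (mat 1 k (\<lambda>(i, j). M 0 (Suc j))) (0\<^sub>m k 1)
            (mat k k (\<lambda>(i, j). schur M i j)))"
      then have "i < Suc k" "j < Suc k" by auto
      then show "mat (Suc k) (Suc k) (\<lambda>(i, j). N i j) $$ (i, j)
        = four_block_mat (mat 1 1 (\<lambda>_. M 0 0)) (mat 1 k (\<lambda>(i, j). M 0 (Suc j))) (0\<^sub>m k 1)
            (mat k k (\<lambda>(i, j). schur M i j)) $$ (i, j)"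
        using assms by (cases i; cases j) (auto simp: N0 NS schur_def)
    qed auto
    then show ?thesis unfolding fdet_def
      by (simp add: det_four_block_mat_lower_left_zero_col[of _ _ k])
        (subst det_upper_triangular[of _ 1], auto simp: diag_mat_def)
  qed
  ultimately show ?thesis by simp
qed

definition quad_form :: "nat \<Rightarrow> (nat \<Rightarrow> nat \<Rightarrow> complex) \<Rightarrow> (nat \<Rightarrow> complex) \<Rightarrow> complex" where
  "quad_form k M x = (\<Sum>i<k. \<Sum>j<k. cnj (x i) * M i j * x j)"

definition psd :: "nat \<Rightarrow> (nat \<Rightarrow> nat \<Rightarrow> complex) \<Rightarrow> bool" where
  "psd k M \<longleftrightarrow> (\<forall>i<k. \<forall>j<k. M j i = cnj (M i j)) \<and> (\<forall>x. 0 \<le> Re (quad_form k M x))"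

lemma psdI:
  assumes "\<And>i j. i < k \<Longrightarrow> j < k \<Longrightarrow> M j i = cnj (M i j)" "\<And>x. 0 \<le> Re (quad_form k M x)"
  shows "psd k M"
  unfolding psd_def by (intro conjI allI impI assms)

lemma psd_hermitian:
  assumes "psd k M" "i < k" "j < k"
  shows "M j i = cnj (M i j)"
  by (rule assms(1)[unfolded psd_def, THEN conjunct1, THEN spec, THEN mp, OF assms(2), THEN spec,
        THEN mp, OF assms(3)])

lemma psd_quad_form: "psd k M \<Longrightarrow> 0 \<le> Re (quad_form k M x)"
  unfolding psd_def by (elim conjE allE)

lemma quad_form_restrict:
  assumes "j \<le> k" "\<And>i. j \<le> i \<Longrightarrow> i < k \<Longrightarrow> x i = 0"
  shows "quad_form k M x = quad_form j M x"
proof -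
  have "(\<Sum>i<k. \<Sum>l<k. cnj (x i) * M i l * x l) = (\<Sum>i<j. \<Sum>l<k. cnj (x i) * M i l * x l)"
    using assms by (intro sum.mono_neutral_right) auto
  also have "\<dots> = (\<Sum>i<j. \<Sum>l<j. cnj (x i) * M i l * x l)"
    using assms by (intro sum.cong refl sum.mono_neutral_right) auto
  finally show ?thesis by (simp add: quad_form_def)
qed

lemma quad_form_cong: "(\<And>i. i < k \<Longrightarrow> x i = y i) \<Longrightarrow> quad_form k M x = quad_form k M y"
  unfolding quad_form_def by (intro sum.cong) auto

lemma psd_leading:
  assumes "psd k M" "j \<le> k"
  shows "psd j M"
proof (rule psdI)
  fix x
  have "quad_form j M x = quad_form k M (\<lambda>i. if i < j then x i else 0)"
    using assms(2) by (subst quad_form_restrict[of j]) (auto intro: quad_form_cong)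
  then show "0 \<le> Re (quad_form j M x)" using psd_quad_form[OF assms(1)] by simp
next
  fix a b assume "a < j" "b < j"
  then show "M b a = cnj (M a b)" using assms(2) by (intro psd_hermitian[OF assms(1)]) simp_all
qed

lemma quad_form_delta:
  assumes "a < k" shows "quad_form k M (\<lambda>i. if i = a then c else 0) = cnj c * M a a * c"
proof -
  have "(\<Sum>j<k. cnj (if i = a then c else 0) * M i j * (if j = a then c else 0))
     = (if i = a then cnj c * M a a * c else 0)" for i
    using assms by (auto simp: if_distrib sum.delta cong: if_cong)
  then show ?thesis using assms by (simp add: quad_form_def)
qed

lemma psd_diag:
  assumes "psd k M" "i < k"
  shows "Im (M i i) = 0" "0 \<le> Re (M i i)"
proof -
  have "Im (M i i) = Im (cnj (M i i))" using psd_hermitian[OF assms(1,2,2)] by (rule arg_cong)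
  then show "Im (M i i) = 0" by simp
  show "0 \<le> Re (M i i)"
    using psd_quad_form[OF assms(1), of "\<lambda>l. if l = i then 1 else 0"]
    by (simp add: quad_form_delta[OF assms(2)])
qed

lemma quad_form_Suc:
  "quad_form (Suc k) M x = cnj (x 0) * M 0 0 * x 0 + cnj (x 0) * (\<Sum>j<k. M 0 (Suc j) * x (Suc j))
     + (\<Sum>i<k. cnj (x (Suc i)) * M (Suc i) 0) * x 0 + quad_form k (\<lambda>i j. M (Suc i) (Suc j)) (\<lambda>i. x (Suc i))"
proof -
  have shift: "(\<Sum>i<Suc k. \<Sum>j<Suc k. f i j)
     = f 0 0 + (\<Sum>j<k. f 0 (Suc j)) + (\<Sum>i<k. f (Suc i) 0) + (\<Sum>i<k. \<Sum>j<k. f (Suc i) (Suc j))"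
    for f :: "nat \<Rightarrow> nat \<Rightarrow> complex"
    unfolding sum.lessThan_Suc_shift sum.distrib by (simp only: ac_simps)
  show ?thesis
    unfolding quad_form_def shift sum_distrib_left sum_distrib_right by (simp only: mult.assoc)
qed

text \<open>Completing the square in coordinate 0. For a positive corner the form of the Schur
  complement is the minimum of the full form over that coordinate, attained at the point in the
  first equation. Positivity and monotonicity of Schur complements both come from this.\<close>

lemma quad_form_schur:
  assumes "M 0 0 \<noteq> 0"
  shows "quad_form k (schur M) x = quad_form (Suc k) M
    (case_nat (- (\<Sum>j<k. M 0 (Suc j) * x j) / M 0 0) x)"
    and "Im (M 0 0) = 0 \<Longrightarrow> (\<And>i. i \<le> k \<Longrightarrow> M i 0 = cnj (M 0 i)) \<Longrightarrow>
     quad_form (Suc k) M (case_nat z x) = quad_form k (schur M) x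
      + of_real ((cmod (M 0 0 * z + (\<Sum>j<k. M 0 (Suc j) * x j)))\<^sup>2) / M 0 0"
proof -
  define s where "s = (\<Sum>j<k. M 0 (Suc j) * x j)"
  define t where "t = (\<Sum>i<k. cnj (x i) * M (Suc i) 0)"
  have S: "quad_form k (schur M) x = quad_form k (\<lambda>i j. M (Suc i) (Suc j)) x - t * s / M 0 0"
    unfolding quad_form_def schur_def s_def t_def sum_product sum_divide_distrib sum_subtractf[symmetric]
    by (intro sum.cong refl) (simp add: field_simps)
  show "quad_form k (schur M) x = quad_form (Suc k) M
    (case_nat (- (\<Sum>j<k. M 0 (Suc j) * x j) / M 0 0) x)"
    unfolding quad_form_Suc using assms
    by (simp add: S s_def[symmetric] t_def[symmetric])
  assume im: "Im (M 0 0) = 0" and h: "\<And>i. i \<le> k \<Longrightarrow> M i 0 = cnj (M 0 i)"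
  have ts: "t = cnj s" unfolding t_def s_def using h by (simp add: mult.commute)
  have r: "cnj (M 0 0) = M 0 0" using im by (simp add: complex_eq_iff)
  have "of_real ((cmod (M 0 0 * z + s))\<^sup>2) = (M 0 0 * z + s) * (M 0 0 * cnj z + cnj s)"
    unfolding complex_norm_square by (simp add: r)
  moreover have "quad_form (Suc k) M (case_nat z x) = cnj z * M 0 0 * z + cnj z * s + t * z
      + quad_form k (\<lambda>i j. M (Suc i) (Suc j)) x"
    unfolding quad_form_Suc by (simp add: s_def t_def)
  ultimately show "quad_form (Suc k) M (case_nat z x) = quad_form k (schur M) x
      + of_real ((cmod (M 0 0 * z + (\<Sum>j<k. M 0 (Suc j) * x j)))\<^sup>2) / M 0 0"
    unfolding s_def[symmetric] S ts using assms by (simp add: field_simps)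
qed

lemma psd_schur:
  assumes "psd (Suc k) M" "M 0 0 \<noteq> 0"
  shows "psd k (schur M)"
proof (rule psdI)
  fix i j assume ij: "i < k" "j < k"
  have "cnj (schur M i j) = cnj (M (Suc i) (Suc j)) - cnj (M 0 (Suc j)) * cnj (M (Suc i) 0) / cnj (M 0 0)"
    by (simp add: schur_def mult.commute)
  also have "\<dots> = schur M j i"
    unfolding schur_def using ij
    by (simp only: psd_hermitian[OF assms(1), symmetric] Suc_less_eq zero_less_Suc)
  finally show "schur M j i = cnj (schur M i j)" ..
next
  fix x show "0 \<le> Re (quad_form k (schur M) x)"
    using psd_quad_form[OF assms(1)] assms(2) by (simp add: quad_form_schur(1))
qed

text \<open>The form has no square term in coordinate 0, so a nonzero mixed coefficient would let it
  become negative.\<close>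

lemma psd_zero_row:
  assumes "psd k M" "M 0 0 = 0" "j < k"
  shows "M 0 j = 0"
proof (rule ccontr)
  assume nz: "M 0 j \<noteq> 0"
  then have j: "j \<noteq> 0" using assms(2) by metis
  \<comment> \<open>Chosen so that the form has real part \<open>- Re (M j j) - 2\<close> at
    \<open>x\<close>.\<close>
  define c :: real where "c = (Re (M j j) + 1) / (cmod (M 0 j))\<^sup>2"
  define x where "x i = (if i = 0 then - of_real c * M 0 j else if i = j then 1 else 0)" for i
  have Mj: "M j 0 = cnj (M 0 j)" using assms by (intro psd_hermitian[of k]) auto
  have "(\<Sum>l<k. cnj (x i) * M i l * x l)
     = cnj (x i) * M i 0 * x 0 + cnj (x i) * M i j * x j" for i
  proof -
    have "(\<Sum>l<k. cnj (x i) * M i l * x l) = (\<Sum>l\<in>{0, j}. cnj (x i) * M i l * x l)"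
      using assms(3) by (intro sum.mono_neutral_right) (auto simp: x_def)
    then show ?thesis using j by simp
  qed
  then have "quad_form k M x = (\<Sum>i<k. cnj (x i) * M i 0 * x 0 + cnj (x i) * M i j * x j)"
    by (simp add: quad_form_def)
  also have "\<dots> = (\<Sum>i\<in>{0, j}. cnj (x i) * M i 0 * x 0 + cnj (x i) * M i j * x j)"
    using assms(3) by (intro sum.mono_neutral_right) (auto simp: x_def)
  also have "\<dots> = - 2 * of_real c * (M 0 j * cnj (M 0 j)) + M j j"
    using j assms(2) by (simp add: x_def Mj)
  finally have "Re (quad_form k M x) = - 2 * c * (cmod (M 0 j))\<^sup>2 + Re (M j j)"
    by (simp add: complex_mult_cnj cmod_power2)
  also have "\<dots> = - Re (M j j) - 2"
    using nz by (simp add: c_def)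
  finally show False
    using psd_diag[OF assms(1,3)] psd_quad_form[OF assms(1), of x] by linarith
qed

definition pdet :: "nat \<Rightarrow> (nat \<Rightarrow> nat \<Rightarrow> complex) \<Rightarrow> real" where
  "pdet k M = Re (fdet k M)"

lemma psd_det_zero:
  assumes "psd (Suc k) M" "M 0 0 = 0"
  shows "fdet (Suc k) M = 0"
  using psd_zero_row[OF assms] by (intro fdet_zero_row[of 0]) auto

lemma fdet_psd_nonneg:
  assumes "psd k M" shows "Im (fdet k M) = 0 \<and> 0 \<le> Re (fdet k M)"
  using assms
proof (induction k arbitrary: M)
  case (Suc k)
  show ?case
  proof (cases "M 0 0 = 0")
    case True then show ?thesis using psd_det_zero[OF Suc.prems] by simp
  next
    case False
    then show ?thesis
      using Suc.IH[OF psd_schur[OF Suc.prems False]] psd_diag[OF Suc.prems, of 0]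
      by (simp add: fdet_schur)
  qed
qed auto

lemma fdet_psd: "psd k M \<Longrightarrow> fdet k M = of_real (pdet k M)"
  using fdet_psd_nonneg[of k M] by (simp add: pdet_def complex_eq_iff)

lemma pdet_nonneg: "psd k M \<Longrightarrow> 0 \<le> pdet k M"
  using fdet_psd_nonneg[of k M] by (simp add: pdet_def)

lemma pdet_schur:
  assumes "psd (Suc k) M" "M 0 0 \<noteq> 0"
  shows "pdet (Suc k) M = Re (M 0 0) * pdet k (schur M)"
  using assms fdet_psd_nonneg[OF psd_schur[OF assms]] by (simp add: pdet_def fdet_schur)

text \<open>Schur complements are monotone because they are minima: the form of \<open>M\<close> is
  evaluated at the minimiser that belongs to \<open>N\<close>. Induction then compares the remaining
  factors.\<close>

lemma pdet_mono:
  assumes "psd k M" "psd k N" "\<And>x. Re (quad_form k M x) \<le> Re (quad_form k N x)"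
  shows "pdet k M \<le> pdet k N"
  using assms
proof (induction k arbitrary: M N)
  case (Suc k)
  note M = Suc.prems(1) and N = Suc.prems(2) and le = Suc.prems(3)
  have diag: "Re (M 0 0) \<le> Re (N 0 0)"
    using le[of "\<lambda>i. if i = 0 then 1 else 0"] by (simp add: quad_form_delta)
  show ?case
  proof (cases "M 0 0 = 0")
    case True
    then show ?thesis using psd_det_zero[OF M] pdet_nonneg[OF N] by (simp add: pdet_def)
  next
    case M0: False
    have Mp: "Re (M 0 0) > 0" using psd_diag[OF M, of 0] M0 by (auto simp: complex_eq_iff less_le)
    then have N0: "N 0 0 \<noteq> 0" using diag by auto
    have "Re (quad_form k (schur M) x) \<le> Re (quad_form k (schur N) x)" for x
    proof -
      let ?y = "case_nat (- (\<Sum>j<k. N 0 (Suc j) * x j) / N 0 0) x"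
      have h: "M i 0 = cnj (M 0 i)" if "i \<le> k" for i
        using that by (intro psd_hermitian[OF M]) auto
      define e where "e = (cmod (M 0 0 * (- (\<Sum>j<k. N 0 (Suc j) * x j) / N 0 0)
        + (\<Sum>j<k. M 0 (Suc j) * x j)))\<^sup>2"
      have e: "e \<ge> 0" "quad_form (Suc k) M ?y = quad_form k (schur M) x + of_real e / M 0 0"
        unfolding e_def by (rule zero_le_power2)
          (rule quad_form_schur(2)[of M k, OF M0 psd_diag(1)[OF M, of 0, simplified] h])
      have "M 0 0 = of_real (Re (M 0 0))" using psd_diag(1)[OF M, of 0] by (simp add: complex_eq_iff)
      then have "Re (of_real e / M 0 0) = e / Re (M 0 0)"
        by (metis Re_complex_of_real of_real_divide)
      then have "Re (quad_form k (schur M) x) \<le> Re (quad_form (Suc k) M ?y)"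
        using e Mp by simp
      also have "\<dots> \<le> Re (quad_form (Suc k) N ?y)" by (rule le)
      also have "\<dots> = Re (quad_form k (schur N) x)" by (simp add: quad_form_schur(1)[of N k x, OF N0])
      finally show ?thesis .
    qed
    then have "pdet k (schur M) \<le> pdet k (schur N)"
      by (intro Suc.IH psd_schur M N M0 N0)
    then show ?thesis
      using pdet_nonneg[OF psd_schur[OF M M0]] diag Mp
      by (simp add: pdet_schur M N M0 N0 mult_mono)
  qed
qed (simp add: pdet_def)

text \<open>Fischer's inequality with a last block of size one. Eliminating the corner takes the
  same factor out of both determinants and can only lower the last diagonal entry.\<close>

lemma pdet_Suc_le:
  assumes "psd (Suc k) M"
  shows "pdet (Suc k) M \<le> pdet k M * Re (M k k)"
  using assms
proof (induction k arbitrary: M)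
  case 0
  then show ?case by (simp add: pdet_def fdet_upper_triangular)
next
  case (Suc k)
  note M = Suc.prems
  show ?case
  proof (cases "M 0 0 = 0")
    case True
    then show ?thesis
      using psd_det_zero[OF M] pdet_nonneg[OF psd_leading[OF M]] psd_diag(2)[OF M, of "Suc k"]
      by (simp add: pdet_def)
  next
    case M0: False
    have r: "M 0 0 = of_real (Re (M 0 0))" using psd_diag(1)[OF M, of 0] by (simp add: complex_eq_iff)
    have p: "Re (M 0 0) \<ge> 0" using psd_diag(2)[OF M, of 0] by simp
    have Mk: "psd (Suc k) M" using psd_leading[OF M] by simp
    have "M (Suc k) 0 = cnj (M 0 (Suc k))" by (intro psd_hermitian[OF M]) auto
    then have "M (Suc k) 0 * M 0 (Suc k) / M 0 0 = of_real ((cmod (M 0 (Suc k)))\<^sup>2 / Re (M 0 0))"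
      by (subst r) (simp add: complex_norm_square mult.commute del: of_real_power)
    then have S: "Re (schur M k k) \<le> Re (M (Suc k) (Suc k))"
      using p by (simp add: schur_def)
    have "pdet (Suc (Suc k)) M = Re (M 0 0) * pdet (Suc k) (schur M)"
      by (rule pdet_schur[OF M M0])
    also have "\<dots> \<le> Re (M 0 0) * (pdet k (schur M) * Re (schur M k k))"
      using Suc.IH[OF psd_schur[OF M M0]] p by (intro mult_left_mono)
    also have "\<dots> \<le> Re (M 0 0) * (pdet k (schur M) * Re (M (Suc k) (Suc k)))"
      using S p pdet_nonneg[OF psd_schur[OF Mk M0]] by (intro mult_left_mono)
    also have "\<dots> = pdet (Suc k) M * Re (M (Suc k) (Suc k))"
      by (simp add: pdet_schur[OF Mk M0])
    finally show ?thesis .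
  qed
qed


section \<open>Powers with \<open>0\<^sup>0 = 1\<close> and weighted products along a flag\<close>

definition pw :: "real \<Rightarrow> real \<Rightarrow> real" where
  "pw x a = (if a = 0 then 1 else x powr a)"

lemma pw_nonneg [simp]: "0 \<le> pw x a"
  by (simp add: pw_def)

lemma pw_pos: "0 < x \<Longrightarrow> 0 < pw x a"
  by (simp add: pw_def)

lemma pw_one [simp]: "pw 1 a = 1"
  by (simp add: pw_def)

lemma pw_zero_right [simp]: "pw x 0 = 1"
  by (simp add: pw_def)

lemma pw_add: "0 \<le> a \<Longrightarrow> 0 \<le> b \<Longrightarrow> pw x (a + b) = pw x a * pw x b"
  by (auto simp: pw_def powr_add)

lemma pw_mono: "0 \<le> a \<Longrightarrow> 0 \<le> x \<Longrightarrow> x \<le> y \<Longrightarrow> pw x a \<le> pw y a"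
  by (auto simp: pw_def intro!: powr_mono2)

lemma pw_mult: "0 \<le> x \<Longrightarrow> 0 \<le> y \<Longrightarrow> pw (x * y) a = pw x a * pw y a"
  by (auto simp: pw_def powr_mult)

lemma pw_prod: "(\<And>i. i \<in> I \<Longrightarrow> 0 \<le> f i) \<Longrightarrow> pw (\<Prod>i\<in>I. f i) a = (\<Prod>i\<in>I. pw (f i) a)"
  by (induction I rule: infinite_finite_induct) (auto simp: pw_mult prod_nonneg)

lemma pw_sum: "(\<And>i. i \<in> I \<Longrightarrow> 0 \<le> f i) \<Longrightarrow> pw x (\<Sum>i\<in>I. f i) = (\<Prod>i\<in>I. pw x (f i))"
  by (induction I rule: infinite_finite_induct) (auto simp: pw_add sum_nonneg)

lemma ln_pw: "0 < x \<Longrightarrow> ln (pw x a) = a * ln x"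
  by (simp add: pw_def)

text \<open>The function x^a e^(-x) is largest at x = a, and its value there is at most a^a. The
  constant reads 1 for a = 0.\<close>

lemma pw_le_exp:
  assumes "0 \<le> x" "0 \<le> a"
  shows "pw x a \<le> exp (a * ln a) * exp x"
proof (cases "a = 0 \<or> x = 0")
  case True
  then show ?thesis using assms by (auto simp: pw_def)
next
  case False
  then have "a > 0" "x > 0" using assms by auto
  then have "ln (x / a) \<le> x / a - 1" by (intro ln_le_minus_one) simp
  then have "a * ln (x / a) \<le> a * (x / a - 1)" using \<open>a > 0\<close> by (intro mult_left_mono) auto
  then have "a * ln x \<le> a * ln a + x" using \<open>a > 0\<close> \<open>x > 0\<close>
    by (simp add: ln_div algebra_simps)
  then show ?thesis using \<open>a > 0\<close> \<open>x > 0\<close>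
    by (simp add: pw_def powr_def exp_add[symmetric])
qed

text \<open>The relative determinant with arbitrary numbers \<open>F j\<close> in place of the
  leading minors, so that minors, diagonal products and bounds for them can be compared on an equal
  footing.\<close>

definition flag_prod :: "nat \<Rightarrow> (nat \<Rightarrow> real) \<Rightarrow> (nat \<Rightarrow> real) \<Rightarrow> real" where
  "flag_prod k a F = (\<Prod>j = 1..k. pw (F j) (seq_diff k a j))"

definition weights :: "nat \<Rightarrow> (nat \<Rightarrow> real) \<Rightarrow> bool" where
  "weights k a \<longleftrightarrow> (\<forall>i j. 1 \<le> i \<longrightarrow> i \<le> j \<longrightarrow> j \<le> k \<longrightarrow> a j \<le> a i) \<and> (\<forall>i. 1 \<le> i \<longrightarrow> i \<le> k \<longrightarrow> 0 \<le> a i)"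

lemma weights_antimono: "weights k a \<Longrightarrow> 1 \<le> i \<Longrightarrow> i \<le> j \<Longrightarrow> j \<le> k \<Longrightarrow> a j \<le> a i"
  by (auto simp: weights_def)

lemma weights_nonneg: "weights k a \<Longrightarrow> 1 \<le> i \<Longrightarrow> i \<le> k \<Longrightarrow> 0 \<le> a i"
  by (auto simp: weights_def)

lemma weights_mono: "weights k a \<Longrightarrow> j \<le> k \<Longrightarrow> weights j a"
  unfolding weights_def by (meson le_trans)

lemma seq_diff_nonneg: "weights k a \<Longrightarrow> 1 \<le> i \<Longrightarrow> i \<le> k \<Longrightarrow> 0 \<le> seq_diff k a i"
  using weights_antimono[of k a i "Suc i"] weights_nonneg[of k a i] by (auto simp: seq_diff_def)

text \<open>Lengthening the sequence changes only the exponent of \<open>F k\<close>, from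
  \<open>a k\<close> to \<open>a k - a (Suc k)\<close>. A common factor \<open>R\<close> is
  exhibited instead of a quotient because the values of \<open>F\<close> may vanish;
  \<open>F 0 = 1\<close> covers k = 0.\<close>

lemma flag_prod_Suc:
  assumes w: "weights (Suc k) a" and F0: "F 0 = 1"
  obtains R where "0 \<le> R" "flag_prod (Suc k) a F = R * pw (F (Suc k)) (a (Suc k))"
    "flag_prod k a F = R * pw (F k) (a (Suc k))"
proof
  let ?R = "\<Prod>j = 1..k. pw (F j) (seq_diff (Suc k) a j)"
  show "0 \<le> ?R" by (intro prod_nonneg) auto
  show "flag_prod (Suc k) a F = ?R * pw (F (Suc k)) (a (Suc k))"
    by (simp add: flag_prod_def seq_diff_def)
  show "flag_prod k a F = ?R * pw (F k) (a (Suc k))"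
  proof (cases k)
    case 0
    then show ?thesis by (simp add: flag_prod_def F0)
  next
    case (Suc l)
    have "(\<Prod>j = 1..l. pw (F j) (seq_diff k a j)) = (\<Prod>j = 1..l. pw (F j) (seq_diff (Suc k) a j))"
      using Suc by (intro prod.cong) (auto simp: seq_diff_def)
    moreover have "pw (F k) (a k) = pw (F k) (a k - a (Suc k)) * pw (F k) (a (Suc k))"
      using pw_add[of "a k - a (Suc k)" "a (Suc k)" "F k"] Suc
        weights_antimono[OF w, of k "Suc k"] weights_nonneg[OF w, of "Suc k"] by simp
    ultimately show ?thesis using Suc by (simp add: flag_prod_def seq_diff_def)
  qed
qed

text \<open>Multiplicative summation by parts: the growth factor from \<open>F j\<close> to
  \<open>F (Suc j)\<close> collects the exponents \<open>seq_diff k a i\<close> with i > j, which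
  telescope to \<open>a (Suc j)\<close>.\<close>

lemma flag_prod_le:
  assumes "weights k a" "F 0 = 1" "\<And>j. j \<le> k \<Longrightarrow> 0 \<le> F j" "\<And>j. j < k \<Longrightarrow> 0 \<le> c j"
    "\<And>j. j < k \<Longrightarrow> F (Suc j) \<le> F j * c j"
  shows "flag_prod k a F \<le> (\<Prod>j<k. pw (c j) (a (Suc j)))"
  using assms
proof (induction k)
  case (Suc k)
  obtain R where R: "0 \<le> R" "flag_prod (Suc k) a F = R * pw (F (Suc k)) (a (Suc k))"
    "flag_prod k a F = R * pw (F k) (a (Suc k))"
    using flag_prod_Suc[where F = F, OF Suc.prems(1,2)] by blast
  have "pw (F (Suc k)) (a (Suc k)) \<le> pw (F k * c k) (a (Suc k))"
    using Suc.prems weights_nonneg[OF Suc.prems(1), of "Suc k"] by (intro pw_mono) auto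
  also have "\<dots> = pw (F k) (a (Suc k)) * pw (c k) (a (Suc k))"
    using Suc.prems by (intro pw_mult) auto
  finally have "flag_prod (Suc k) a F \<le> flag_prod k a F * pw (c k) (a (Suc k))"
    using R by (simp add: mult_left_mono mult.assoc)
  also have "\<dots> \<le> (\<Prod>j<k. pw (c j) (a (Suc j))) * pw (c k) (a (Suc k))"
    using Suc.prems weights_mono[OF Suc.prems(1), of k] by (intro mult_right_mono Suc.IH) auto
  finally show ?case by simp
qed (simp add: flag_prod_def)

lemma flag_prod_prefix:
  assumes "weights k a" "\<And>j. j < k \<Longrightarrow> 0 \<le> c j"
  shows "flag_prod k a (\<lambda>j. \<Prod>i<j. c i) = (\<Prod>j<k. pw (c j) (a (Suc j)))"
  using assms
proof (induction k)
  case (Suc k)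
  let ?F = "\<lambda>j. \<Prod>i<j. c i"
  obtain R where R: "0 \<le> R" "flag_prod (Suc k) a ?F = R * pw (?F (Suc k)) (a (Suc k))"
    "flag_prod k a ?F = R * pw (?F k) (a (Suc k))"
    using flag_prod_Suc[OF Suc.prems(1), of ?F] by auto
  have "pw (?F (Suc k)) (a (Suc k)) = pw (?F k) (a (Suc k)) * pw (c k) (a (Suc k))"
    using Suc.prems(2) by (simp, subst pw_mult) (auto intro!: prod_nonneg)
  then show ?case
    using R Suc.IH weights_mono[OF Suc.prems(1), of k] Suc.prems(2) by simp
qed (simp add: flag_prod_def)

lemma flag_prod_mult:
  assumes "\<And>j. 1 \<le> j \<Longrightarrow> j \<le> k \<Longrightarrow> 0 \<le> F j" "\<And>j. 1 \<le> j \<Longrightarrow> j \<le> k \<Longrightarrow> 0 \<le> G j"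
  shows "flag_prod k a (\<lambda>j. F j * G j) = flag_prod k a F * flag_prod k a G"
  unfolding flag_prod_def prod.distrib[symmetric]
  using assms by (intro prod.cong) (auto simp: pw_mult)

lemma flag_prod_mono:
  assumes "weights k a" "\<And>j. 1 \<le> j \<Longrightarrow> j \<le> k \<Longrightarrow> seq_diff k a j \<noteq> 0 \<Longrightarrow> 0 \<le> F j \<and> F j \<le> G j"
  shows "flag_prod k a F \<le> flag_prod k a G"
  unfolding flag_prod_def
proof (intro prod_mono conjI pw_nonneg)
  fix j assume "j \<in> {1..k}"
  then show "pw (F j) (seq_diff k a j) \<le> pw (G j) (seq_diff k a j)"
    using assms by (cases "seq_diff k a j = 0") (auto intro!: pw_mono seq_diff_nonneg)
qed

text \<open>The additive counterpart. With an indicator for \<open>c\<close> it turns weighted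
  dimensions into sums of weights.\<close>

lemma sum_seq_diff_prefix:
  "(\<Sum>j = 1..k. seq_diff k a j * (\<Sum>i<j. c i)) = (\<Sum>i<k. a (Suc i) * c i)"
proof (induction k)
  case (Suc k)
  have "(\<Sum>j = 1..k. seq_diff (Suc k) a j * (\<Sum>i<j. c i))
      = (\<Sum>j = 1..k. seq_diff k a j * (\<Sum>i<j. c i)) - a (Suc k) * (\<Sum>i<k. c i)"
  proof (cases k)
    case (Suc l)
    have "(\<Sum>j = 1..l. seq_diff (Suc k) a j * (\<Sum>i<j. c i)) = (\<Sum>j = 1..l. seq_diff k a j * (\<Sum>i<j. c i))"
      using Suc by (intro sum.cong) (auto simp: seq_diff_def)
    then show ?thesis using Suc by (simp add: seq_diff_def algebra_simps)
  qed simp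
  then show ?case using Suc.IH by (simp add: seq_diff_def algebra_simps)
qed simp

section \<open>Relative determinants of positive semidefinite matrices\<close>

definition rdet :: "nat \<Rightarrow> (nat \<Rightarrow> real) \<Rightarrow> (nat \<Rightarrow> nat \<Rightarrow> complex) \<Rightarrow> real" where
  "rdet k a M = flag_prod k a (\<lambda>j. pdet j M)"

lemma pdet_0 [simp]: "pdet 0 M = 1"
  by (simp add: pdet_def)

lemma rdet_nonneg: "0 \<le> rdet k a M"
  unfolding rdet_def flag_prod_def by (intro prod_nonneg) auto

lemma rdet_le_diag:
  assumes "weights k a" "psd k M"
  shows "rdet k a M \<le> (\<Prod>j<k. pw (Re (M j j)) (a (Suc j)))"
  unfolding rdet_def
  using assms psd_diag[OF assms(2)]
  by (intro flag_prod_le pdet_Suc_le pdet_nonneg) (auto intro: psd_leading)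

lemma rdet_mono:
  assumes w: "weights k a" and M: "psd k M" and N: "psd k N"
    and le: "\<And>x. Re (quad_form k M x) \<le> Re (quad_form k N x)"
  shows "rdet k a M \<le> rdet k a N"
  unfolding rdet_def
proof (intro flag_prod_mono w conjI)
  fix j assume "j \<le> k"
  then show "0 \<le> pdet j M" using psd_leading[OF M] pdet_nonneg by blast
  have "quad_form j X x = quad_form k X (\<lambda>i. if i < j then x i else 0)" for X x
    using \<open>j \<le> k\<close> by (subst quad_form_restrict[of j]) (auto intro: quad_form_cong)
  then show "pdet j M \<le> pdet j N"
    using \<open>j \<le> k\<close> le by (intro pdet_mono psd_leading[OF M] psd_leading[OF N]) auto
qed

text \<open>An upper triangular \<open>g\<close> preserves the flag, so the leading block of the
  congruent matrix is the congruence of the leading block of \<open>M\<close> by the leading block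
  of \<open>g\<close>.\<close>

lemma fdet_congruence:
  assumes "j \<le> k" "\<And>i l. l < i \<Longrightarrow> i < k \<Longrightarrow> g i l = 0"
  shows "fdet j (\<lambda>a b. \<Sum>i<k. \<Sum>l<k. cnj (g i a) * M i l * g l b)
    = of_real (\<Prod>i<j. (cmod (g i i))\<^sup>2) * fdet j M"
proof -
  have "fdet j (\<lambda>a b. \<Sum>i<k. \<Sum>l<k. cnj (g i a) * M i l * g l b)
      = fdet j (\<lambda>a b. \<Sum>i<j. cnj (g i a) * (\<Sum>l<j. M i l * g l b))"
  proof (rule fdet_cong)
    fix a b assume "a < j" "b < j"
    have "(\<Sum>i<k. \<Sum>l<k. cnj (g i a) * M i l * g l b) = (\<Sum>i<j. \<Sum>l<k. cnj (g i a) * M i l * g l b)"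
      using assms \<open>a < j\<close> by (intro sum.mono_neutral_right) auto
    also have "\<dots> = (\<Sum>i<j. \<Sum>l<j. cnj (g i a) * M i l * g l b)"
      using assms \<open>b < j\<close> by (intro sum.cong refl sum.mono_neutral_right) auto
    finally show "(\<Sum>i<k. \<Sum>l<k. cnj (g i a) * M i l * g l b) = (\<Sum>i<j. cnj (g i a) * (\<Sum>l<j. M i l * g l b))"
      by (simp add: sum_distrib_left mult.assoc)
  qed
  also have "\<dots> = fdet j (\<lambda>a i. cnj (g i a)) * (fdet j M * fdet j g)"
    by (subst fdet_mult, subst fdet_mult) (rule refl)
  also have "fdet j (\<lambda>a i. cnj (g i a)) = cnj (fdet j g)"
    unfolding fdet_cnj by (subst fdet_transpose) (rule refl)
  also have "fdet j g = (\<Prod>i<j. g i i)"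
    using assms by (intro fdet_upper_triangular) auto
  also have "cnj (\<Prod>i<j. g i i) * (fdet j M * (\<Prod>i<j. g i i))
     = (\<Prod>i<j. g i i * cnj (g i i)) * fdet j M"
    by (simp add: prod.distrib mult_ac)
  also have "(\<Prod>i<j. g i i * cnj (g i i)) = of_real (\<Prod>i<j. (cmod (g i i))\<^sup>2)"
    unfolding of_real_prod complex_norm_square ..
  finally show ?thesis .
qed

lemma rdet_congruence:
  assumes w: "weights k a" and M: "psd k M" and g: "\<And>i l. l < i \<Longrightarrow> i < k \<Longrightarrow> g i l = 0"
  shows "rdet k a (\<lambda>a b. \<Sum>i<k. \<Sum>l<k. cnj (g i a) * M i l * g l b)
    = (\<Prod>j<k. pw ((cmod (g j j))\<^sup>2) (a (Suc j))) * rdet k a M"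
proof -
  have "rdet k a (\<lambda>a b. \<Sum>i<k. \<Sum>l<k. cnj (g i a) * M i l * g l b)
     = flag_prod k a (\<lambda>j. (\<Prod>i<j. (cmod (g i i))\<^sup>2) * pdet j M)"
    unfolding rdet_def flag_prod_def
    by (intro prod.cong refl) (simp add: pdet_def fdet_congruence[OF _ g] del: of_real_prod)
  also have "\<dots> = flag_prod k a (\<lambda>j. \<Prod>i<j. (cmod (g i i))\<^sup>2) * rdet k a M"
    unfolding rdet_def
    by (intro flag_prod_mult prod_nonneg pdet_nonneg psd_leading[OF M]) auto
  also have "flag_prod k a (\<lambda>j. \<Prod>i<j. (cmod (g i i))\<^sup>2) = (\<Prod>j<k. pw ((cmod (g j j))\<^sup>2) (a (Suc j)))"
    by (intro flag_prod_prefix w) auto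
  finally show ?thesis .
qed

lemma rdet_scale:
  assumes w: "weights k a" and M: "psd k M" and c: "0 \<le> c"
  shows "rdet k a (\<lambda>i j. of_real c * M i j) = (\<Prod>j<k. pw c (a (Suc j))) * rdet k a M"
proof -
  have "rdet k a (\<lambda>i j. of_real c * M i j) = flag_prod k a (\<lambda>j. (\<Prod>i<j. c) * pdet j M)"
    unfolding rdet_def flag_prod_def
    by (intro prod.cong refl) (simp add: pdet_def fdet_scale_rows flip: of_real_power)
  also have "\<dots> = flag_prod k a (\<lambda>j. \<Prod>i<j. c) * rdet k a M"
    unfolding rdet_def
    using c by (intro flag_prod_mult prod_nonneg pdet_nonneg psd_leading[OF M]) auto
  also have "flag_prod k a (\<lambda>j. \<Prod>i<j. c) = (\<Prod>j<k. pw c (a (Suc j)))"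
    using c by (intro flag_prod_prefix w) auto
  finally show ?thesis .
qed

lemma rdet_cong: "(\<And>i j. i < k \<Longrightarrow> j < k \<Longrightarrow> M i j = N i j) \<Longrightarrow> rdet k a M = rdet k a N"
  unfolding rdet_def flag_prod_def pdet_def
  by (intro prod.cong refl arg_cong2[of _ _ _ _ pw] arg_cong[of _ _ Re] fdet_cong) auto

text \<open>The weighted sum of the rank-one matrices built from the row vectors \<open>w t\<close>,
  conjugated on the left. The index type is left open since the Kraus description uses
  pairs.\<close>

definition gram :: "'i set \<Rightarrow> ('i \<Rightarrow> real) \<Rightarrow> ('i \<Rightarrow> nat \<Rightarrow> complex) \<Rightarrow> nat \<Rightarrow> nat \<Rightarrow> complex" where
  "gram I c w a b = (\<Sum>t\<in>I. of_real (c t) * cnj (w t a) * w t b)"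

lemma quad_form_gram:
  "quad_form k (gram I c w) x = of_real (\<Sum>t\<in>I. c t * (cmod (\<Sum>b<k. w t b * x b))\<^sup>2)"
proof -
  have "quad_form k (gram I c w) x
      = (\<Sum>a<k. \<Sum>b<k. \<Sum>t\<in>I. of_real (c t) * (cnj (w t a * x a) * (w t b * x b)))"
    unfolding quad_form_def gram_def sum_distrib_left sum_distrib_right
    by (intro sum.cong refl) (simp add: mult_ac)
  also have "\<dots> = (\<Sum>a<k. \<Sum>t\<in>I. \<Sum>b<k. of_real (c t) * (cnj (w t a * x a) * (w t b * x b)))"
    by (intro sum.cong refl sum.swap)
  also have "\<dots> = (\<Sum>t\<in>I. \<Sum>a<k. \<Sum>b<k. of_real (c t) * (cnj (w t a * x a) * (w t b * x b)))"
    by (rule sum.swap)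
  also have "\<dots> = (\<Sum>t\<in>I. of_real (c t) * (cnj (\<Sum>b<k. w t b * x b) * (\<Sum>b<k. w t b * x b)))"
    by (simp only: cnj_sum sum_product) (simp only: sum_distrib_left complex_cnj_mult)
  also have "\<dots> = (\<Sum>t\<in>I. of_real (c t) * ((\<Sum>b<k. w t b * x b) * cnj (\<Sum>b<k. w t b * x b)))"
    by (simp only: mult.commute)
  also have "\<dots> = of_real (\<Sum>t\<in>I. c t * (cmod (\<Sum>b<k. w t b * x b))\<^sup>2)"
    unfolding of_real_sum of_real_mult complex_norm_square ..
  finally show ?thesis .
qed

lemma psd_gram:
  assumes "\<And>t. t \<in> I \<Longrightarrow> 0 \<le> c t"
  shows "psd k (gram I c w)"
proof (rule psdI)
  fix x show "0 \<le> Re (quad_form k (gram I c w) x)"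
    unfolding quad_form_gram using assms by (auto intro!: sum_nonneg)
qed (simp add: gram_def mult_ac)

lemma quad_form_gram_mono:
  assumes "\<And>t. t \<in> I \<Longrightarrow> c t \<le> d t"
  shows "Re (quad_form k (gram I c w) x) \<le> Re (quad_form k (gram I d w) x)"
  unfolding quad_form_gram using assms by (auto intro!: sum_mono mult_right_mono)

text \<open>One term of the Cauchy-Binet expansion, all of whose terms are nonnegative. Instead of
  expanding, the weights outside \<open>S\<close> are set to 0, which can only lower the form; the
  remaining matrix is a product of square matrices.\<close>

lemma pdet_gram_ge:
  assumes I: "finite I" and c: "\<And>t. t \<in> I \<Longrightarrow> 0 \<le> c t" and \<kappa>: "bij_betw \<kappa> {..<k} S" "S \<subseteq> I"
  shows "(\<Prod>t\<in>S. c t) * (cmod (fdet k (\<lambda>e. w (\<kappa> e))))\<^sup>2 \<le> pdet k (gram I c w)"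
proof -
  define d where "d t = (if t \<in> S then c t else 0)" for t
  have "gram I d w a b = (\<Sum>e<k. cnj (w (\<kappa> e) a) * (of_real (c (\<kappa> e)) * w (\<kappa> e) b))" for a b
  proof -
    have "gram I d w a b = (\<Sum>t\<in>S. of_real (d t) * cnj (w t a) * w t b)"
      unfolding gram_def using I \<kappa>(2) by (intro sum.mono_neutral_right) (auto simp: d_def)
    also have "\<dots> = (\<Sum>t\<in>S. cnj (w t a) * (of_real (c t) * w t b))"
      by (intro sum.cong) (auto simp: d_def)
    also have "\<dots> = (\<Sum>e<k. cnj (w (\<kappa> e) a) * (of_real (c (\<kappa> e)) * w (\<kappa> e) b))"
      by (rule sum.reindex_bij_betw[OF \<kappa>(1), symmetric])
    finally show ?thesis .
  qed
  then have "fdet k (gram I d w)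
      = fdet k (\<lambda>a b. \<Sum>e<k. cnj (w (\<kappa> e) a) * (of_real (c (\<kappa> e)) * w (\<kappa> e) b))"
    by (intro fdet_cong)
  also have "\<dots> = fdet k (\<lambda>a e. cnj (w (\<kappa> e) a)) * fdet k (\<lambda>e b. of_real (c (\<kappa> e)) * w (\<kappa> e) b)"
    by (rule fdet_mult)
  also have "fdet k (\<lambda>a e. cnj (w (\<kappa> e) a)) = cnj (fdet k (\<lambda>e. w (\<kappa> e)))"
    unfolding fdet_cnj by (subst fdet_transpose) (rule refl)
  also have "fdet k (\<lambda>e b. of_real (c (\<kappa> e)) * w (\<kappa> e) b) = of_real (\<Prod>e<k. c (\<kappa> e)) * fdet k (\<lambda>e. w (\<kappa> e))"
    by (simp add: fdet_scale_rows)
  also have "(\<Prod>e<k. c (\<kappa> e)) = (\<Prod>t\<in>S. c t)"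
    by (rule prod.reindex_bij_betw[OF \<kappa>(1)])
  finally have "fdet k (gram I d w)
      = of_real (\<Prod>t\<in>S. c t) * (fdet k (\<lambda>e. w (\<kappa> e)) * cnj (fdet k (\<lambda>e. w (\<kappa> e))))"
    by (simp only: mult_ac)
  also have "\<dots> = of_real ((\<Prod>t\<in>S. c t) * (cmod (fdet k (\<lambda>e. w (\<kappa> e))))\<^sup>2)"
    unfolding of_real_mult complex_norm_square ..
  finally have "pdet k (gram I d w) = (\<Prod>t\<in>S. c t) * (cmod (fdet k (\<lambda>e. w (\<kappa> e))))\<^sup>2"
    unfolding pdet_def by (simp only: Re_complex_of_real)
  moreover have "pdet k (gram I d w) \<le> pdet k (gram I c w)"
    using c by (intro pdet_mono psd_gram quad_form_gram_mono) (auto simp: d_def)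
  ultimately show ?thesis by simp
qed


section \<open>Pivots of subspaces\<close>

lemma csubspaceI:
  assumes "L \<subseteq> carrier_vec k" "0\<^sub>v k \<in> L" "\<And>x y. x \<in> L \<Longrightarrow> y \<in> L \<Longrightarrow> x + y \<in> L"
    "\<And>c x. x \<in> L \<Longrightarrow> c \<cdot>\<^sub>v x \<in> L"
  shows "csubspace k L"
proof -
  interpret vec_space "TYPE(complex)" k .
  show ?thesis
    unfolding csubspace_def subspace_def submodule_def
    using assms vectorspace_axioms module_axioms by (auto simp: module_vec_simps)
qed

lemma csubspaceD:
  assumes "csubspace k L"
  shows "L \<subseteq> carrier_vec k" "0\<^sub>v k \<in> L" "x \<in> L \<Longrightarrow> y \<in> L \<Longrightarrow> x + y \<in> L"
    "x \<in> L \<Longrightarrow> c \<cdot>\<^sub>v x \<in> L"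
proof -
  have s: "submodule class_ring L (cvec_space k)"
    using assms unfolding csubspace_def subspace_def by blast
  show "L \<subseteq> carrier_vec k" "0\<^sub>v k \<in> L"
    using submodule.subset[OF s] submodule.zero_closed[OF s] by (auto simp: module_vec_simps)
  show "x \<in> L \<Longrightarrow> y \<in> L \<Longrightarrow> x + y \<in> L"
    using submodule.m_closed[OF s, of x y] by (simp add: module_vec_simps)
  show "x \<in> L \<Longrightarrow> c \<cdot>\<^sub>v x \<in> L"
    using submodule.smult_closed[OF s, of c x] by (simp add: module_vec_simps)
qed

definition has_pivot :: "nat \<Rightarrow> nat \<Rightarrow> complex vec \<Rightarrow> bool" where
  "has_pivot k e x \<longleftrightarrow> x $ e \<noteq> 0 \<and> (\<forall>j. e < j \<longrightarrow> j < k \<longrightarrow> x $ j = 0)"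

text \<open>The places where the dimension of the intersection of L with the flag jumps: a vector
  with pivot e lies in the flag space of index e + 1 but not in that of index e. Dimensions thereby
  become cardinalities.\<close>

definition pivots :: "nat \<Rightarrow> complex vec set \<Rightarrow> nat set" where
  "pivots k L = {e. e < k \<and> (\<exists>x\<in>L. has_pivot k e x)}"

definition coord_space :: "nat \<Rightarrow> nat \<Rightarrow> complex vec set" where
  "coord_space k i = {x \<in> carrier_vec k. \<forall>j. i \<le> j \<longrightarrow> j < k \<longrightarrow> x $ j = 0}"

text \<open>Echelon reduction from the last coordinate downwards: a multiple of \<open>v i\<close>
  cancels coordinate \<open>i\<close> and leaves a vector of the same subspace one step lower in the
  flag.\<close>

lemma csubspace_span_pivots:
  assumes L: "csubspace k L" and i: "i \<le> k"
    and v: "\<And>e. e \<in> pivots k L \<Longrightarrow> e < i \<Longrightarrow> v e \<in> L \<and> has_pivot k e (v e)"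
    and x: "x \<in> coord_space k i \<inter> L"
  shows "x \<in> LinearCombinations.module.span class_ring (cvec_space k) (v ` (pivots k L \<inter> {..<i}))"
  using i v x
proof (induction i arbitrary: x)
  case 0
  interpret vec_space "TYPE(complex)" k .
  have "x = 0\<^sub>v k" using "0.prems" by (intro eq_vecI) (auto simp: coord_space_def)
  moreover have "pivots k L \<inter> {..<0} = {}" by auto
  ultimately show ?case by (simp add: span_empty)
next
  case (Suc i)
  interpret vec_space "TYPE(complex)" k .
  let ?S = "\<lambda>i. v ` (pivots k L \<inter> {..<i})"
  have sub: "?S (Suc i) \<subseteq> carrier_vec k"
    using Suc.prems(2) csubspaceD(1)[OF L] by auto
  have mono: "span (?S i) \<subseteq> span (?S (Suc i))"
    by (intro span_is_monotone) auto
  have IH: "y \<in> span (?S (Suc i))" if "y \<in> coord_space k i \<inter> L" for y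
    using Suc.IH[OF _ _ that] Suc.prems(1,2) mono by (auto simp: less_Suc_eq)
  show ?case
  proof (cases "x $ i = 0")
    case True
    then have "x \<in> coord_space k i \<inter> L"
      using Suc.prems(3) by (auto simp: coord_space_def) (metis Suc_leI le_neq_implies_less)
    then show ?thesis by (rule IH)
  next
    case False
    then have "has_pivot k i x" using Suc.prems(3) by (auto simp: has_pivot_def coord_space_def)
    then have p: "i \<in> pivots k L" using Suc.prems by (auto simp: pivots_def)
    then have vi: "v i \<in> L" "has_pivot k i (v i)" using Suc.prems(2) by auto
    have xc: "x \<in> carrier_vec k" and vc: "v i \<in> carrier_vec k"
      using Suc.prems(3) vi csubspaceD(1)[OF L] by auto
    define c where "c = x $ i / v i $ i"
    define y where "y = x + (- c) \<cdot>\<^sub>v v i"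
    have "y \<in> L" unfolding y_def using Suc.prems(3) vi csubspaceD[OF L] by blast
    moreover have "y $ j = 0" if "i \<le> j" "j < k" for j
    proof (cases "j = i")
      case True
      then show ?thesis using that xc vc vi by (simp add: y_def c_def has_pivot_def)
    next
      case False
      then show ?thesis using that xc vc vi Suc.prems(3)
        by (simp add: y_def has_pivot_def coord_space_def)
    qed
    ultimately have "y \<in> coord_space k i \<inter> L"
      using csubspaceD(1)[OF L] by (auto simp: coord_space_def)
    then have ys: "y \<in> span (?S (Suc i))" by (rule IH)
    have "v i \<in> span (?S (Suc i))" using p sub by (intro in_own_span[THEN subsetD]) auto
    then have "c \<cdot>\<^sub>v v i \<in> span (?S (Suc i))"
      using submodule.smult_closed[OF span_is_submodule[OF sub], of c "v i"] by (simp add: module_vec_simps)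
    then have "y + c \<cdot>\<^sub>v v i \<in> span (?S (Suc i))"
      using submodule.m_closed[OF span_is_submodule[OF sub] ys] by (simp add: module_vec_simps)
    moreover have "y + c \<cdot>\<^sub>v v i = x"
      using xc vc by (intro eq_vecI) (auto simp: y_def)
    ultimately show ?thesis by simp
  qed
qed

lemma csubspace_coord_space: "csubspace k (coord_space k i)"
  by (intro csubspaceI) (auto simp: coord_space_def)

lemma csubspace_Int: "csubspace k L \<Longrightarrow> csubspace k M \<Longrightarrow> csubspace k (L \<inter> M)"
  using csubspaceD[of k L] csubspaceD[of k M] by (intro csubspaceI) auto

lemma csubspace_carrier: "csubspace k (carrier_vec k)"
  by (intro csubspaceI) auto

lemma flag_space_eq:
  assumes "i \<le> k"
  shows "flag_space k i = coord_space k i"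
proof
  interpret vec_space "TYPE(complex)" k .
  have "submodule class_ring (coord_space k i) V"
    using csubspace_coord_space unfolding csubspace_def subspace_def by blast
  moreover have "unit_vec k ` {..<i} \<subseteq> coord_space k i"
    using assms by (auto simp: coord_space_def)
  ultimately show "flag_space k i \<subseteq> coord_space k i"
    unfolding flag_space_def by (intro span_is_subset)
  have piv: "has_pivot k e (unit_vec k e)" if "e < k" for e
    using that by (auto simp: has_pivot_def)
  have "e \<in> pivots k (carrier_vec k)" if "e < k" for e
    unfolding pivots_def using that piv[OF that] unit_vec_carrier[of k e] by (intro CollectI conjI bexI)
  then have "pivots k (carrier_vec k) \<inter> {..<i} = {..<i}" using assms by auto
  then show "coord_space k i \<subseteq> flag_space k i"
    unfolding flag_space_def
    using csubspace_span_pivots[OF csubspace_carrier assms, of "unit_vec k"] piv assms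
    by (auto simp: coord_space_def)
qed

text \<open>One vector for each pivot below \<open>i\<close> gives a basis. These vectors span by
  echelon reduction and are independent because their last nonzero coordinates differ.\<close>

lemma dim_flag_space_Int:
  assumes L: "csubspace k L" and i: "i \<le> k"
  shows "subspace_dim k (flag_space k i \<inter> L) = card (pivots k L \<inter> {..<i})"
proof -
  interpret vec_space "TYPE(complex)" k .
  let ?W = "coord_space k i \<inter> L"
  let ?P = "pivots k L \<inter> {..<i}"
  have "\<forall>e\<in>pivots k L. \<exists>x. x \<in> L \<and> has_pivot k e x" by (auto simp: pivots_def)
  then obtain v where v: "\<And>e. e \<in> pivots k L \<Longrightarrow> v e \<in> L \<and> has_pivot k e (v e)"
    using bchoice[of "pivots k L" "\<lambda>e x. x \<in> L \<and> has_pivot k e x"] by blast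
  have inj: "inj_on v ?P"
  proof (rule inj_onI)
    fix e f assume ef: "e \<in> ?P" "f \<in> ?P" "v e = v f"
    then have "has_pivot k e (v e)" "has_pivot k f (v e)" "e < k" "f < k"
      using v[of e] v[of f] by (auto simp: pivots_def)
    then show "e = f" unfolding has_pivot_def by (metis nat_neq_iff)
  qed
  have "csubspace k ?W" by (intro csubspace_Int csubspace_coord_space L)
  then have W: "subspace class_ring ?W V" unfolding csubspace_def .
  then have Wm: "submodule class_ring ?W V" unfolding subspace_def by blast
  interpret W: vectorspace class_ring "V\<lparr>carrier := ?W\<rparr>"
    using subspace_is_vs[OF W] by simp
  have sub: "v ` ?P \<subseteq> ?W"
    using v csubspaceD(1)[OF L] by (fastforce simp: coord_space_def has_pivot_def)
  then have subV: "v ` ?P \<subseteq> carrier_vec k"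
    using csubspaceD(1)[OF L] by auto
  have "W.basis (v ` ?P)"
    unfolding W.basis_def
  proof (intro conjI)
    show "v ` ?P \<subseteq> carrier (V\<lparr>carrier := ?W\<rparr>)" using sub by simp
    have "?W \<subseteq> span (v ` ?P)"
      using csubspace_span_pivots[OF L i, of v] v by blast
    moreover have "span (v ` ?P) \<subseteq> ?W" using span_is_subset[OF sub Wm] .
    ultimately show "W.span (v ` ?P) = carrier (V\<lparr>carrier := ?W\<rparr>)"
      using span_li_not_depend(1)[OF sub Wm] by simp
    have "\<not> lin_dep (v ` ?P)"
    proof
      assume "lin_dep (v ` ?P)"
      moreover have "finite (v ` ?P)" by simp
      ultimately obtain a w where a: "lincomb a (v ` ?P) = 0\<^sub>v k" "w \<in> v ` ?P" "a w \<noteq> 0"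
        using finite_lin_dep[of "v ` ?P"] subV by (auto simp: module_vec_simps)
      let ?N = "{e \<in> ?P. a (v e) \<noteq> 0}"
      have N: "finite ?N" "?N \<noteq> {}" using a by auto
      \<comment> \<open>At the largest pivot with nonzero coefficient, vectors with smaller pivots
        vanish and those with larger pivots do not occur in the combination.\<close>
      define e where "e = Max ?N"
      have e: "e \<in> ?N" unfolding e_def using N by (rule Max_in)
      then have ek: "e < k" by (auto simp: pivots_def)
      have "lincomb a (v ` ?P) $ e = (\<Sum>x\<in>v ` ?P. a x * x $ e)"
        by (rule lincomb_index[OF ek subV])
      also have "\<dots> = (\<Sum>f\<in>?P. a (v f) * v f $ e)"
        by (rule sum.reindex_cong[OF inj]) auto
      also have "\<dots> = (\<Sum>f\<in>{e}. a (v f) * v f $ e)"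
      proof (intro sum.mono_neutral_right)
        show "\<forall>f\<in>?P - {e}. a (v f) * v f $ e = 0"
        proof
          fix f assume f: "f \<in> ?P - {e}"
          show "a (v f) * v f $ e = 0"
          proof (cases "f < e")
            case True
            then show ?thesis using v[of f] f ek by (auto simp: has_pivot_def)
          next
            case False
            have "f \<notin> ?N"
            proof
              assume "f \<in> ?N"
              then have "f \<le> e" unfolding e_def using N by (intro Max_ge)
              then show False using False f by auto
            qed
            then show ?thesis using f by auto
          qed
        qed
      qed (use e in auto)
      finally have "a (v e) * v e $ e = 0" using a(1) ek by simp
      then show False using e v[of e] by (auto simp: has_pivot_def)
    qed
    then show "\<not> W.lin_dep (v ` ?P)"
      using span_li_not_depend(2)[OF sub Wm] by simp
  qed
  then have "W.dim = card (v ` ?P)" by (intro W.dim_basis) auto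
  then show ?thesis
    unfolding subspace_dim_def flag_space_eq[OF i] using card_image[OF inj] by simp
qed

text \<open>The pairing is bilinear, without conjugation: where orthogonality is meant, the
  conjugate already sits in the vectors of \<open>W\<close>, as in \<open>kraus_vec\<close>.\<close>

definition annihilator :: "nat \<Rightarrow> (nat \<Rightarrow> complex) set \<Rightarrow> complex vec set" where
  "annihilator k W = {x \<in> carrier_vec k. \<forall>w\<in>W. (\<Sum>a<k. w a * x $ a) = 0}"

lemma csubspace_annihilator: "csubspace k (annihilator k W)"
proof (rule csubspaceI)
  fix x y assume "x \<in> annihilator k W" "y \<in> annihilator k W"
  then show "x + y \<in> annihilator k W"
    by (auto simp: annihilator_def distrib_left sum.distrib)
next
  fix c x assume x: "x \<in> annihilator k W"
  have "(\<Sum>a<k. w a * (c \<cdot>\<^sub>v x) $ a) = c * (\<Sum>a<k. w a * x $ a)" for w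
    using x by (auto simp: annihilator_def sum_distrib_left mult_ac intro!: sum.cong)
  then show "c \<cdot>\<^sub>v x \<in> annihilator k W"
    using x by (auto simp: annihilator_def)
qed (auto simp: annihilator_def)

text \<open>One further equation destroys at most one pivot: among the pivot vectors not killed by it, take
  the one with the smallest pivot and use it to correct the others.\<close>

lemma card_pivots_annihilator_ge:
  assumes "finite W" "i \<le> k"
  shows "i \<le> card (pivots k (annihilator k W) \<inter> {..<i}) + card W"
  using assms(1)
proof induction
  case empty
  have "e \<in> pivots k (annihilator k {})" if "e < k" for e
  proof -
    have "unit_vec k e \<in> annihilator k {}" "has_pivot k e (unit_vec k e)"
      using that by (auto simp: annihilator_def has_pivot_def)
    then show ?thesis unfolding pivots_def using that by (intro CollectI conjI bexI)
  qed
  then have "pivots k (annihilator k {}) \<inter> {..<i} = {..<i}" using assms(2) by auto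
  then show ?case by simp
next
  case (insert w W)
  let ?L = "annihilator k W" and ?M = "annihilator k (insert w W)"
  let ?f = "\<lambda>x. \<Sum>a<k. w a * x $ a"
  have M: "x \<in> ?M \<longleftrightarrow> x \<in> ?L \<and> ?f x = 0" for x by (auto simp: annihilator_def)
  let ?B = "{e \<in> pivots k ?L. \<exists>x\<in>?L. has_pivot k e x \<and> ?f x \<noteq> 0}"
  have "\<exists>e0. pivots k ?L - {e0} \<subseteq> pivots k ?M"
  proof (cases "?B = {}")
    case True
    have "pivots k ?L \<subseteq> pivots k ?M"
    proof
      fix e assume e: "e \<in> pivots k ?L"
      then obtain x where "x \<in> ?L" "has_pivot k e x" by (auto simp: pivots_def)
      then show "e \<in> pivots k ?M" using True e M by (auto simp: pivots_def)
    qed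
    then show ?thesis by auto
  next
    case False
    define e0 where "e0 = (LEAST e. e \<in> ?B)"
    have "e0 \<in> ?B" unfolding e0_def using False by (metis (no_types, lifting) LeastI ex_in_conv)
    then obtain x0 where x0: "x0 \<in> ?L" "has_pivot k e0 x0" "?f x0 \<noteq> 0" by auto
    have "pivots k ?L - {e0} \<subseteq> pivots k ?M"
    proof
      fix e assume e: "e \<in> pivots k ?L - {e0}"
      then obtain x where x: "x \<in> ?L" "has_pivot k e x" and ek: "e < k" by (auto simp: pivots_def)
      show "e \<in> pivots k ?M"
      proof (cases "?f x = 0")
        case True then show ?thesis using x ek M by (auto simp: pivots_def)
      next
        case False
        then have "e \<in> ?B" using x e by auto
        then have "e0 \<le> e" unfolding e0_def by (rule Least_le)
        then have lt: "e0 < e" using e by auto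
        define c where "c = ?f x / ?f x0"
        define y where "y = x + (- c) \<cdot>\<^sub>v x0"
        have car: "x \<in> carrier_vec k" "x0 \<in> carrier_vec k" using x x0 by (auto simp: annihilator_def)
        have y: "y $ a = x $ a - c * x0 $ a" if "a < k" for a using car that by (simp add: y_def)
        have "y \<in> ?L" unfolding y_def
          using csubspaceD(3,4)[OF csubspace_annihilator] x x0 by blast
        moreover have "?f y = ?f x - c * ?f x0"
          by (simp add: y sum_distrib_left sum_subtractf[symmetric] algebra_simps)
        then have "?f y = 0" using x0(3) by (simp add: c_def)
        moreover have "has_pivot k e y"
          using x(2) x0(2) lt ek by (auto simp: has_pivot_def y)
        ultimately show ?thesis using ek M by (auto simp: pivots_def)
      qed
    qed
    then show ?thesis by blast
  qed
  then obtain e0 where e0: "pivots k ?L - {e0} \<subseteq> pivots k ?M" by blast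
  have "card (pivots k ?L \<inter> {..<i}) \<le> card (insert e0 (pivots k ?M \<inter> {..<i}))"
    using e0 by (intro card_mono) auto
  also have "\<dots> \<le> Suc (card (pivots k ?M \<inter> {..<i}))"
    by (simp add: card_insert_if)
  finally show ?case using insert by simp
qed

text \<open>A vector with pivot below \<open>i\<close> lies in the flag space of index
  \<open>i\<close>. Membership in \<open>L\<close> thus has to be checked there only, where each
  equation sees just its first \<open>i\<close> coefficients.\<close>

lemma card_pivots_ge:
  assumes "finite W" "i \<le> k"
    and sub: "\<And>x. x \<in> annihilator k W \<Longrightarrow> x \<in> coord_space k i \<Longrightarrow> x \<in> L"
  shows "i \<le> card (pivots k L \<inter> {..<i}) + card W"
proof -
  have "pivots k (annihilator k W) \<inter> {..<i} \<subseteq> pivots k L \<inter> {..<i}"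
  proof
    fix e assume e: "e \<in> pivots k (annihilator k W) \<inter> {..<i}"
    then obtain x where x: "x \<in> annihilator k W" "has_pivot k e x" by (auto simp: pivots_def)
    then have "x \<in> coord_space k i"
      using e by (auto simp: coord_space_def has_pivot_def annihilator_def)
    then show "e \<in> pivots k L \<inter> {..<i}" using x sub e by (auto simp: pivots_def)
  qed
  then have "card (pivots k (annihilator k W) \<inter> {..<i}) \<le> card (pivots k L \<inter> {..<i})"
    by (intro card_mono) auto
  then show ?thesis using card_pivots_annihilator_ge[OF assms(1,2)] by linarith
qed


section \<open>Relative determinants and capacity in terms of entries\<close>

lemma GL_flag_iff:
  "h \<in> GL_flag k \<longleftrightarrow> h \<in> carrier_mat k k \<and> (\<forall>i j. j < i \<longrightarrow> i < k \<longrightarrow> h $$ (i, j) = 0)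
     \<and> (\<forall>i<k. h $$ (i, i) \<noteq> 0)"
proof (cases "h \<in> carrier_mat k k \<and> upper_triangular h")
  case True
  then have h: "h \<in> carrier_mat k k" and ut: "upper_triangular h" by auto
  have "Determinant.det h = (\<Prod>i = 0..<k. h $$ (i, i))"
    using det_upper_triangular[OF ut h] h by (simp add: prod_list_diag_prod)
  then have det: "Determinant.det h \<noteq> 0 \<longleftrightarrow> (\<forall>i<k. h $$ (i, i) \<noteq> 0)" by auto
  have "invertible_mat h \<longleftrightarrow> Determinant.det h \<noteq> 0"
  proof
    assume "invertible_mat h"
    then obtain B where B: "h * B = 1\<^sub>m k" "B * h = 1\<^sub>m (dim_row B)"
      using h by (auto simp: invertible_mat_def inverts_mat_def)
    have "dim_col B = k" using arg_cong[OF B(1), of dim_col] by simp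
    moreover have "dim_row B = k" using arg_cong[OF B(2), of dim_col] h by simp
    ultimately have "B \<in> carrier_mat k k" by auto
    then have "Determinant.det h * Determinant.det B = 1"
      using Determinant.det_mult[OF h, of B] B(1) by simp
    then show "Determinant.det h \<noteq> 0" by auto
  next
    assume nz: "Determinant.det h \<noteq> 0"
    define B where "B = (1 / Determinant.det h) \<cdot>\<^sub>m adj_mat h"
    note a = adj_mat[OF h]
    have "h * B = (1 / Determinant.det h) \<cdot>\<^sub>m (h * adj_mat h)"
      unfolding B_def by (rule mult_smult_distrib[OF h a(1)])
    then have 1: "h * B = 1\<^sub>m k" using a(2) nz by (simp, intro eq_matI) auto
    have "B * h = (1 / Determinant.det h) \<cdot>\<^sub>m (adj_mat h * h)"
      unfolding B_def by (rule mult_smult_assoc_mat[OF a(1) h])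
    then have 2: "B * h = 1\<^sub>m k" using a(3) nz by (simp, intro eq_matI) auto
    show "invertible_mat h"
      unfolding invertible_mat_def inverts_mat_def using h 1 2 a(1)
      by (auto simp: B_def intro!: exI[of _ B])
  qed
  then show ?thesis using h ut det by (auto simp: GL_flag_def upper_triangular_def)
next
  case False
  then show ?thesis by (auto simp: GL_flag_def upper_triangular_def)
qed

abbreviation entries :: "complex mat \<Rightarrow> nat \<Rightarrow> nat \<Rightarrow> complex" where
  "entries X \<equiv> \<lambda>i j. X $$ (i, j)"

lemma det_eta:
  assumes X: "X \<in> carrier_mat k k" and j: "j \<le> k"
  shows "Determinant.det (eta j k * X * mat_adjoint (eta j k)) = fdet j (entries X)"
proof -
  have e: "eta j k \<in> carrier_mat j k" by (simp add: eta_def)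
  note e' = mat_adjoint_carrier[OF e]
  have "eta j k * X * mat_adjoint (eta j k) = mat j j (\<lambda>(a, b). X $$ (a, b))"
  proof (rule eq_matI)
    fix a b assume "a < dim_row (mat j j (\<lambda>(a, b). X $$ (a, b)))" "b < dim_col (mat j j (\<lambda>(a, b). X $$ (a, b)))"
    then have ab: "a < j" "b < j" by auto
    have "(eta j k * X * mat_adjoint (eta j k)) $$ (a, b)
        = (\<Sum>l<k. (\<Sum>i<k. eta j k $$ (a, i) * X $$ (i, l)) * mat_adjoint (eta j k) $$ (l, b))"
      by (rule mat_mult3_index[OF e X e' ab])
    also have "\<dots> = (\<Sum>l<k. (\<Sum>i<k. if i = a then X $$ (i, l) else 0) * (if l = b then 1 else 0))"
      using ab j mat_adjoint_index[OF e]
      by (intro sum.cong refl arg_cong2[of _ _ _ _ "(*)"]) (auto simp: eta_def)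
    also have "\<dots> = (\<Sum>l<k. if l = b then X $$ (a, l) else 0)"
      using ab j by (intro sum.cong refl) auto
    also have "\<dots> = X $$ (a, b)" using ab j by simp
    finally show "(eta j k * X * mat_adjoint (eta j k)) $$ (a, b) = mat j j (\<lambda>(a, b). X $$ (a, b)) $$ (a, b)"
      using ab by simp
  qed (use e e' in auto)
  then show ?thesis by (simp add: fdet_def)
qed

lemma rel_det_psd:
  assumes X: "X \<in> carrier_mat k k" and p: "psd k (entries X)"
  shows "rel_det k a X = of_real (rdet k a (entries X))"
proof -
  have "(if seq_diff k a j = 0 then 1
       else Determinant.det (eta j k * X * mat_adjoint (eta j k)) powr complex_of_real (seq_diff k a j))
     = of_real (pw (pdet j (entries X)) (seq_diff k a j))" if "j \<in> {1..k}" for j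
  proof -
    have pj: "psd j (entries X)" using psd_leading[OF p] that by auto
    have "Determinant.det (eta j k * X * mat_adjoint (eta j k)) = of_real (pdet j (entries X))"
      using det_eta[OF X, of j] fdet_psd[OF pj] that by simp
    then show ?thesis
      using pdet_nonneg[OF pj] by (simp add: pw_def powr_of_real)
  qed
  then show ?thesis
    unfolding rel_det_def rdet_def flag_prod_def of_real_prod by (intro prod.cong) auto
qed

lemma rdet_identity:
  "weights k a \<Longrightarrow> psd k (\<lambda>i j. if i = j then 1 else 0) \<and> rdet k a (\<lambda>i j. if i = j then 1 else 0) = 1"
proof
  show "psd k (\<lambda>i j. if i = j then 1 else 0)"
  proof (rule psdI)
    fix x
    have "quad_form k (\<lambda>i j. if i = j then 1 else 0) x = (\<Sum>i<k. cnj (x i) * x i)"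
      unfolding quad_form_def
      by (intro sum.cong refl) (simp add: if_distrib if_distribR cong: if_cong)
    also have "\<dots> = of_real (\<Sum>i<k. (cmod (x i))\<^sup>2)"
      unfolding of_real_sum complex_norm_square by (simp add: mult.commute)
    finally show "0 \<le> Re (quad_form k (\<lambda>i j. if i = j then 1 else 0) x)"
      by (simp add: sum_nonneg)
  qed auto
  have "pdet j (\<lambda>i j. if i = j then 1 else 0) = 1" for j
    unfolding pdet_def by (subst fdet_upper_triangular) auto
  then show "rdet k a (\<lambda>i j. if i = j then 1 else 0) = 1"
    by (simp add: rdet_def flag_prod_def)
qed

text \<open>The matrix is the congruence of the identity by \<open>h\<close>, so the denominator of
  the capacity depends only on the diagonal of \<open>h\<close>.\<close>

lemma rel_det_adjoint_mult:
  assumes w: "weights k a" and h: "h \<in> GL_flag k"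
  shows "rel_det k a (mat_adjoint h * h) = of_real (\<Prod>j<k. pw ((cmod (h $$ (j, j)))\<^sup>2) (a (Suc j)))"
proof -
  have hc: "h \<in> carrier_mat k k" using h by (simp add: GL_flag_iff)
  note h' = mat_adjoint_carrier[OF hc]
  let ?I = "\<lambda>i j. if i = j then 1 else 0 :: complex"
  have e: "(mat_adjoint h * h) $$ (a, b) = gram {..<k} (\<lambda>_. 1) (entries h) a b" if "a < k" "b < k" for a b
    using that hc h' by (simp add: gram_def scalar_prod_def lessThan_atLeast0 mat_adjoint_index[OF hc])
  have e2: "(mat_adjoint h * h) $$ (a, b) = (\<Sum>i<k. \<Sum>l<k. cnj (h $$ (i, a)) * ?I i l * h $$ (l, b))"
    if "a < k" "b < k" for a b
    unfolding e[OF that] gram_def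
    by (intro sum.cong refl) (simp add: if_distrib if_distribR cong: if_cong)
  have "psd k (entries (mat_adjoint h * h))"
  proof (rule psdI)
    fix i j assume "i < k" "j < k"
    then show "(mat_adjoint h * h) $$ (j, i) = cnj ((mat_adjoint h * h) $$ (i, j))"
      by (simp only: e) (simp add: gram_def mult.commute)
  next
    fix x
    have "quad_form k (entries (mat_adjoint h * h)) x = quad_form k (gram {..<k} (\<lambda>_. 1) (entries h)) x"
      unfolding quad_form_def by (intro sum.cong refl) (simp only: e lessThan_iff)
    then show "0 \<le> Re (quad_form k (entries (mat_adjoint h * h)) x)"
      using psd_quad_form[OF psd_gram[of "{..<k}" "\<lambda>_. 1"]] by simp
  qed
  then have "rel_det k a (mat_adjoint h * h) = of_real (rdet k a (entries (mat_adjoint h * h)))"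
    using hc h' by (intro rel_det_psd) auto
  also have "rdet k a (entries (mat_adjoint h * h))
      = rdet k a (\<lambda>a b. \<Sum>i<k. \<Sum>l<k. cnj (h $$ (i, a)) * ?I i l * h $$ (l, b))"
    by (intro rdet_cong e2)
  also have "\<dots> = (\<Prod>j<k. pw ((cmod (h $$ (j, j)))\<^sup>2) (a (Suc j)))"
    using rdet_identity[OF w] h by (subst rdet_congruence[OF w]) (auto simp: GL_flag_iff)
  finally show ?thesis .
qed

lemma psd_cong:
  assumes "psd k M" "\<And>i j. i < k \<Longrightarrow> j < k \<Longrightarrow> N i j = M i j"
  shows "psd k N"
proof (rule psdI)
  fix i j assume ij: "i < k" "j < k"
  show "N j i = cnj (N i j)"
    unfolding assms(2)[OF ij] assms(2)[OF ij(2,1)] by (rule psd_hermitian[OF assms(1) ij])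
next
  fix x
  have "quad_form k N x = quad_form k M x"
    unfolding quad_form_def by (intro sum.cong refl) (simp add: assms(2))
  then show "0 \<le> Re (quad_form k N x)" using psd_quad_form[OF assms(1)] by simp
qed

section \<open>Completely positive maps as Gram matrices\<close>

lemma cp_map_index:
  assumes A: "\<And>i. i \<in> {1..r} \<Longrightarrow> A i \<in> carrier_mat m n" and X: "X \<in> carrier_mat n n"
    and ab: "a < m" "b < m"
  shows "cp_map m r A X $$ (a, b)
    = (\<Sum>l = 1..r. \<Sum>i<n. \<Sum>j<n. A l $$ (a, i) * X $$ (i, j) * cnj (A l $$ (b, j)))"
proof -
  have "(A l * X * mat_adjoint (A l)) $$ (a, b)
      = (\<Sum>i<n. \<Sum>j<n. A l $$ (a, i) * X $$ (i, j) * cnj (A l $$ (b, j)))" if "l \<in> {1..r}" for l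
  proof -
    note Al = A[OF that] and Al' = mat_adjoint_carrier[OF A[OF that]]
    have "(A l * X * mat_adjoint (A l)) $$ (a, b)
        = (\<Sum>j<n. (\<Sum>i<n. A l $$ (a, i) * X $$ (i, j)) * mat_adjoint (A l) $$ (j, b))"
      by (rule mat_mult3_index[OF Al X Al' ab])
    also have "\<dots> = (\<Sum>j<n. \<Sum>i<n. A l $$ (a, i) * X $$ (i, j) * cnj (A l $$ (b, j)))"
      using ab by (simp add: mat_adjoint_index[OF Al] sum_distrib_right)
    also have "\<dots> = (\<Sum>i<n. \<Sum>j<n. A l $$ (a, i) * X $$ (i, j) * cnj (A l $$ (b, j)))"
      by (rule sum.swap)
    finally show ?thesis .
  qed
  then show ?thesis using ab by (simp add: cp_map_def del: index_mult_mat)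
qed

text \<open>For t = (k, l) this is the conjugate of the vector obtained by applying
  \<open>A l\<close> to column k of \<open>H\<close>. The conjugate fits the convention of
  \<open>gram\<close>, and it makes the bilinear equation given by this vector express Hermitian
  orthogonality to that image.\<close>

definition kraus_vec :: "nat \<Rightarrow> (nat \<Rightarrow> complex mat) \<Rightarrow> (nat \<Rightarrow> nat \<Rightarrow> complex) \<Rightarrow> nat \<times> nat \<Rightarrow> nat \<Rightarrow> complex" where
  "kraus_vec n A H t a = cnj (\<Sum>i<n. A (snd t) $$ (a, i) * H i (fst t))"

text \<open>Only \<open>X\<close> occurs on the left, so any two factorisations of the same
  \<open>X\<close> produce the same Gram matrix. This permits replacing \<open>h\<close> by the
  pivoted basis later.\<close>

lemma cp_map_gram:
  assumes A: "\<And>i. i \<in> {1..r} \<Longrightarrow> A i \<in> carrier_mat m n" and X: "X \<in> carrier_mat n n"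
    and XH: "\<And>i j. i < n \<Longrightarrow> j < n \<Longrightarrow> X $$ (i, j) = (\<Sum>k<n. of_real (d k) * H i k * cnj (H j k))"
    and ab: "a < m" "b < m"
  shows "cp_map m r A X $$ (a, b) = gram ({..<n} \<times> {1..r}) (\<lambda>t. d (fst t)) (kraus_vec n A H) a b"
proof -
  have "gram ({..<n} \<times> {1..r}) (\<lambda>t. d (fst t)) (kraus_vec n A H) a b
      = (\<Sum>k<n. \<Sum>l = 1..r. of_real (d k) * (\<Sum>i<n. A l $$ (a, i) * H i k) * cnj (\<Sum>j<n. A l $$ (b, j) * H j k))"
    unfolding gram_def kraus_vec_def by (simp add: sum.cartesian_product split_def)
  also have "\<dots> = (\<Sum>l = 1..r. \<Sum>k<n. of_real (d k) * (\<Sum>i<n. A l $$ (a, i) * H i k) * cnj (\<Sum>j<n. A l $$ (b, j) * H j k))"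
    by (rule sum.swap)
  also have "\<dots> = (\<Sum>l = 1..r. \<Sum>i<n. \<Sum>j<n. A l $$ (a, i) * X $$ (i, j) * cnj (A l $$ (b, j)))"
  proof (rule sum.cong[OF refl])
    fix l
    have "(\<Sum>k<n. of_real (d k) * (\<Sum>i<n. A l $$ (a, i) * H i k) * cnj (\<Sum>j<n. A l $$ (b, j) * H j k))
        = (\<Sum>k<n. \<Sum>i<n. \<Sum>j<n. A l $$ (a, i) * (of_real (d k) * H i k * cnj (H j k)) * cnj (A l $$ (b, j)))"
      unfolding cnj_sum sum_distrib_left sum_distrib_right
      by (rule sum.cong[OF refl], rule trans[OF sum.swap], intro sum.cong refl) (simp add: mult_ac)
    also have "\<dots> = (\<Sum>i<n. \<Sum>k<n. \<Sum>j<n. A l $$ (a, i) * (of_real (d k) * H i k * cnj (H j k)) * cnj (A l $$ (b, j)))"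
      by (rule sum.swap)
    also have "\<dots> = (\<Sum>i<n. \<Sum>j<n. \<Sum>k<n. A l $$ (a, i) * (of_real (d k) * H i k * cnj (H j k)) * cnj (A l $$ (b, j)))"
      by (intro sum.cong refl sum.swap)
    also have "\<dots> = (\<Sum>i<n. \<Sum>j<n. A l $$ (a, i) * X $$ (i, j) * cnj (A l $$ (b, j)))"
      by (intro sum.cong refl) (simp add: XH sum_distrib_left sum_distrib_right)
    finally show "(\<Sum>k<n. of_real (d k) * (\<Sum>i<n. A l $$ (a, i) * H i k) * cnj (\<Sum>j<n. A l $$ (b, j) * H j k))
        = (\<Sum>i<n. \<Sum>j<n. A l $$ (a, i) * X $$ (i, j) * cnj (A l $$ (b, j)))" .
  qed
  finally show ?thesis using cp_map_index[OF A X ab] by simp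
qed

lemma diag_congruence_index:
  assumes h: "h \<in> carrier_mat n n" and ij: "i < n" "j < n"
  shows "(h * seq_diag n p * mat_adjoint h) $$ (i, j)
    = (\<Sum>k<n. of_real (p (Suc k)) * h $$ (i, k) * cnj (h $$ (j, k)))"
proof -
  note h' = mat_adjoint_carrier[OF h]
  have d: "seq_diag n p \<in> carrier_mat n n" by (simp add: seq_diag_def)
  have "(h * seq_diag n p * mat_adjoint h) $$ (i, j)
      = (\<Sum>k<n. (\<Sum>l<n. h $$ (i, l) * seq_diag n p $$ (l, k)) * mat_adjoint h $$ (k, j))"
    by (rule mat_mult3_index[OF h d h' ij])
  also have "\<dots> = (\<Sum>k<n. (\<Sum>l<n. if l = k then h $$ (i, l) * of_real (p (Suc k)) else 0) * cnj (h $$ (j, k)))"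
    using ij by (intro sum.cong refl arg_cong2[of _ _ _ _ "(*)"])
      (auto simp: seq_diag_def mat_diag_def mat_adjoint_index[OF h])
  also have "\<dots> = (\<Sum>k<n. of_real (p (Suc k)) * h $$ (i, k) * cnj (h $$ (j, k)))"
    by (intro sum.cong refl) (simp add: mult.commute)
  finally show ?thesis .
qed

lemma mat_trace_seq_diag: "mat_trace (seq_diag k a) = of_real (\<Sum>i<k. a (Suc i))"
  by (simp add: mat_trace_def seq_diag_def mat_diag_def)

lemma one_mat_GL_flag: "1\<^sub>m k \<in> GL_flag k"
  by (simp add: GL_flag_iff)

locale scaling_problem =
  fixes m n r :: nat and A :: "nat \<Rightarrow> complex mat" and p q :: "nat \<Rightarrow> real"
  assumes kraus: "\<And>i. i \<in> {1..r} \<Longrightarrow> A i \<in> carrier_mat m n"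
    and wp: "weights n p" and wq: "weights m q"
    and total: "(\<Sum>i<n. p (Suc i)) = (\<Sum>i<m. q (Suc i))"
begin

definition image_det :: "complex mat \<Rightarrow> real" where
  "image_det h = rdet m q (gram ({..<n} \<times> {1..r}) (\<lambda>t. p (Suc (fst t))) (kraus_vec n A (entries h)))"

definition flag_weight :: "nat \<Rightarrow> (nat \<Rightarrow> real) \<Rightarrow> complex mat \<Rightarrow> real" where
  "flag_weight k a h = (\<Prod>j<k. pw ((cmod (h $$ (j, j)))\<^sup>2) (a (Suc j)))"

lemma flag_weight_pos: "h \<in> GL_flag k \<Longrightarrow> 0 < flag_weight k a h"
  unfolding flag_weight_def by (auto simp: GL_flag_iff intro!: prod_pos pw_pos)

lemma p_nonneg: "j < n \<Longrightarrow> 0 \<le> p (Suc j)"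
  using weights_nonneg[OF wp, of "Suc j"] by simp

lemma q_nonneg: "j < m \<Longrightarrow> 0 \<le> q (Suc j)"
  using weights_nonneg[OF wq, of "Suc j"] by simp

lemma capacity_ratio:
  assumes h: "h \<in> GL_flag n"
  shows "Re (rel_det m q (cp_map m r A (h * seq_diag n p * mat_adjoint h)) / rel_det n p (mat_adjoint h * h))
    = image_det h / flag_weight n p h"
proof -
  have hc: "h \<in> carrier_mat n n" using h by (simp add: GL_flag_iff)
  let ?X = "h * seq_diag n p * mat_adjoint h"
  let ?G = "gram ({..<n} \<times> {1..r}) (\<lambda>t. p (Suc (fst t))) (kraus_vec n A (entries h))"
  have X: "?X \<in> carrier_mat n n"
    using hc mat_adjoint_carrier[OF hc] by (intro mult_carrier_mat) (auto simp: seq_diag_def)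
  have e: "cp_map m r A ?X $$ (a, b) = ?G a b" if "a < m" "b < m" for a b
    by (rule cp_map_gram[OF kraus X diag_congruence_index[OF hc] that])
  have "psd m ?G" by (intro psd_gram) (auto intro: p_nonneg)
  then have "psd m (entries (cp_map m r A ?X))" by (rule psd_cong) (rule e)
  then have "rel_det m q (cp_map m r A ?X) = of_real (rdet m q (entries (cp_map m r A ?X)))"
    by (intro rel_det_psd) (auto simp: cp_map_def)
  also have "rdet m q (entries (cp_map m r A ?X)) = image_det h"
    unfolding image_det_def by (intro rdet_cong e)
  finally show ?thesis
    unfolding rel_det_adjoint_mult[OF wp h] flag_weight_def[symmetric]
    by (metis Re_complex_of_real of_real_divide)
qed

text \<open>The ratios form a nonempty set bounded below by 0, so a positive infimum amounts to one
  constant that serves all \<open>h\<close>. The denominators are cleared because they are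
  positive.\<close>

lemma capacity_pos_iff:
  "capacity m n (cp_map m r A) p q > 0 \<longleftrightarrow> (\<exists>c>0. \<forall>h\<in>GL_flag n. c * flag_weight n p h \<le> image_det h)"
proof -
  let ?f = "\<lambda>h. image_det h / flag_weight n p h"
  have cap: "capacity m n (cp_map m r A) p q = (INF h\<in>GL_flag n. ?f h)"
    unfolding capacity_def by (intro INF_cong refl capacity_ratio)
  have nn: "0 \<le> ?f h" if "h \<in> GL_flag n" for h
    using flag_weight_pos[OF that, of p] by (simp add: image_det_def rdet_nonneg)
  have ne: "GL_flag n \<noteq> {}" using one_mat_GL_flag by blast
  have bdd: "bdd_below (?f ` GL_flag n)" using nn by (intro bdd_belowI[of _ 0]) auto
  show ?thesis
  proof
    assume pos: "capacity m n (cp_map m r A) p q > 0"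
    have "capacity m n (cp_map m r A) p q * flag_weight n p h \<le> image_det h" if "h \<in> GL_flag n" for h
    proof -
      have "capacity m n (cp_map m r A) p q \<le> ?f h" unfolding cap by (rule cINF_lower[OF bdd that])
      then show ?thesis using flag_weight_pos[OF that, of p] by (simp add: pos_le_divide_eq)
    qed
    then show "\<exists>c>0. \<forall>h\<in>GL_flag n. c * flag_weight n p h \<le> image_det h" using pos by blast
  next
    assume "\<exists>c>0. \<forall>h\<in>GL_flag n. c * flag_weight n p h \<le> image_det h"
    then obtain c where c: "c > 0" "\<And>h. h \<in> GL_flag n \<Longrightarrow> c * flag_weight n p h \<le> image_det h" by blast
    have "c \<le> (INF h\<in>GL_flag n. ?f h)"
      using c(2) flag_weight_pos by (intro cINF_greatest ne) (simp add: pos_le_divide_eq)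
    then show "capacity m n (cp_map m r A) p q > 0" using c(1) cap by simp
  qed
qed

end


section \<open>Near minimisers have small gradient\<close>

lemma cmod_sum_mult_le:
  "(cmod (\<Sum>b<k. w b * x b))\<^sup>2 \<le> (\<Sum>b<k. (cmod (w b))\<^sup>2) * (\<Sum>b<k. (cmod (x b))\<^sup>2)"
proof -
  have "cmod (\<Sum>b<k. w b * x b) \<le> (\<Sum>b<k. cmod (w b) * cmod (x b))"
    using norm_sum[of "\<lambda>b. w b * x b" "{..<k}"] by (simp add: norm_mult)
  then have "(cmod (\<Sum>b<k. w b * x b))\<^sup>2 \<le> (\<Sum>b<k. cmod (w b) * cmod (x b))\<^sup>2"
    by (intro power_mono) auto
  also have "\<dots> \<le> (\<Sum>b<k. (cmod (w b))\<^sup>2) * (\<Sum>b<k. (cmod (x b))\<^sup>2)"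
    by (rule Cauchy_Schwarz_ineq_sum)
  finally show ?thesis .
qed

lemma Re_gram_diag: "Re (gram I c w a a) = (\<Sum>t\<in>I. c t * (cmod (w t a))\<^sup>2)"
proof -
  have "gram I c w a a = of_real (\<Sum>t\<in>I. c t * (cmod (w t a))\<^sup>2)"
    unfolding gram_def of_real_sum of_real_mult complex_norm_square
    by (intro sum.cong refl) (simp add: mult_ac)
  then show ?thesis by simp
qed

text \<open>Cauchy-Schwarz on each row. It bounds the largest eigenvalue by the trace, which is
  crude but enough for a second-order error term.\<close>

lemma quad_form_gram_le:
  "Re (quad_form k (gram I (\<lambda>_. 1) w) x)
    \<le> (\<Sum>a<k. Re (gram I (\<lambda>_. 1) w a a)) * (\<Sum>a<k. (cmod (x a))\<^sup>2)"
proof -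
  have "Re (quad_form k (gram I (\<lambda>_. 1) w) x) = (\<Sum>t\<in>I. (cmod (\<Sum>b<k. w t b * x b))\<^sup>2)"
    by (simp add: quad_form_gram)
  also have "\<dots> \<le> (\<Sum>t\<in>I. (\<Sum>b<k. (cmod (w t b))\<^sup>2) * (\<Sum>b<k. (cmod (x b))\<^sup>2))"
    by (intro sum_mono cmod_sum_mult_le)
  also have "\<dots> = (\<Sum>a<k. Re (gram I (\<lambda>_. 1) w a a)) * (\<Sum>a<k. (cmod (x a))\<^sup>2)"
    unfolding Re_gram_diag sum_distrib_right[symmetric] by (subst sum.swap) simp
  finally show ?thesis .
qed

lemma quad_form_add_delta:
  assumes M: "psd k M" and a: "a < k"
  shows "Re (quad_form k M (\<lambda>e. (if e = a then 1 else 0) + x e))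
    = Re (M a a) + 2 * (\<Sum>i<k. Re (cnj (x i) * M i a)) + Re (quad_form k M x)"
proof -
  let ?d = "\<lambda>e. if e = a then 1 else 0 :: complex"
  have "quad_form k M (\<lambda>e. ?d e + x e)
      = (\<Sum>i<k. \<Sum>j<k. ?d i * M i j * ?d j) + (\<Sum>i<k. \<Sum>j<k. ?d i * (M i j * x j))
        + (\<Sum>i<k. \<Sum>j<k. cnj (x i) * M i j * ?d j) + quad_form k M x"
    unfolding quad_form_def sum.distrib[symmetric]
    by (intro sum.cong refl) (simp add: algebra_simps)
  also have "(\<Sum>i<k. \<Sum>j<k. ?d i * M i j * ?d j) = M a a"
    using quad_form_delta[OF a, of M 1] unfolding quad_form_def by (simp add: if_distrib cong: if_cong)
  also have "(\<Sum>i<k. \<Sum>j<k. ?d i * (M i j * x j)) = (\<Sum>j<k. M a j * x j)"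
    unfolding sum_distrib_left[symmetric] using a by (simp add: if_distribR if_distrib cong: if_cong)
  also have "(\<Sum>i<k. \<Sum>j<k. cnj (x i) * M i j * ?d j) = (\<Sum>i<k. cnj (x i) * M i a)"
    using a by (intro sum.cong refl) (simp add: if_distrib cong: if_cong)
  also have "(\<Sum>j<k. M a j * x j) = cnj (\<Sum>i<k. cnj (x i) * M i a)"
    unfolding cnj_sum
  proof (intro sum.cong refl)
    fix j assume "j \<in> {..<k}"
    then have "M a j = cnj (M j a)" by (intro psd_hermitian[OF M] a) simp
    then show "M a j * x j = cnj (cnj (x j) * M j a)" by (simp add: mult.commute)
  qed
  finally show ?thesis by (simp add: Re_sum)
qed

text \<open>Formulated for a single Gram matrix so that it serves both marginals. The assumption
  compares the objective at 1 with its value at 1 + Z, up to \<delta>. The gradient at Z = 0 is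
  twice the upper triangular part of M minus the diagonal matrix of \<open>q\<close>; a descent step
  of length t along it would gain at least t times the squared norm of that part, so this norm is at
  most \<delta>/t. The factor 2 in the bound restores the lower triangle.\<close>

lemma near_minimiser_close:
  fixes k :: nat and q :: "nat \<Rightarrow> real" and I :: "'i set"
  defines "S \<equiv> \<Sum>a<k. q (Suc a)"
  assumes M: "M = gram I (\<lambda>_. 1) w" and q: "\<And>a. a < k \<Longrightarrow> 0 \<le> q (Suc a)" and \<delta>: "0 \<le> \<delta>" "\<delta> \<le> 1"
    and hyp: "\<And>Z. (\<And>e a. a < e \<Longrightarrow> Z e a = 0) \<Longrightarrow> (\<And>a. a < k \<Longrightarrow> cmod (Z a a) \<le> 1 / 2) \<Longrightarrow>
      (\<Sum>a<k. Re (M a a)) - \<delta> \<le> (\<Sum>a<k. Re (quad_form k M (\<lambda>e. (if e = a then 1 else 0) + Z e a)))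
        - (\<Sum>a<k. q (Suc a) * ln ((cmod (1 + Z a a))\<^sup>2))"
  shows "(\<Sum>a<k. \<Sum>b<k. (cmod (M a b - (if a = b then of_real (q (Suc a)) else 0)))\<^sup>2) \<le> 2 * (4 + 7 * S) * \<delta>"
proof -
  define Tr where "Tr = (\<Sum>a<k. Re (M a a))"
  have psd: "psd k M" unfolding M by (intro psd_gram) auto
  have S0: "0 \<le> S" unfolding S_def using q by (intro sum_nonneg) auto
  have qS: "q (Suc a) \<le> S" if "a < k" for a
    unfolding S_def using that q by (intro member_le_sum) auto
  have Maa: "Im (M a a) = 0" "0 \<le> Re (M a a)" if "a < k" for a
    using psd_diag[OF psd that] by auto
  have MTr: "Re (M a a) \<le> Tr" if "a < k" for a
    unfolding Tr_def using that Maa by (intro member_le_sum) auto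
  have Tr_le: "Tr \<le> 2 + 3 * S"
  proof -
    \<comment> \<open>Scaling everything by 1/2 quarters the trace and costs
      \<open>2 * ln 2 * S\<close>, at most \<open>2 * S\<close>. A near-minimiser can therefore not
      have a large trace.\<close>
    define Z where "Z e a = (if e = a then - 1 / 2 else 0 :: complex)" for e a :: nat
    have "Re (quad_form k M (\<lambda>e. (if e = a then 1 else 0) + Z e a)) = Re (M a a) / 4" if "a < k" for a
    proof -
      have "(\<lambda>e. (if e = a then 1 else 0) + Z e a) = (\<lambda>e. if e = a then 1 / 2 else 0)"
        by (auto simp: Z_def)
      then show ?thesis by (simp only: quad_form_delta[OF that]) simp
    qed
    then have "(\<Sum>a<k. Re (quad_form k M (\<lambda>e. (if e = a then 1 else 0) + Z e a))) = Tr / 4"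
      unfolding Tr_def sum_divide_distrib by (intro sum.cong) auto
    moreover have "(\<Sum>a<k. q (Suc a) * ln ((cmod (1 + Z a a))\<^sup>2)) = - (2 * ln 2) * S"
    proof -
      have "ln ((cmod (1 + Z a a))\<^sup>2) = - (2 * ln 2)" for a
        by (simp add: Z_def ln_realpow ln_div)
      then show ?thesis by (simp add: S_def sum_negf sum_distrib_right[symmetric])
    qed
    moreover have "Tr - \<delta> \<le> (\<Sum>a<k. Re (quad_form k M (\<lambda>e. (if e = a then 1 else 0) + Z e a)))
        - (\<Sum>a<k. q (Suc a) * ln ((cmod (1 + Z a a))\<^sup>2))"
      unfolding Tr_def by (rule hyp) (auto simp: Z_def)
    ultimately have "Tr - \<delta> \<le> Tr / 4 + 2 * ln 2 * S" by simp
    moreover have "2 * ln 2 * S \<le> 2 * S"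
      using S0 ln_le_minus_one[of 2] by (intro mult_right_mono) auto
    ultimately show ?thesis using \<delta> S0 by linarith
  qed
  define E where "E a b = M a b - (if a = b then of_real (q (Suc a)) else 0)" for a b
  \<comment> \<open>The number \<open>4 + 7 * S\<close> bounds the second-order coefficient
    \<open>Tr + 4 * S\<close> as well as twice every diagonal error; the latter keeps
    \<open>t * \<epsilon> a\<close> within 1/2.\<close>
  define t where "t = 1 / (4 + 7 * S)"
  have t0: "0 < t" and tS: "t * (4 + 7 * S) = 1" using S0 by (auto simp: t_def)
  \<comment> \<open>Steepest descent restricted to upper triangular directions.\<close>
  define Z where "Z e a = (if e \<le> a then - of_real t * E e a else 0)" for e a
  define \<epsilon> where "\<epsilon> a = Re (E a a)" for a
  have E\<epsilon>: "E a a = of_real (\<epsilon> a)" if "a < k" for a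
    using Maa[OF that] by (simp add: E_def \<epsilon>_def complex_eq_iff)
  have \<epsilon>M: "M a a = of_real (\<epsilon> a + q (Suc a))" if "a < k" for a
    using Maa[OF that] by (simp add: E_def \<epsilon>_def complex_eq_iff)
  have \<epsilon>b: "\<bar>t * \<epsilon> a\<bar> \<le> 1 / 2" if "a < k" for a
  proof -
    have "\<bar>\<epsilon> a\<bar> \<le> 2 + 3 * S"
      using \<epsilon>M[OF that] Maa[OF that] MTr[OF that] Tr_le q[OF that] qS[OF that] S0 by auto
    then have "t * \<bar>\<epsilon> a\<bar> \<le> t * (2 + 3 * S)" using t0 by (intro mult_left_mono) auto
    also have "\<dots> \<le> t * ((4 + 7 * S) / 2)" using t0 S0 by (intro mult_left_mono) auto
    also have "\<dots> = 1 / 2" using tS by simp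
    finally show ?thesis using t0 by (simp add: abs_mult)
  qed
  define U where "U a = (\<Sum>i<k. if i \<le> a then (cmod (E i a))\<^sup>2 else 0)" for a
  have \<epsilon>U: "(\<epsilon> a)\<^sup>2 \<le> U a" if "a < k" for a
  proof -
    have "(\<epsilon> a)\<^sup>2 = (if a \<le> a then (cmod (E a a))\<^sup>2 else 0)" using E\<epsilon>[OF that] by simp
    also have "\<dots> \<le> U a" unfolding U_def
      using that by (intro member_le_sum) auto
    finally show ?thesis .
  qed
  have U0: "0 \<le> U a" for a unfolding U_def by (intro sum_nonneg) auto
  have step: "Re (quad_form k M (\<lambda>e. (if e = a then 1 else 0) + Z e a)) - q (Suc a) * ln ((cmod (1 + Z a a))\<^sup>2)
      \<le> Re (M a a) - 2 * t * U a + t\<^sup>2 * (Tr + 4 * S) * U a" if a: "a < k" for a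
  proof -
    have "Re (cnj (Z i a) * M i a)
        = - t * (if i \<le> a then (cmod (E i a))\<^sup>2 else 0) - (if i = a then t * q (Suc a) * \<epsilon> a else 0)"
      if "i < k" for i
    proof (cases "i = a")
      case True
      then show ?thesis using E\<epsilon>[OF a] \<epsilon>M[OF a] by (simp add: Z_def power2_eq_square algebra_simps)
    next
      case False
      then have "E i a = M i a" by (simp add: E_def)
      moreover have "cnj (- of_real t * z) * z = of_real (- t * (cmod z)\<^sup>2)" for z
        unfolding of_real_mult complex_norm_square by simp
      then have "Re (cnj (- of_real t * z) * z) = - t * (cmod z)\<^sup>2" for z
        by (metis Re_complex_of_real)
      ultimately show ?thesis using False by (simp add: Z_def)
    qed
    then have "(\<Sum>i<k. Re (cnj (Z i a) * M i a))
      = (\<Sum>i<k. - t * (if i \<le> a then (cmod (E i a))\<^sup>2 else 0) - (if i = a then t * q (Suc a) * \<epsilon> a else 0))"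
      by (intro sum.cong) auto
    also have "\<dots> = - t * U a - t * q (Suc a) * \<epsilon> a"
      using a by (simp add: sum_subtractf sum_negf sum_distrib_left[symmetric] U_def)
    finally have lin: "(\<Sum>i<k. Re (cnj (Z i a) * M i a)) = - t * U a - t * q (Suc a) * \<epsilon> a" .
    have "(\<Sum>i<k. (cmod (Z i a))\<^sup>2) = t\<^sup>2 * U a"
      unfolding U_def sum_distrib_left
      by (intro sum.cong refl) (auto simp: Z_def norm_mult power_mult_distrib)
    then have quad: "Re (quad_form k M (\<lambda>i. Z i a)) \<le> Tr * (t\<^sup>2 * U a)"
      using quad_form_gram_le[of k I w "\<lambda>i. Z i a"] by (simp add: M Tr_def)
    have "cmod (1 + Z a a) = 1 + - (t * \<epsilon> a)"
    proof -
      have "1 + Z a a = of_real (1 + - (t * \<epsilon> a))" using E\<epsilon>[OF a] by (simp add: Z_def)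
      then have "cmod (1 + Z a a) = \<bar>1 + - (t * \<epsilon> a)\<bar>" by (metis norm_of_real)
      then show ?thesis using \<epsilon>b[OF a] by linarith
    qed
    then have "ln ((cmod (1 + Z a a))\<^sup>2) = 2 * ln (1 + - (t * \<epsilon> a))"
      using \<epsilon>b[OF a] by (simp add: ln_realpow)
    moreover have "\<bar>ln (1 + - (t * \<epsilon> a)) - - (t * \<epsilon> a)\<bar> \<le> 2 * (- (t * \<epsilon> a))\<^sup>2"
      using \<epsilon>b[OF a] by (intro abs_ln_one_plus_x_minus_x_bound) simp
    ultimately have "- ln ((cmod (1 + Z a a))\<^sup>2) \<le> 2 * (t * \<epsilon> a) + 4 * (t\<^sup>2 * (\<epsilon> a)\<^sup>2)"
      by (simp add: power_mult_distrib abs_le_iff)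
    also have "\<dots> \<le> 2 * (t * \<epsilon> a) + 4 * (t\<^sup>2 * U a)"
      using \<epsilon>U[OF a] by (intro add_left_mono mult_left_mono) auto
    finally have "q (Suc a) * - ln ((cmod (1 + Z a a))\<^sup>2) \<le> q (Suc a) * (2 * (t * \<epsilon> a) + 4 * (t\<^sup>2 * U a))"
      using q[OF a] by (rule mult_left_mono)
    also have "\<dots> \<le> 2 * q (Suc a) * t * \<epsilon> a + S * (4 * (t\<^sup>2 * U a))"
      using mult_right_mono[OF qS[OF a], of "4 * (t\<^sup>2 * U a)"] U0 by (simp add: algebra_simps)
    finally have "- (q (Suc a) * ln ((cmod (1 + Z a a))\<^sup>2)) \<le> 2 * q (Suc a) * t * \<epsilon> a + S * (4 * (t\<^sup>2 * U a))"
      by simp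
    \<comment> \<open>The first-order terms with \<open>q (Suc a) * t * \<epsilon> a\<close> from
      the quadratic form and from the logarithm cancel; the decrease is governed by
      \<open>U a\<close> alone.\<close>
    then show ?thesis
      unfolding quad_form_add_delta[OF psd a] lin using quad by (simp add: algebra_simps)
  qed
  let ?U = "\<Sum>a<k. U a"
  have U'0: "0 \<le> ?U" using U0 by (intro sum_nonneg)
  have "Tr - \<delta> \<le> (\<Sum>a<k. Re (quad_form k M (\<lambda>e. (if e = a then 1 else 0) + Z e a)))
        - (\<Sum>a<k. q (Suc a) * ln ((cmod (1 + Z a a))\<^sup>2))"
    unfolding Tr_def
  proof (rule hyp)
    fix a assume "a < k"
    then show "cmod (Z a a) \<le> 1 / 2" using \<epsilon>b[of a] E\<epsilon>[of a] by (simp add: Z_def norm_mult abs_mult)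
  qed (simp add: Z_def)
  also have "\<dots> = (\<Sum>a<k. Re (quad_form k M (\<lambda>e. (if e = a then 1 else 0) + Z e a)) - q (Suc a) * ln ((cmod (1 + Z a a))\<^sup>2))"
    by (rule sum_subtractf[symmetric])
  also have "\<dots> \<le> (\<Sum>a<k. Re (M a a) - 2 * t * U a + t\<^sup>2 * (Tr + 4 * S) * U a)"
    using step by (intro sum_mono) auto
  also have "\<dots> = Tr - 2 * t * ?U + t\<^sup>2 * (Tr + 4 * S) * ?U"
    by (simp add: Tr_def sum.distrib sum_subtractf sum_distrib_left)
  finally have "2 * t * ?U \<le> \<delta> + t\<^sup>2 * (Tr + 4 * S) * ?U" by simp
  also have "t\<^sup>2 * (Tr + 4 * S) * ?U \<le> t\<^sup>2 * (4 + 7 * S) * ?U"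
    using Tr_le U'0 by (intro mult_right_mono mult_left_mono) auto
  \<comment> \<open>With this step length the second-order error consumes at most half of the
    first-order gain.\<close>
  also have "t\<^sup>2 * (4 + 7 * S) * ?U = t * ?U"
    unfolding power2_eq_square mult.assoc[of t t] tS by simp
  finally have "t * ?U \<le> \<delta>" by simp
  then have "(4 + 7 * S) * (t * ?U) \<le> (4 + 7 * S) * \<delta>" using S0 by (intro mult_left_mono) auto
  moreover have "(4 + 7 * S) * (t * ?U) = ?U"
    unfolding mult.assoc[symmetric] mult.commute[of _ t] tS by simp
  ultimately have U\<delta>: "?U \<le> (4 + 7 * S) * \<delta>" by simp
  let ?V = "\<lambda>i a. if i \<le> a then (cmod (E i a))\<^sup>2 else 0"
  \<comment> \<open>\<open>E\<close> is Hermitian, so each entry has a counterpart of the same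
    modulus in the upper triangle; diagonal entries are counted twice.\<close>
  have "(\<Sum>a<k. \<Sum>b<k. (cmod (E a b))\<^sup>2) \<le> (\<Sum>a<k. \<Sum>b<k. ?V a b + ?V b a)"
  proof (intro sum_mono)
    fix a b assume ab: "a \<in> {..<k}" "b \<in> {..<k}"
    have "E b a = cnj (E a b)"
      using psd_hermitian[OF psd, of a b] ab by (auto simp: E_def)
    then have "cmod (E b a) = cmod (E a b)" by simp
    then show "(cmod (E a b))\<^sup>2 \<le> ?V a b + ?V b a" by auto
  qed
  also have "\<dots> = (\<Sum>a<k. \<Sum>b<k. ?V a b) + ?U" by (simp add: sum.distrib U_def)
  also have "(\<Sum>a<k. \<Sum>b<k. ?V a b) = ?U" unfolding U_def by (rule sum.swap)
  finally have "(\<Sum>a<k. \<Sum>b<k. (cmod (E a b))\<^sup>2) \<le> ?U + ?U" .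
  moreover have "?U + ?U \<le> 2 * (4 + 7 * S) * \<delta>" using U\<delta> by (simp add: algebra_simps)
  ultimately show ?thesis unfolding E_def by linarith
qed


section \<open>Positive capacity implies approximate scalability\<close>

lemma cp_dual_index:
  assumes B: "\<And>i. i \<in> {1..r} \<Longrightarrow> B i \<in> carrier_mat m n" and ab: "a < n" "b < n"
  shows "cp_dual n r B (1\<^sub>m m) $$ (a, b)
    = gram ({..<m} \<times> {1..r}) (\<lambda>_. 1) (\<lambda>t f. B (snd t) $$ (fst t, f)) a b"
proof -
  have "(mat_adjoint (B l) * 1\<^sub>m m * B l) $$ (a, b) = (\<Sum>i<m. cnj (B l $$ (i, a)) * B l $$ (i, b))"
    if "l \<in> {1..r}" for l
  proof -
    note Bl = B[OF that] and Bl' = mat_adjoint_carrier[OF B[OF that]]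
    have "mat_adjoint (B l) * 1\<^sub>m m = mat_adjoint (B l)" by (rule right_mult_one_mat[OF Bl'])
    then show ?thesis
      using ab Bl Bl' mat_adjoint_index[OF Bl] by (simp add: scalar_prod_def lessThan_atLeast0)
  qed
  then have "cp_dual n r B (1\<^sub>m m) $$ (a, b) = (\<Sum>l = 1..r. \<Sum>i<m. cnj (B l $$ (i, a)) * B l $$ (i, b))"
    using ab by (simp add: cp_dual_def del: index_mult_mat)
  also have "\<dots> = (\<Sum>i<m. \<Sum>l = 1..r. cnj (B l $$ (i, a)) * B l $$ (i, b))"
    by (rule sum.swap)
  finally show ?thesis
    by (simp add: gram_def sum.cartesian_product split_def)
qed

lemma cp_map_one_index:
  assumes B: "\<And>i. i \<in> {1..r} \<Longrightarrow> B i \<in> carrier_mat m n" and ab: "a < m" "b < m"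
  shows "cp_map m r B (1\<^sub>m n) $$ (a, b)
    = gram ({..<n} \<times> {1..r}) (\<lambda>_. 1) (\<lambda>t f. cnj (B (snd t) $$ (f, fst t))) a b"
proof -
  have "cp_map m r B (1\<^sub>m n) $$ (a, b)
      = gram ({..<n} \<times> {1..r}) (\<lambda>_. 1) (kraus_vec n B (\<lambda>i k. if i = k then 1 else 0)) a b"
    by (rule cp_map_gram[OF B _ _ ab]) (auto simp: if_distrib cong: if_cong)
  also have "\<dots> = gram ({..<n} \<times> {1..r}) (\<lambda>_. 1) (\<lambda>t f. cnj (B (snd t) $$ (f, fst t))) a b"
    unfolding gram_def
    by (intro sum.cong refl) (auto simp: kraus_vec_def if_distrib cong: if_cong)
  finally show ?thesis .
qed

lemma hs_norm_eq:
  assumes X: "X \<in> carrier_mat k k"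
  shows "hs_norm X = sqrt (\<Sum>a<k. \<Sum>b<k. (cmod (X $$ (a, b)))\<^sup>2)"
proof -
  note X' = mat_adjoint_carrier[OF X]
  have "mat_trace (X * mat_adjoint X) = (\<Sum>a<k. \<Sum>b<k. X $$ (a, b) * cnj (X $$ (a, b)))"
    unfolding mat_trace_def using X X' mat_adjoint_index[OF X]
    by (auto simp: scalar_prod_def lessThan_atLeast0 intro!: sum.cong)
  also have "\<dots> = of_real (\<Sum>a<k. \<Sum>b<k. (cmod (X $$ (a, b)))\<^sup>2)"
    unfolding of_real_sum complex_norm_square ..
  finally show ?thesis by (simp add: hs_norm_def)
qed

context scaling_problem
begin

text \<open>The entries of the Kraus operators of the scaled map. The scalings enter as functions,
  so that products with 1 + Z can be inserted without forming matrices.\<close>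

definition scaled_entry :: "(nat \<Rightarrow> nat \<Rightarrow> complex) \<Rightarrow> (nat \<Rightarrow> nat \<Rightarrow> complex) \<Rightarrow> nat \<Rightarrow> nat \<Rightarrow> nat \<Rightarrow> complex" where
  "scaled_entry g h l a c = (\<Sum>j<n. (\<Sum>i<m. cnj (g i a) * A l $$ (i, j)) * h j c)"

lemma scaled_kraus_index:
  assumes "l \<in> {1..r}" "g \<in> carrier_mat m m" "h \<in> carrier_mat n n"
  shows "scaled_kraus g h A l \<in> carrier_mat m n"
    and "a < m \<Longrightarrow> c < n \<Longrightarrow> scaled_kraus g h A l $$ (a, c) = scaled_entry (entries g) (entries h) l a c"
proof -
  note g' = mat_adjoint_carrier[OF assms(2)]
  show "scaled_kraus g h A l \<in> carrier_mat m n"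
    unfolding scaled_kraus_def using kraus[OF assms(1)] g' assms(3) by auto
  assume a: "a < m" and c: "c < n"
  show "scaled_kraus g h A l $$ (a, c) = scaled_entry (entries g) (entries h) l a c"
    unfolding scaled_kraus_def scaled_entry_def mat_mult3_index[OF g' kraus[OF assms(1)] assms(3) a c]
    using a by (simp add: mat_adjoint_index[OF assms(2)])
qed

lemma scaled_entry_left:
  "scaled_entry (\<lambda>i a. \<Sum>e<m. g i e * Y e a) h l a c = (\<Sum>e<m. cnj (Y e a) * scaled_entry g h l e c)"
proof -
  have "(\<Sum>i<m. cnj (\<Sum>e<m. g i e * Y e a) * A l $$ (i, j)) = (\<Sum>e<m. cnj (Y e a) * (\<Sum>i<m. cnj (g i e) * A l $$ (i, j)))" for j
  proof -
    have "(\<Sum>i<m. cnj (\<Sum>e<m. g i e * Y e a) * A l $$ (i, j)) = (\<Sum>i<m. \<Sum>e<m. cnj (Y e a) * (cnj (g i e) * A l $$ (i, j)))"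
      unfolding cnj_sum sum_distrib_right by (intro sum.cong refl) (simp add: mult_ac)
    then show ?thesis unfolding sum_distrib_left by (subst sum.swap) simp
  qed
  then have "scaled_entry (\<lambda>i a. \<Sum>e<m. g i e * Y e a) h l a c
      = (\<Sum>j<n. \<Sum>e<m. cnj (Y e a) * ((\<Sum>i<m. cnj (g i e) * A l $$ (i, j)) * h j c))"
    unfolding scaled_entry_def by (simp add: sum_distrib_right mult.assoc)
  then show ?thesis unfolding scaled_entry_def sum_distrib_left[of _ _ "{..<n}"] by (subst sum.swap) simp
qed

lemma scaled_entry_right:
  "scaled_entry g (\<lambda>j c. \<Sum>e<n. h j e * Y e c) l a c = (\<Sum>e<n. scaled_entry g h l a e * Y e c)"
proof -
  have "scaled_entry g (\<lambda>j c. \<Sum>e<n. h j e * Y e c) l a c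
      = (\<Sum>j<n. \<Sum>e<n. (\<Sum>i<m. cnj (g i a) * A l $$ (i, j)) * h j e * Y e c)"
    unfolding scaled_entry_def sum_distrib_left[of _ _ "{..<n}"] by (simp only: mult.assoc)
  then show ?thesis unfolding scaled_entry_def sum_distrib_right[of _ "{..<n}"] by (subst sum.swap) simp
qed

text \<open>The total squared Hilbert-Schmidt norm of the scaled Kraus operators, which is the
  common trace of the scaled map and of its dual at the identity.\<close>

definition energy :: "(nat \<Rightarrow> nat \<Rightarrow> complex) \<Rightarrow> (nat \<Rightarrow> nat \<Rightarrow> complex) \<Rightarrow> real" where
  "energy g h = (\<Sum>l = 1..r. \<Sum>a<m. \<Sum>c<n. (cmod (scaled_entry g h l a c))\<^sup>2)"

text \<open>The scaled map at the identity, written as a Gram matrix; \<open>right_gram\<close> is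
  the dual of the scaled map at the identity.\<close>

definition left_gram :: "(nat \<Rightarrow> nat \<Rightarrow> complex) \<Rightarrow> (nat \<Rightarrow> nat \<Rightarrow> complex) \<Rightarrow> nat \<Rightarrow> nat \<Rightarrow> complex" where
  "left_gram g h = gram ({..<n} \<times> {1..r}) (\<lambda>_. 1) (\<lambda>t a. cnj (scaled_entry g h (snd t) a (fst t)))"

definition right_gram :: "(nat \<Rightarrow> nat \<Rightarrow> complex) \<Rightarrow> (nat \<Rightarrow> nat \<Rightarrow> complex) \<Rightarrow> nat \<Rightarrow> nat \<Rightarrow> complex" where
  "right_gram g h = gram ({..<m} \<times> {1..r}) (\<lambda>_. 1) (\<lambda>t c. scaled_entry g h (snd t) (fst t) c)"

text \<open>With \<open>h\<close> fixed, the energy is a quadratic form in the columns of the factor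
  by which \<open>g\<close> is multiplied. In this shape the variation of \<open>g\<close> fits
  \<open>near_minimiser_close\<close>.\<close>

lemma energy_left:
  "energy (\<lambda>i a. \<Sum>e<m. g i e * Y e a) h = (\<Sum>a<m. Re (quad_form m (left_gram g h) (\<lambda>e. Y e a)))"
proof -
  have "Re (quad_form m (left_gram g h) (\<lambda>e. Y e a))
      = (\<Sum>c<n. \<Sum>l = 1..r. (cmod (scaled_entry (\<lambda>i a. \<Sum>e<m. g i e * Y e a) h l a c))\<^sup>2)" for a
  proof -
    have "cmod (\<Sum>e<m. cnj (scaled_entry g h l e c) * Y e a)
        = cmod (scaled_entry (\<lambda>i a. \<Sum>e<m. g i e * Y e a) h l a c)" for l c
    proof -
      have "(\<Sum>e<m. cnj (scaled_entry g h l e c) * Y e a) = cnj (\<Sum>e<m. cnj (Y e a) * scaled_entry g h l e c)"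
        by (simp add: mult.commute)
      then show ?thesis unfolding scaled_entry_left by (simp only: complex_mod_cnj)
    qed
    then show ?thesis
      unfolding left_gram_def quad_form_gram Re_complex_of_real
      by (simp add: sum.cartesian_product split_def)
  qed
  then have "(\<Sum>a<m. Re (quad_form m (left_gram g h) (\<lambda>e. Y e a)))
      = (\<Sum>a<m. \<Sum>l = 1..r. \<Sum>c<n. (cmod (scaled_entry (\<lambda>i a. \<Sum>e<m. g i e * Y e a) h l a c))\<^sup>2)"
    by (simp only:) (intro sum.cong[OF refl] sum.swap)
  also have "\<dots> = energy (\<lambda>i a. \<Sum>e<m. g i e * Y e a) h"
    unfolding energy_def by (rule sum.swap)
  finally show ?thesis ..
qed

lemma energy_right:
  "energy g (\<lambda>j c. \<Sum>e<n. h j e * Y e c) = (\<Sum>c<n. Re (quad_form n (right_gram g h) (\<lambda>e. Y e c)))"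
proof -
  have "Re (quad_form n (right_gram g h) (\<lambda>e. Y e c))
      = (\<Sum>a<m. \<Sum>l = 1..r. (cmod (scaled_entry g (\<lambda>j c. \<Sum>e<n. h j e * Y e c) l a c))\<^sup>2)" for c
    unfolding right_gram_def quad_form_gram Re_complex_of_real scaled_entry_right
    by (simp add: sum.cartesian_product split_def)
  then have "(\<Sum>c<n. Re (quad_form n (right_gram g h) (\<lambda>e. Y e c)))
      = (\<Sum>c<n. \<Sum>l = 1..r. \<Sum>a<m. (cmod (scaled_entry g (\<lambda>j c. \<Sum>e<n. h j e * Y e c) l a c))\<^sup>2)"
    by (simp only:) (intro sum.cong[OF refl] sum.swap)
  also have "\<dots> = (\<Sum>l = 1..r. \<Sum>c<n. \<Sum>a<m. (cmod (scaled_entry g (\<lambda>j c. \<Sum>e<n. h j e * Y e c) l a c))\<^sup>2)"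
    by (rule sum.swap)
  also have "\<dots> = energy g (\<lambda>j c. \<Sum>e<n. h j e * Y e c)"
    unfolding energy_def by (intro sum.cong[OF refl] sum.swap)
  finally show ?thesis ..
qed

lemma energy_cong:
  assumes "\<And>i a. i < m \<Longrightarrow> a < m \<Longrightarrow> g i a = g' i a" "\<And>j c. j < n \<Longrightarrow> c < n \<Longrightarrow> h j c = h' j c"
  shows "energy g h = energy g' h'"
  unfolding energy_def scaled_entry_def
  using assms by (intro sum.cong refl arg_cong[of _ _ "\<lambda>x. (cmod x)\<^sup>2"] arg_cong2[of _ _ _ _ "(*)"]) auto

lemma energy_trace:
  "(\<Sum>a<m. Re (left_gram g h a a)) = energy g h" "(\<Sum>c<n. Re (right_gram g h c c)) = energy g h"
proof -
  let ?\<delta> = "\<lambda>e a. if e = a then 1 else 0 :: complex"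
  have "energy (\<lambda>i a. \<Sum>e<m. g i e * ?\<delta> e a) h = energy g h"
    by (intro energy_cong) (simp_all add: if_distrib cong: if_cong)
  then show "(\<Sum>a<m. Re (left_gram g h a a)) = energy g h"
    unfolding energy_left using quad_form_delta[of _ m "left_gram g h" 1] by simp
  have "energy g (\<lambda>i a. \<Sum>e<n. h i e * ?\<delta> e a) = energy g h"
    by (intro energy_cong) (simp_all add: if_distrib cong: if_cong)
  then show "(\<Sum>c<n. Re (right_gram g h c c)) = energy g h"
    unfolding energy_right using quad_form_delta[of _ n "right_gram g h" 1] by simp
qed

section \<open>The objective function and its near-minimisers\<close>

definition log_weight :: "nat \<Rightarrow> (nat \<Rightarrow> real) \<Rightarrow> complex mat \<Rightarrow> real" where
  "log_weight k a h = (\<Sum>j<k. a (Suc j) * ln ((cmod (h $$ (j, j)))\<^sup>2))"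

lemma ln_flag_weight: "h \<in> GL_flag k \<Longrightarrow> ln (flag_weight k a h) = log_weight k a h"
  unfolding flag_weight_def log_weight_def
  by (subst ln_prod) (auto simp: GL_flag_iff ln_pw pw_pos[THEN less_imp_neq, symmetric] intro!: sum.cong)

definition objective :: "complex mat \<Rightarrow> complex mat \<Rightarrow> real" where
  "objective g h = energy (entries g) (entries h) - log_weight m q g - log_weight n p h"

text \<open>P is at most \<beta> times the identity, so monotonicity and homogeneity of the relative
  determinant replace \<open>h P h^\<dagger>\<close> by \<open>h h^\<dagger>\<close> at the cost of
  a constant. The capacity speaks of the former, the objective of the latter.\<close>

lemma rdet_image_le:
  "\<exists>C>0. \<forall>h. image_det h \<le> C * rdet m q (gram ({..<n} \<times> {1..r}) (\<lambda>_. 1) (kraus_vec n A (entries h)))"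
proof -
  \<comment> \<open>The summand 1 keeps \<beta> positive when all weights vanish.\<close>
  define \<beta> where "\<beta> = 1 + (\<Sum>i<n. p (Suc i))"
  have p\<beta>: "p (Suc k) \<le> \<beta>" if "k < n" for k
    unfolding \<beta>_def using that p_nonneg member_le_sum[of k "{..<n}" "\<lambda>i. p (Suc i)"] by force
  have \<beta>1: "0 < \<beta>" unfolding \<beta>_def using p_nonneg by (intro add_pos_nonneg sum_nonneg) auto
  let ?G = "\<lambda>c h. gram ({..<n} \<times> {1..r}) c (kraus_vec n A (entries h))"
  have "image_det h \<le> (\<Prod>j<m. pw \<beta> (q (Suc j))) * rdet m q (?G (\<lambda>_. 1) h)" for h
  proof -
    have "image_det h \<le> rdet m q (?G (\<lambda>_. \<beta>) h)"
      unfolding image_det_def using p\<beta> p_nonneg \<beta>1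
      by (intro rdet_mono wq psd_gram quad_form_gram_mono) (auto simp: mem_Times_iff)
    also have "?G (\<lambda>_. \<beta>) h = (\<lambda>i j. of_real \<beta> * ?G (\<lambda>_. 1) h i j)"
      by (simp add: fun_eq_iff gram_def sum_distrib_left mult.assoc)
    also have "rdet m q \<dots> = (\<Prod>j<m. pw \<beta> (q (Suc j))) * rdet m q (?G (\<lambda>_. 1) h)"
      using \<beta>1 by (intro rdet_scale wq psd_gram) auto
    finally show ?thesis .
  qed
  then show ?thesis using \<beta>1 by (intro exI[of _ "\<Prod>j<m. pw \<beta> (q (Suc j))"]) (auto intro!: prod_pos pw_pos)
qed

text \<open>The scaled map at the identity is the congruence by \<open>g\<close> of the image of
  \<open>h h^\<dagger>\<close>; its relative determinant therefore splits off the weight of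
  \<open>g\<close>.\<close>

lemma left_gram_congruence:
  "left_gram g h a b = (\<Sum>i<m. \<Sum>l<m. cnj (g i a) * gram ({..<n} \<times> {1..r}) (\<lambda>_. 1) (kraus_vec n A h) i l * g l b)"
proof -
  have e: "cnj (scaled_entry g h l a c) = (\<Sum>i<m. kraus_vec n A h (c, l) i * g i a)" for l a c
  proof -
    have "scaled_entry g h l a c = (\<Sum>j<n. \<Sum>i<m. A l $$ (i, j) * h j c * cnj (g i a))"
      unfolding scaled_entry_def sum_distrib_right by (intro sum.cong refl) (simp add: mult_ac)
    also have "\<dots> = (\<Sum>i<m. (\<Sum>j<n. A l $$ (i, j) * h j c) * cnj (g i a))"
      unfolding sum_distrib_right by (rule sum.swap)
    finally show ?thesis by (simp add: kraus_vec_def)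
  qed
  let ?w = "kraus_vec n A h" and ?I = "{..<n} \<times> {1..r}"
  have "left_gram g h a b = (\<Sum>t\<in>?I. (\<Sum>i<m. cnj (?w t i * g i a)) * (\<Sum>l<m. ?w t l * g l b))"
    unfolding left_gram_def gram_def e by simp
  also have "\<dots> = (\<Sum>t\<in>?I. \<Sum>i<m. \<Sum>l<m. cnj (g i a) * (cnj (?w t i) * ?w t l) * g l b)"
    unfolding sum_product by (intro sum.cong refl) (simp add: mult_ac)
  also have "\<dots> = (\<Sum>i<m. \<Sum>t\<in>?I. \<Sum>l<m. cnj (g i a) * (cnj (?w t i) * ?w t l) * g l b)"
    by (rule sum.swap)
  also have "\<dots> = (\<Sum>i<m. \<Sum>l<m. \<Sum>t\<in>?I. cnj (g i a) * (cnj (?w t i) * ?w t l) * g l b)"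
    by (intro sum.cong[OF refl] sum.swap)
  finally show ?thesis by (simp add: gram_def sum_distrib_left sum_distrib_right)
qed

text \<open>Capacity bounds the weights of \<open>g\<close> and \<open>h\<close> by the relative
  determinant of the scaled image, Fischer's inequality passes to powers of its diagonal entries,
  and \<open>pw_le_exp\<close> turns these into the exponential of the trace. Taking logarithms
  gives the objective.\<close>

lemma objective_bounded_below:
  assumes c: "0 < c" "\<And>h. h \<in> GL_flag n \<Longrightarrow> c * flag_weight n p h \<le> image_det h"
  shows "\<exists>K. \<forall>g\<in>GL_flag m. \<forall>h\<in>GL_flag n. K \<le> objective g h"
proof -
  obtain C where C: "C > 0" "\<And>h. image_det h \<le> C * rdet m q (gram ({..<n} \<times> {1..r}) (\<lambda>_. 1) (kraus_vec n A (entries h)))"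
    using rdet_image_le by blast
  define D where "D = C * (\<Prod>j<m. exp (q (Suc j) * ln (q (Suc j))))"
  have D: "D > 0" unfolding D_def using C(1) by (intro mult_pos_pos prod_pos) auto
  have "ln c - ln D \<le> objective g h" if g: "g \<in> GL_flag m" and h: "h \<in> GL_flag n" for g h
  proof -
    let ?G = "gram ({..<n} \<times> {1..r}) (\<lambda>_. 1) (kraus_vec n A (entries h))"
    let ?N = "left_gram (entries g) (entries h)"
    have N: "psd m ?N" unfolding left_gram_def by (intro psd_gram) auto
    have Nd: "0 \<le> Re (?N j j)" if "j < m" for j using psd_diag(2)[OF N that] .
    have G: "psd m ?G" by (intro psd_gram) auto
    note pg = flag_weight_pos[OF g, of q] and ph = flag_weight_pos[OF h, of p]
    have "rdet m q ?N = rdet m q (\<lambda>a b. \<Sum>i<m. \<Sum>l<m. cnj (g $$ (i, a)) * ?G i l * g $$ (l, b))"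
      by (intro rdet_cong left_gram_congruence)
    also have "\<dots> = flag_weight m q g * rdet m q ?G"
      unfolding flag_weight_def using g by (intro rdet_congruence wq G) (auto simp: GL_flag_iff)
    finally have rN: "rdet m q ?N = flag_weight m q g * rdet m q ?G" .
    have "c * flag_weight n p h * flag_weight m q g \<le> image_det h * flag_weight m q g"
      using c(2)[OF h] pg by (intro mult_right_mono) auto
    also have "\<dots> \<le> C * rdet m q ?G * flag_weight m q g"
      using C(2) pg by (intro mult_right_mono) auto
    also have "\<dots> = C * rdet m q ?N" by (simp add: rN mult_ac)
    also have "\<dots> \<le> C * (\<Prod>j<m. pw (Re (?N j j)) (q (Suc j)))"
      using C(1) rdet_le_diag[OF wq N] by (intro mult_left_mono) auto
    also have "\<dots> \<le> C * (\<Prod>j<m. exp (q (Suc j) * ln (q (Suc j))) * exp (Re (?N j j)))"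
      using C(1) Nd q_nonneg by (intro mult_left_mono prod_mono conjI pw_le_exp pw_nonneg) auto
    also have "\<dots> = D * exp (energy (entries g) (entries h))"
      unfolding D_def prod.distrib energy_trace(1)[symmetric] exp_sum[OF finite_lessThan] by simp
    finally have "ln (c * flag_weight n p h * flag_weight m q g) \<le> ln (D * exp (energy (entries g) (entries h)))"
      using c(1) pg ph D by (subst ln_le_cancel_iff) auto
    then show ?thesis
      using c(1) pg ph D
      by (simp add: ln_mult objective_def ln_flag_weight[OF g, symmetric] ln_flag_weight[OF h, symmetric])
  qed
  then show ?thesis by blast
qed

text \<open>The diagonal of a product of triangular matrices is the product of the diagonals, so
  logarithmic weights add. The bound 1/2 keeps the factors \<open>1 + Z a a\<close> away from
  0.\<close>

lemma GL_flag_perturb: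
  fixes Z :: "nat \<Rightarrow> nat \<Rightarrow> complex"
  assumes g: "g \<in> GL_flag k" and Z: "\<And>e a. a < e \<Longrightarrow> Z e a = 0" "\<And>a. a < k \<Longrightarrow> cmod (Z a a) \<le> 1 / 2"
  defines "g' \<equiv> mat k k (\<lambda>(i, a). \<Sum>e<k. g $$ (i, e) * ((if e = a then 1 else 0) + Z e a))"
  shows "g' \<in> GL_flag k"
    and "log_weight k w g' = log_weight k w g + (\<Sum>a<k. w (Suc a) * ln ((cmod (1 + Z a a))\<^sup>2))"
proof -
  have nz: "1 + Z a a \<noteq> 0" if "a < k" for a
  proof
    assume "1 + Z a a = 0"
    then have "Z a a = - 1" by (simp add: eq_neg_iff_add_eq_0 add.commute)
    then show False using Z(2)[OF that] by simp
  qed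
  have g0: "g $$ (i, j) = 0" if "j < i" "i < k" for i j using g that by (auto simp: GL_flag_iff)
  have diag: "g' $$ (a, a) = g $$ (a, a) * (1 + Z a a)" if "a < k" for a
  proof -
    have "g' $$ (a, a) = (\<Sum>e<k. g $$ (a, e) * ((if e = a then 1 else 0) + Z e a))"
      unfolding g'_def using that by simp
    also have "\<dots> = (\<Sum>e\<in>{a}. g $$ (a, e) * ((if e = a then 1 else 0) + Z e a))"
      using that Z(1) g0[of _ a] by (intro sum.mono_neutral_right) (auto simp: neq_iff)
    finally have "g' $$ (a, a) = (\<Sum>e\<in>{a}. g $$ (a, e) * ((if e = a then 1 else 0) + Z e a))" .
    then show ?thesis by simp
  qed
  have "g' $$ (i, a) = 0" if "a < i" "i < k" for i a
  proof -
    have "g $$ (i, e) * ((if e = a then 1 else 0) + Z e a) = 0" for e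
      using that g0[of e i] Z(1)[of a e] by (cases "e < i") auto
    then show ?thesis unfolding g'_def using that by (simp add: sum.neutral)
  qed
  then show "g' \<in> GL_flag k"
    using g nz diag by (auto simp: GL_flag_iff g'_def)
  have "ln ((cmod (g' $$ (a, a)))\<^sup>2) = ln ((cmod (g $$ (a, a)))\<^sup>2) + ln ((cmod (1 + Z a a))\<^sup>2)" if "a < k" for a
    using nz[OF that] g that by (simp add: diag norm_mult power_mult_distrib ln_mult GL_flag_iff)
  then show "log_weight k w g' = log_weight k w g + (\<Sum>a<k. w (Suc a) * ln ((cmod (1 + Z a a))\<^sup>2))"
    unfolding log_weight_def sum.distrib[symmetric]
    by (intro sum.cong refl) (simp add: distrib_left)
qed

lemma hs_norm_scaled_map:
  assumes gc: "g \<in> carrier_mat m m" and hc: "h \<in> carrier_mat n n"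
  shows "hs_norm (scaled_map g h (cp_map m r A) (1\<^sub>m n) - seq_diag m q)
     = sqrt (\<Sum>a<m. \<Sum>b<m. (cmod (left_gram (entries g) (entries h) a b - (if a = b then of_real (q (Suc a)) else 0)))\<^sup>2)"
proof -
  have "scaled_map g h (cp_map m r A) (1\<^sub>m n) = cp_map m r (scaled_kraus g h A) (1\<^sub>m n)"
    by (rule cp_map_scaled_kraus[OF kraus gc hc, symmetric]) auto
  moreover have "cp_map m r (scaled_kraus g h A) (1\<^sub>m n) $$ (a, b) = left_gram (entries g) (entries h) a b" if "a < m" "b < m" for a b
  proof -
    have "cp_map m r (scaled_kraus g h A) (1\<^sub>m n) $$ (a, b)
        = gram ({..<n} \<times> {1..r}) (\<lambda>_. 1) (\<lambda>t f. cnj (scaled_kraus g h A (snd t) $$ (f, fst t))) a b"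
      by (rule cp_map_one_index[OF _ that]) (rule scaled_kraus_index(1)[OF _ gc hc])
    also have "\<dots> = left_gram (entries g) (entries h) a b"
      unfolding left_gram_def gram_def
      using that by (intro sum.cong refl) (auto simp: scaled_kraus_index(2)[OF _ gc hc])
    finally show ?thesis .
  qed
  ultimately show ?thesis
    by (subst hs_norm_eq[of _ m])
      (auto simp: cp_map_def seq_diag_def mat_diag_def
        intro!: sum.cong arg_cong[of _ _ "\<lambda>x. (cmod x)\<^sup>2"])
qed

lemma hs_norm_scaled_dual:
  assumes gc: "g \<in> carrier_mat m m" and hc: "h \<in> carrier_mat n n"
  shows "hs_norm (cp_dual n r (scaled_kraus g h A) (1\<^sub>m m) - seq_diag n p)
     = sqrt (\<Sum>a<n. \<Sum>b<n. (cmod (right_gram (entries g) (entries h) a b - (if a = b then of_real (p (Suc a)) else 0)))\<^sup>2)"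
proof -
  have "cp_dual n r (scaled_kraus g h A) (1\<^sub>m m) $$ (a, b) = right_gram (entries g) (entries h) a b" if "a < n" "b < n" for a b
  proof -
    have "cp_dual n r (scaled_kraus g h A) (1\<^sub>m m) $$ (a, b)
        = gram ({..<m} \<times> {1..r}) (\<lambda>_. 1) (\<lambda>t f. scaled_kraus g h A (snd t) $$ (fst t, f)) a b"
      by (rule cp_dual_index[OF _ that]) (rule scaled_kraus_index(1)[OF _ gc hc])
    also have "\<dots> = right_gram (entries g) (entries h) a b"
      unfolding right_gram_def gram_def
      using that by (intro sum.cong refl) (auto simp: scaled_kraus_index(2)[OF _ gc hc])
    finally show ?thesis .
  qed
  then show ?thesis
    by (subst hs_norm_eq[of _ n])
      (auto simp: cp_dual_def seq_diag_def mat_diag_def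
        intro!: sum.cong arg_cong[of _ _ "\<lambda>x. (cmod x)\<^sup>2"])
qed

lemma near_minimiser_scales:
  assumes g: "g \<in> GL_flag m" and h: "h \<in> GL_flag n" and \<delta>: "0 \<le> \<delta>" "\<delta> \<le> 1"
    and min: "\<And>g' h'. g' \<in> GL_flag m \<Longrightarrow> h' \<in> GL_flag n \<Longrightarrow> objective g h - \<delta> \<le> objective g' h'"
  defines "S \<equiv> \<Sum>i<m. q (Suc i)"
  shows "(hs_norm (scaled_map g h (cp_map m r A) (1\<^sub>m n) - seq_diag m q))\<^sup>2 \<le> 2 * (4 + 7 * S) * \<delta>"
    and "(hs_norm (cp_dual n r (scaled_kraus g h A) (1\<^sub>m m) - seq_diag n p))\<^sup>2 \<le> 2 * (4 + 7 * S) * \<delta>"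
proof -
  have gc: "g \<in> carrier_mat m m" and hc: "h \<in> carrier_mat n n" using g h by (auto simp: GL_flag_iff)
  let ?g = "entries g" and ?h = "entries h"
  let ?\<delta> = "\<lambda>e a. if e = a then 1 else 0 :: complex"
  have "(\<Sum>a<m. \<Sum>b<m. (cmod (left_gram ?g ?h a b - (if a = b then of_real (q (Suc a)) else 0)))\<^sup>2)
      \<le> 2 * (4 + 7 * (\<Sum>a<m. q (Suc a))) * \<delta>"
  proof (rule near_minimiser_close[where k = m and q = q and M = "left_gram ?g ?h", OF left_gram_def q_nonneg \<delta>])
    fix Z :: "nat \<Rightarrow> nat \<Rightarrow> complex"
    assume Z: "\<And>e a. a < e \<Longrightarrow> Z e a = 0" "\<And>a. a < m \<Longrightarrow> cmod (Z a a) \<le> 1 / 2"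
    define g' where "g' = mat m m (\<lambda>(i, a). \<Sum>e<m. g $$ (i, e) * (?\<delta> e a + Z e a))"
    have "energy (entries g') ?h = energy (\<lambda>i a. \<Sum>e<m. g $$ (i, e) * (?\<delta> e a + Z e a)) ?h"
      by (intro energy_cong) (auto simp: g'_def)
    then have "objective g' h = (\<Sum>a<m. Re (quad_form m (left_gram ?g ?h) (\<lambda>e. ?\<delta> e a + Z e a)))
        - (log_weight m q g + (\<Sum>a<m. q (Suc a) * ln ((cmod (1 + Z a a))\<^sup>2))) - log_weight n p h"
      unfolding objective_def energy_left
      using GL_flag_perturb(2)[where Z = Z and w = q, OF g Z] by (simp add: g'_def)
    moreover have "objective g h - \<delta> \<le> objective g' h"
      using GL_flag_perturb(1)[where Z = Z, OF g Z] h unfolding g'_def by (intro min)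
    ultimately show "(\<Sum>a<m. Re (left_gram ?g ?h a a)) - \<delta>
      \<le> (\<Sum>a<m. Re (quad_form m (left_gram ?g ?h) (\<lambda>e. ?\<delta> e a + Z e a)))
        - (\<Sum>a<m. q (Suc a) * ln ((cmod (1 + Z a a))\<^sup>2))"
      unfolding energy_trace by (simp add: objective_def)
  qed
  then show "(hs_norm (scaled_map g h (cp_map m r A) (1\<^sub>m n) - seq_diag m q))\<^sup>2 \<le> 2 * (4 + 7 * S) * \<delta>"
    unfolding hs_norm_scaled_map[OF gc hc] by (simp add: S_def sum_nonneg)
  have "(\<Sum>a<n. \<Sum>b<n. (cmod (right_gram ?g ?h a b - (if a = b then of_real (p (Suc a)) else 0)))\<^sup>2)
      \<le> 2 * (4 + 7 * (\<Sum>a<n. p (Suc a))) * \<delta>"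
  proof (rule near_minimiser_close[where k = n and q = p and M = "right_gram ?g ?h", OF right_gram_def p_nonneg \<delta>])
    fix Z :: "nat \<Rightarrow> nat \<Rightarrow> complex"
    assume Z: "\<And>e a. a < e \<Longrightarrow> Z e a = 0" "\<And>a. a < n \<Longrightarrow> cmod (Z a a) \<le> 1 / 2"
    define h' where "h' = mat n n (\<lambda>(i, a). \<Sum>e<n. h $$ (i, e) * (?\<delta> e a + Z e a))"
    have "energy ?g (entries h') = energy ?g (\<lambda>i a. \<Sum>e<n. h $$ (i, e) * (?\<delta> e a + Z e a))"
      by (intro energy_cong) (auto simp: h'_def)
    then have "objective g h' = (\<Sum>a<n. Re (quad_form n (right_gram ?g ?h) (\<lambda>e. ?\<delta> e a + Z e a)))
        - log_weight m q g - (log_weight n p h + (\<Sum>a<n. p (Suc a) * ln ((cmod (1 + Z a a))\<^sup>2)))"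
      unfolding objective_def energy_right
      using GL_flag_perturb(2)[where Z = Z and w = p, OF h Z] by (simp add: h'_def)
    moreover have "objective g h - \<delta> \<le> objective g h'"
      using GL_flag_perturb(1)[where Z = Z, OF h Z] g unfolding h'_def by (intro min)
    ultimately show "(\<Sum>a<n. Re (right_gram ?g ?h a a)) - \<delta>
      \<le> (\<Sum>a<n. Re (quad_form n (right_gram ?g ?h) (\<lambda>e. ?\<delta> e a + Z e a)))
        - (\<Sum>a<n. p (Suc a) * ln ((cmod (1 + Z a a))\<^sup>2))"
      unfolding energy_trace by (simp add: objective_def)
  qed
  then show "(hs_norm (cp_dual n r (scaled_kraus g h A) (1\<^sub>m m) - seq_diag n p))\<^sup>2 \<le> 2 * (4 + 7 * S) * \<delta>"
    unfolding hs_norm_scaled_dual[OF gc hc] by (simp add: S_def total sum_nonneg)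
qed

lemma capacity_imp_scalable:
  assumes "capacity m n (cp_map m r A) p q > 0"
  shows "approx_scalable m n r A (GL_flag m) (GL_flag n)
    (1\<^sub>m n) (seq_diag m q) (1\<^sub>m m) (seq_diag n p)"
  unfolding approx_scalable_def
proof (intro allI impI)
  fix \<epsilon> :: real assume \<epsilon>: "\<epsilon> > 0"
  define S where "S = (\<Sum>i<m. q (Suc i))"
  have S: "S \<ge> 0" unfolding S_def using q_nonneg by (intro sum_nonneg) auto
  \<comment> \<open>The second argument makes the error bound at most \<epsilon> squared; the
    descent estimate also assumes \<delta> at most 1.\<close>
  define \<delta> where "\<delta> = min 1 (\<epsilon>\<^sup>2 / (2 * (4 + 7 * S)))"
  have \<delta>: "0 < \<delta>" "\<delta> \<le> 1" using \<epsilon> S by (auto simp: \<delta>_def)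
  have "2 * (4 + 7 * S) * \<delta> \<le> 2 * (4 + 7 * S) * (\<epsilon>\<^sup>2 / (2 * (4 + 7 * S)))"
    using S by (intro mult_left_mono) (auto simp: \<delta>_def)
  then have \<delta>\<epsilon>: "2 * (4 + 7 * S) * \<delta> \<le> \<epsilon>\<^sup>2" using S by simp
  obtain c where c: "0 < c" "\<And>h. h \<in> GL_flag n \<Longrightarrow> c * flag_weight n p h \<le> image_det h"
    using assms unfolding capacity_pos_iff by blast
  obtain K where K: "\<And>g h. g \<in> GL_flag m \<Longrightarrow> h \<in> GL_flag n \<Longrightarrow> K \<le> objective g h"
    using objective_bounded_below[OF c] by blast
  let ?V = "(\<lambda>(g, h). objective g h) ` (GL_flag m \<times> GL_flag n)"
  have "1\<^sub>m m \<in> GL_flag m" "1\<^sub>m n \<in> GL_flag n" by (rule one_mat_GL_flag)+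
  then have ne: "?V \<noteq> {}" by blast
  have bdd: "bdd_below ?V" using K by (intro bdd_belowI[of _ K]) auto
  have "Inf ?V < Inf ?V + \<delta>" using \<delta> by simp
  then obtain v where v: "v \<in> ?V" "v < Inf ?V + \<delta>"
    using cInf_lessD[OF ne] by blast
  then obtain g h where gh: "g \<in> GL_flag m" "h \<in> GL_flag n" "objective g h < Inf ?V + \<delta>" by auto
  have min: "objective g h - \<delta> \<le> objective g' h'" if "g' \<in> GL_flag m" "h' \<in> GL_flag n" for g' h'
  proof -
    have "Inf ?V \<le> objective g' h'" using that by (intro cInf_lower bdd) force
    then show ?thesis using gh(3) by simp
  qed
  note sc = near_minimiser_scales[OF gh(1,2) less_imp_le[OF \<delta>(1)] \<delta>(2) min, folded S_def]
  have "x \<le> \<epsilon>" if "x\<^sup>2 \<le> 2 * (4 + 7 * S) * \<delta>" for x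
    using that \<delta>\<epsilon> \<epsilon> by (intro power2_le_imp_le[of x \<epsilon>]) auto
  then show "\<exists>g\<in>GL_flag m. \<exists>h\<in>GL_flag n.
        hs_norm (scaled_map g h (cp_map m r A) (1\<^sub>m n) - seq_diag m q) \<le> \<epsilon> \<and>
        hs_norm (cp_dual n r (scaled_kraus g h A) (1\<^sub>m m) - seq_diag n p) \<le> \<epsilon>"
    using sc gh by blast
qed

end


section \<open>Approximate scalability implies rank non-decrease\<close>

text \<open>Rewrites the rank inequality for a pair (L, R): its left side is the sum of the weights
  at the pivots of L and of R.\<close>

lemma sum_seq_diff_card:
  assumes "E \<subseteq> {..<k}"
  shows "(\<Sum>j = 1..k. seq_diff k a j * real (card (E \<inter> {..<j}))) = (\<Sum>e\<in>E. a (Suc e))"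
proof -
  have fin: "finite E" using assms finite_subset by blast
  have "real (card (E \<inter> {..<j})) = (\<Sum>i<j. if i \<in> E then 1 else 0)" for j
    by (simp add: sum.If_cases Int_commute)
  then have "(\<Sum>j = 1..k. seq_diff k a j * real (card (E \<inter> {..<j})))
      = (\<Sum>i<k. a (Suc i) * (if i \<in> E then 1 else 0))"
    using sum_seq_diff_prefix[of k a "\<lambda>i. if i \<in> E then 1 else 0"] by simp
  also have "\<dots> = (\<Sum>i\<in>E. a (Suc i) * (if i \<in> E then 1 else 0))"
    using assms by (intro sum.mono_neutral_right) auto
  finally show ?thesis by simp
qed

definition orthonormal :: "nat \<Rightarrow> nat set \<Rightarrow> (nat \<Rightarrow> nat \<Rightarrow> complex) \<Rightarrow> bool" where
  "orthonormal k E y \<longleftrightarrow> (\<forall>e\<in>E. \<forall>f\<in>E. (\<Sum>j<k. cnj (y e j) * y f j) = (if e = f then 1 else 0))"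

lemma orthonormalD: "orthonormal k E y \<Longrightarrow> e \<in> E \<Longrightarrow> f \<in> E \<Longrightarrow>
    (\<Sum>j<k. cnj (y e j) * y f j) = (if e = f then 1 else 0)"
  by (auto simp: orthonormal_def)

text \<open>Gram-Schmidt in the order of increasing pivots. The vectors already constructed vanish
  at the new pivot \<open>b\<close> and beyond, so subtracting them changes neither the pivot entry
  nor the zeros after it.\<close>

lemma adapted_orthonormal:
  fixes X :: "(nat \<Rightarrow> complex) set"
  assumes "finite E" "E \<subseteq> {..<k}"
    and lin: "\<And>x y c. x \<in> X \<Longrightarrow> y \<in> X \<Longrightarrow> (\<lambda>j. x j + c * y j) \<in> X"
    and ex: "\<And>e. e \<in> E \<Longrightarrow> \<exists>x\<in>X. x e \<noteq> 0 \<and> (\<forall>j. e < j \<longrightarrow> j < k \<longrightarrow> x j = 0)"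
  shows "\<exists>y. orthonormal k E y \<and> (\<forall>e\<in>E. y e \<in> X \<and> (\<forall>j. e < j \<longrightarrow> j < k \<longrightarrow> y e j = 0))"
  using assms(1,2) ex
proof (induction E rule: finite_linorder_max_induct)
  case empty
  then show ?case by (simp add: orthonormal_def)
next
  case (insert b E)
  obtain y where y: "orthonormal k E y" "\<And>e. e \<in> E \<Longrightarrow> y e \<in> X"
    "\<And>e j. e \<in> E \<Longrightarrow> e < j \<Longrightarrow> j < k \<Longrightarrow> y e j = 0"
    using insert.IH insert.prems by (auto simp del: ex_simps)
  obtain x where x: "x \<in> X" "x b \<noteq> 0" "\<And>j. b < j \<Longrightarrow> j < k \<Longrightarrow> x j = 0"
    using insert.prems(2)[of b] by blast
  have bk: "b < k" using insert.prems by auto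
  define \<beta> where "\<beta> f = (\<Sum>j<k. cnj (y f j) * x j)" for f
  define z where "z j = x j - (\<Sum>f\<in>E. \<beta> f * y f j)" for j
  have span: "(\<lambda>j. x j - (\<Sum>f\<in>F. \<beta> f * y f j)) \<in> X" if "finite F" "F \<subseteq> E" for F
    using that
  proof (induction F)
    case (insert f F)
    have "(\<lambda>j. (x j - (\<Sum>f\<in>F. \<beta> f * y f j)) + (- \<beta> f) * y f j) \<in> X"
      using insert y(2) by (intro lin) auto
    then show ?case using insert by (simp add: algebra_simps)
  qed (simp add: x)
  have zX: "z \<in> X" using span[OF insert.hyps(1)] by (simp add: z_def[abs_def])
  have zb: "z b = x b"
    unfolding z_def using y(3) insert.hyps(2) bk by (simp add: sum.neutral)
  have z0: "z j = 0" if "b < j" "j < k" for j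
  proof -
    have "\<beta> f * y f j = 0" if "f \<in> E" for f
      using y(3)[OF that] insert.hyps(2) that \<open>b < j\<close> \<open>j < k\<close> by (auto dest: less_trans)
    then show ?thesis using x(3)[OF that] by (simp add: z_def)
  qed
  have orth: "(\<Sum>j<k. cnj (y e j) * z j) = 0" if e: "e \<in> E" for e
  proof -
    have "(\<Sum>j<k. cnj (y e j) * z j) = \<beta> e - (\<Sum>j<k. \<Sum>f\<in>E. \<beta> f * (cnj (y e j) * y f j))"
      unfolding z_def \<beta>_def by (simp add: right_diff_distrib sum_subtractf sum_distrib_left mult_ac)
    also have "(\<Sum>j<k. \<Sum>f\<in>E. \<beta> f * (cnj (y e j) * y f j)) = (\<Sum>f\<in>E. \<beta> f * (\<Sum>j<k. cnj (y e j) * y f j))"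
      unfolding sum_distrib_left by (rule sum.swap)
    also have "\<dots> = (\<Sum>f\<in>E. if e = f then \<beta> f else 0)"
      using orthonormalD[OF y(1) e] by (intro sum.cong) auto
    also have "\<dots> = \<beta> e" using e insert.hyps(1) by simp
    finally show ?thesis by simp
  qed
  define N where "N = (\<Sum>j<k. (cmod (z j))\<^sup>2)"
  have "0 < (cmod (z b))\<^sup>2" using zb x(2) by simp
  also have "\<dots> \<le> N" unfolding N_def using bk by (intro member_le_sum) auto
  finally have N: "0 < N" .
  define w where "w j = z j / of_real (sqrt N)" for j
  have "(\<lambda>j. z j + (1 / of_real (sqrt N) - 1) * z j) \<in> X" using zX zX by (rule lin)
  moreover have "(\<lambda>j. z j + (1 / of_real (sqrt N) - 1) * z j) = w"
    by (simp add: w_def fun_eq_iff algebra_simps)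
  ultimately have wX: "w \<in> X" by simp
  have ww: "(\<Sum>j<k. cnj (w j) * w j) = 1"
  proof -
    have "(\<Sum>j<k. cnj (w j) * w j) = (\<Sum>j<k. cnj (z j) * z j) / of_real (sqrt N * sqrt N)"
      unfolding w_def complex_cnj_divide complex_cnj_complex_of_real of_real_mult times_divide_times_eq
      by (rule sum_divide_distrib[symmetric])
    also have "(\<Sum>j<k. cnj (z j) * z j) = of_real N"
      unfolding N_def of_real_sum complex_norm_square by (simp add: mult.commute)
    finally show ?thesis using N by simp
  qed
  have yw: "(\<Sum>j<k. cnj (y e j) * w j) = 0" if "e \<in> E" for e
    using orth[OF that] by (simp add: w_def sum_divide_distrib[symmetric])
  have wy: "(\<Sum>j<k. cnj (w j) * y e j) = 0" if "e \<in> E" for e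
  proof -
    have "(\<Sum>j<k. cnj (w j) * y e j) = cnj (\<Sum>j<k. cnj (y e j) * w j)" by (simp add: mult.commute)
    then show ?thesis using yw[OF that] by simp
  qed
  define y' where "y' = y(b := w)"
  have bE: "b \<notin> E" using insert.hyps by auto
  have "orthonormal k (insert b E) y'"
    unfolding orthonormal_def
  proof (intro ballI)
    fix e f assume "e \<in> insert b E" "f \<in> insert b E"
    then show "(\<Sum>j<k. cnj (y' e j) * y' f j) = (if e = f then 1 else 0)"
      using orthonormalD[OF y(1), of e f] ww yw[of e] wy[of f] bE
      by (cases "e = b"; cases "f = b") (auto simp: y'_def)
  qed
  moreover have "y' e \<in> X \<and> (\<forall>j. e < j \<longrightarrow> j < k \<longrightarrow> y' e j = 0)" if "e \<in> insert b E" for e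
    using that wX y(2,3) z0 by (auto simp: y'_def w_def)
  ultimately show ?case by blast
qed

text \<open>Pythagoras: the subtracted sum is the orthogonal projection of \<open>b\<close> to the
  span of the conjugates of the \<open>y f\<close>.\<close>

lemma projection_defect:
  assumes F: "finite F" and y: "orthonormal n F y" and \<beta>: "\<And>f. f \<in> F \<Longrightarrow> \<beta> f = (\<Sum>c<n. b c * y f c)"
  shows "(\<Sum>c<n. (cmod (b c - (\<Sum>f\<in>F. \<beta> f * cnj (y f c))))\<^sup>2) = (\<Sum>c<n. (cmod (b c))\<^sup>2) - (\<Sum>f\<in>F. (cmod (\<beta> f))\<^sup>2)"
proof -
  let ?s = "\<lambda>c. \<Sum>f\<in>F. \<beta> f * cnj (y f c)"
  have bs: "(\<Sum>c<n. b c * cnj (?s c)) = (\<Sum>f\<in>F. \<beta> f * cnj (\<beta> f))"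
  proof -
    have "(\<Sum>c<n. b c * cnj (?s c)) = (\<Sum>c<n. \<Sum>f\<in>F. cnj (\<beta> f) * (b c * y f c))"
      by (simp add: sum_distrib_left mult_ac)
    also have "\<dots> = (\<Sum>f\<in>F. cnj (\<beta> f) * (\<Sum>c<n. b c * y f c))"
      unfolding sum_distrib_left by (rule sum.swap)
    also have "\<dots> = (\<Sum>f\<in>F. \<beta> f * cnj (\<beta> f))"
      using \<beta> by (intro sum.cong) (auto simp: mult.commute)
    finally show ?thesis .
  qed
  have ss: "(\<Sum>c<n. ?s c * cnj (?s c)) = (\<Sum>f\<in>F. \<beta> f * cnj (\<beta> f))"
  proof -
    have "(\<Sum>c<n. ?s c * cnj (?s c)) = (\<Sum>c<n. \<Sum>f\<in>F. \<Sum>e\<in>F. \<beta> f * cnj (\<beta> e) * (cnj (y f c) * y e c))"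
      by (simp add: sum_product mult_ac)
    also have "\<dots> = (\<Sum>f\<in>F. \<Sum>c<n. \<Sum>e\<in>F. \<beta> f * cnj (\<beta> e) * (cnj (y f c) * y e c))"
      by (rule sum.swap)
    also have "\<dots> = (\<Sum>f\<in>F. \<Sum>e\<in>F. \<Sum>c<n. \<beta> f * cnj (\<beta> e) * (cnj (y f c) * y e c))"
      by (intro sum.cong[OF refl] sum.swap)
    also have "\<dots> = (\<Sum>f\<in>F. \<Sum>e\<in>F. if f = e then \<beta> f * cnj (\<beta> e) else 0)"
      using orthonormalD[OF y]
      by (intro sum.cong refl) (simp add: sum_distrib_left[symmetric] if_distrib cong: if_cong)
    also have "\<dots> = (\<Sum>f\<in>F. \<beta> f * cnj (\<beta> f))" using F by simp
    finally show ?thesis .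
  qed
  have "(\<Sum>c<n. cnj (b c) * ?s c) = cnj (\<Sum>c<n. b c * cnj (?s c))" by simp
  then have sb: "(\<Sum>c<n. ?s c * cnj (b c)) = (\<Sum>f\<in>F. \<beta> f * cnj (\<beta> f))"
    unfolding bs by (simp add: mult.commute)
  have "complex_of_real (\<Sum>c<n. (cmod (b c - ?s c))\<^sup>2)
      = (\<Sum>c<n. b c * cnj (b c)) - (\<Sum>c<n. b c * cnj (?s c)) - (\<Sum>c<n. ?s c * cnj (b c)) + (\<Sum>c<n. ?s c * cnj (?s c))"
    unfolding of_real_sum complex_norm_square complex_cnj_diff
    by (simp only: sum.distrib[symmetric] sum_subtractf[symmetric]) (simp add: algebra_simps)
  also have "\<dots> = (\<Sum>c<n. b c * cnj (b c)) - (\<Sum>f\<in>F. \<beta> f * cnj (\<beta> f))"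
    unfolding bs ss sb by simp
  also have "\<dots> = complex_of_real ((\<Sum>c<n. (cmod (b c))\<^sup>2) - (\<Sum>f\<in>F. (cmod (\<beta> f))\<^sup>2))"
    unfolding of_real_diff of_real_sum complex_norm_square ..
  finally show ?thesis by (simp only: of_real_eq_iff)
qed

lemma orthonormal_cnj: "orthonormal k E y \<Longrightarrow> orthonormal k E (\<lambda>e j. cnj (y e j))"
  unfolding orthonormal_def
proof (intro ballI)
  fix e f assume y: "\<forall>e\<in>E. \<forall>f\<in>E. (\<Sum>j<k. cnj (y e j) * y f j) = (if e = f then 1 else 0)"
    and ef: "e \<in> E" "f \<in> E"
  have "(\<Sum>j<k. cnj (cnj (y e j)) * cnj (y f j)) = cnj (\<Sum>j<k. cnj (y e j) * y f j)" by simp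
  then show "(\<Sum>j<k. cnj (cnj (y e j)) * cnj (y f j)) = (if e = f then 1 else 0)"
    using y ef by simp
qed

text \<open>The left factors see only the part of \<open>B\<close> orthogonal to the \<open>y f\<close>.\<close>

lemma orthogonal_blocks_le:
  assumes F: "finite F" and y: "orthonormal n F y" and E: "finite E" and x: "orthonormal m E x"
    and orth: "\<And>e f. e \<in> E \<Longrightarrow> f \<in> F \<Longrightarrow> (\<Sum>a<m. \<Sum>c<n. cnj (x e a) * B a c * y f c) = 0"
  shows "(\<Sum>e\<in>E. \<Sum>c<n. (cmod (\<Sum>a<m. cnj (x e a) * B a c))\<^sup>2) + (\<Sum>f\<in>F. \<Sum>a<m. (cmod (\<Sum>c<n. B a c * y f c))\<^sup>2)
    \<le> (\<Sum>a<m. \<Sum>c<n. (cmod (B a c))\<^sup>2)"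
proof -
  define \<beta> where "\<beta> a f = (\<Sum>c<n. B a c * y f c)" for a f
  define B' where "B' a c = B a c - (\<Sum>f\<in>F. \<beta> a f * cnj (y f c))" for a c
  have B': "(\<Sum>c<n. (cmod (B' a c))\<^sup>2) = (\<Sum>c<n. (cmod (B a c))\<^sup>2) - (\<Sum>f\<in>F. (cmod (\<beta> a f))\<^sup>2)" for a
    unfolding B'_def by (rule projection_defect[OF F y]) (simp add: \<beta>_def)
  have "(\<Sum>a<m. cnj (x e a) * B a c) = (\<Sum>a<m. B' a c * cnj (x e a))" if "e \<in> E" for e c
  proof -
    have "(\<Sum>a<m. B' a c * cnj (x e a))
        = (\<Sum>a<m. cnj (x e a) * B a c) - (\<Sum>a<m. \<Sum>f\<in>F. cnj (y f c) * (cnj (x e a) * \<beta> a f))"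
      unfolding B'_def left_diff_distrib sum_subtractf sum_distrib_right by (simp add: mult_ac)
    also have "(\<Sum>a<m. \<Sum>f\<in>F. cnj (y f c) * (cnj (x e a) * \<beta> a f)) = (\<Sum>f\<in>F. cnj (y f c) * (\<Sum>a<m. cnj (x e a) * \<beta> a f))"
      unfolding sum_distrib_left by (rule sum.swap)
    also have "\<dots> = 0"
      using orth[OF that] by (intro sum.neutral) (simp add: \<beta>_def sum_distrib_left mult.assoc)
    finally show ?thesis by simp
  qed
  then have "(\<Sum>e\<in>E. \<Sum>c<n. (cmod (\<Sum>a<m. cnj (x e a) * B a c))\<^sup>2)
      = (\<Sum>c<n. \<Sum>e\<in>E. (cmod (\<Sum>a<m. B' a c * cnj (x e a)))\<^sup>2)"
    by (subst sum.swap) simp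
  also have "\<dots> \<le> (\<Sum>c<n. \<Sum>a<m. (cmod (B' a c))\<^sup>2)"
  proof (rule sum_mono)
    fix c
    \<comment> \<open>Bessel's inequality for column \<open>c\<close> of the remainder.\<close>
    have "0 \<le> (\<Sum>a<m. (cmod (B' a c - (\<Sum>e\<in>E. (\<Sum>a<m. B' a c * cnj (x e a)) * cnj (cnj (x e a)))))\<^sup>2)"
      by (intro sum_nonneg) auto
    also have "\<dots> = (\<Sum>a<m. (cmod (B' a c))\<^sup>2) - (\<Sum>e\<in>E. (cmod (\<Sum>a<m. B' a c * cnj (x e a)))\<^sup>2)"
      by (rule projection_defect[OF E orthonormal_cnj[OF x]]) simp
    finally show "(\<Sum>e\<in>E. (cmod (\<Sum>a<m. B' a c * cnj (x e a)))\<^sup>2) \<le> (\<Sum>a<m. (cmod (B' a c))\<^sup>2)" by simp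
  qed
  also have "\<dots> = (\<Sum>a<m. (\<Sum>c<n. (cmod (B a c))\<^sup>2) - (\<Sum>f\<in>F. (cmod (\<beta> a f))\<^sup>2))"
    by (subst sum.swap) (simp only: B')
  also have "\<dots> = (\<Sum>a<m. \<Sum>c<n. (cmod (B a c))\<^sup>2) - (\<Sum>f\<in>F. \<Sum>a<m. (cmod (\<beta> a f))\<^sup>2)"
    by (simp only: sum_subtractf sum.swap[of _ F])
  finally show ?thesis by (simp add: \<beta>_def)
qed

text \<open>Cauchy-Schwarz twice; the operator norm is at most the Hilbert-Schmidt norm.\<close>

lemma cmod_quad_form_le:
  "cmod (quad_form k D x) \<le> sqrt (\<Sum>a<k. \<Sum>b<k. (cmod (D a b))\<^sup>2) * (\<Sum>a<k. (cmod (x a))\<^sup>2)"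
proof -
  let ?D = "\<Sum>a<k. \<Sum>b<k. (cmod (D a b))\<^sup>2" and ?X = "\<Sum>a<k. (cmod (x a))\<^sup>2"
  have X: "0 \<le> ?X" by (intro sum_nonneg) auto
  have "quad_form k D x = (\<Sum>a<k. cnj (x a) * (\<Sum>b<k. D a b * x b))"
    by (simp add: quad_form_def sum_distrib_left mult.assoc)
  then have "(cmod (quad_form k D x))\<^sup>2 \<le> ?X * (\<Sum>a<k. (cmod (\<Sum>b<k. D a b * x b))\<^sup>2)"
    using cmod_sum_mult_le[of "\<lambda>a. cnj (x a)" "\<lambda>a. \<Sum>b<k. D a b * x b" k] by simp
  also have "\<dots> \<le> ?X * (\<Sum>a<k. (\<Sum>b<k. (cmod (D a b))\<^sup>2) * ?X)"
    using X by (intro mult_left_mono sum_mono cmod_sum_mult_le)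
  also have "\<dots> = ?X * (?D * ?X)" by (simp only: sum_distrib_right)
  also have "\<dots> = (sqrt ?D * ?X)\<^sup>2"
    by (simp add: power_mult_distrib sum_nonneg power2_eq_square[of ?X])
  finally show ?thesis
    using X by (intro power2_le_imp_le[of "cmod (quad_form k D x)"]) (auto simp: sum_nonneg)
qed

text \<open>A unit vector supported on the first e + 1 coordinates averages weights that are at
  least \<open>q (Suc e)\<close>, and replacing diag(q) by \<open>M\<close> costs at most the
  Hilbert-Schmidt distance.\<close>

lemma adapted_quad_form_ge:
  assumes w: "weights k q" and e: "e < k" and x: "\<And>j. e < j \<Longrightarrow> j < k \<Longrightarrow> x j = 0"
    and unit: "(\<Sum>j<k. cnj (x j) * x j) = 1"
    and le: "(\<Sum>a<k. \<Sum>b<k. (cmod (M a b - (if a = b then of_real (q (Suc a)) else 0)))\<^sup>2) \<le> \<epsilon>\<^sup>2" "0 \<le> \<epsilon>"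
  shows "q (Suc e) - \<epsilon> \<le> Re (quad_form k M x)"
proof -
  let ?Q = "\<lambda>a b. if a = b then complex_of_real (q (Suc a)) else 0"
  have "complex_of_real (\<Sum>j<k. (cmod (x j))\<^sup>2) = 1"
    using unit unfolding of_real_sum complex_norm_square by (simp add: mult.commute)
  then have u: "(\<Sum>j<k. (cmod (x j))\<^sup>2) = 1" by (simp only: of_real_eq_1_iff)
  have "quad_form k M x = quad_form k (\<lambda>a b. M a b - ?Q a b) x + quad_form k ?Q x"
    unfolding quad_form_def sum.distrib[symmetric] by (intro sum.cong refl) (simp add: algebra_simps)
  moreover have "quad_form k ?Q x = of_real (\<Sum>j<k. q (Suc j) * (cmod (x j))\<^sup>2)"
    unfolding quad_form_def of_real_sum of_real_mult complex_norm_square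
    by (intro sum.cong refl) (simp add: if_distrib if_distribR mult_ac cong: if_cong)
  moreover have "cmod (quad_form k (\<lambda>a b. M a b - ?Q a b) x) \<le> \<epsilon>"
    using cmod_quad_form_le[of k "\<lambda>a b. M a b - ?Q a b" x] real_le_lsqrt[OF le(2,1)] u by simp
  then have "- \<epsilon> \<le> Re (quad_form k (\<lambda>a b. M a b - ?Q a b) x)"
    using abs_Re_le_cmod[of "quad_form k (\<lambda>a b. M a b - ?Q a b) x"] by linarith
  moreover have "q (Suc e) \<le> (\<Sum>j<k. q (Suc j) * (cmod (x j))\<^sup>2)"
  proof -
    have "q (Suc e) = (\<Sum>j<k. q (Suc e) * (cmod (x j))\<^sup>2)"
      unfolding sum_distrib_left[symmetric] u by simp
    also have "\<dots> \<le> (\<Sum>j<k. q (Suc j) * (cmod (x j))\<^sup>2)"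
    proof (rule sum_mono)
      fix j assume "j \<in> {..<k}"
      then show "q (Suc e) * (cmod (x j))\<^sup>2 \<le> q (Suc j) * (cmod (x j))\<^sup>2"
        using x[of j] e weights_antimono[OF w, of "Suc j" "Suc e"]
        by (cases "e < j") (auto intro: mult_right_mono)
    qed
    finally show ?thesis .
  qed
  ultimately show ?thesis by simp
qed

section \<open>Triangular changes of coordinates preserve the flag\<close>

lemma upper_triangular_solve:
  fixes l :: "nat \<Rightarrow> complex"
  assumes g: "g \<in> GL_flag k" and "i \<le> k" "\<And>j. i \<le> j \<Longrightarrow> j < k \<Longrightarrow> l j = 0"
  shows "\<exists>x. (\<forall>j. i \<le> j \<longrightarrow> x j = 0) \<and> (\<forall>a<k. (\<Sum>j<k. g $$ (a, j) * x j) = l a)"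
  using assms(2,3)
proof (induction i arbitrary: l)
  case 0
  then show ?case by (intro exI[of _ "\<lambda>_. 0"]) auto
next
  case (Suc i)
  define c where "c = l i / g $$ (i, i)"
  have gi: "g $$ (i, i) \<noteq> 0" using g Suc.prems by (auto simp: GL_flag_iff)
  have "l j - c * g $$ (j, i) = 0" if "i \<le> j" "j < k" for j
    using that g gi Suc.prems by (cases "j = i") (auto simp: c_def GL_flag_iff)
  then obtain x where x: "\<And>j. i \<le> j \<Longrightarrow> x j = 0" "\<And>a. a < k \<Longrightarrow> (\<Sum>j<k. g $$ (a, j) * x j) = l a - c * g $$ (a, i)"
    using Suc.IH[of "\<lambda>j. l j - c * g $$ (j, i)"] Suc.prems by auto
  have "(\<Sum>j<k. g $$ (a, j) * (x j + (if j = i then c else 0))) = l a" if "a < k" for a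
  proof -
    have "(\<Sum>j<k. g $$ (a, j) * (x j + (if j = i then c else 0)))
        = (\<Sum>j<k. g $$ (a, j) * x j) + (\<Sum>j<k. if j = i then g $$ (a, j) * c else 0)"
      unfolding sum.distrib[symmetric] by (intro sum.cong) (auto simp: algebra_simps)
    then show ?thesis using x(2)[OF that] Suc.prems by simp
  qed
  then show ?case using x(1) by (intro exI[of _ "\<lambda>j. x j + (if j = i then c else 0)"]) auto
qed

text \<open>The inverse of \<open>g\<close> preserves the flag, so the preimage of \<open>L\<close>
  under \<open>g\<close> has the pivots of \<open>L\<close>. Back substitution supplies a preimage
  of each pivot vector, without naming the inverse matrix.\<close>

lemma pulled_back_orthonormal:
  assumes g: "g \<in> GL_flag k" and L: "csubspace k L"
  shows "\<exists>y. orthonormal k (pivots k L) y \<and> (\<forall>e\<in>pivots k L.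
    vec k (\<lambda>i. \<Sum>j<k. g $$ (i, j) * y e j) \<in> L \<and> (\<forall>j. e < j \<longrightarrow> j < k \<longrightarrow> y e j = 0))"
proof -
  let ?X = "{x. vec k (\<lambda>i. \<Sum>j<k. g $$ (i, j) * x j) \<in> L}"
  have "\<exists>y. orthonormal k (pivots k L) y \<and> (\<forall>e\<in>pivots k L. y e \<in> ?X \<and> (\<forall>j. e < j \<longrightarrow> j < k \<longrightarrow> y e j = 0))"
  proof (rule adapted_orthonormal)
    show "finite (pivots k L)" "pivots k L \<subseteq> {..<k}" by (auto simp: pivots_def)
    fix x y c assume "x \<in> ?X" "y \<in> ?X"
    then have "vec k (\<lambda>i. \<Sum>j<k. g $$ (i, j) * x j) + c \<cdot>\<^sub>v vec k (\<lambda>i. \<Sum>j<k. g $$ (i, j) * y j) \<in> L"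
      by (auto intro!: csubspaceD(3,4)[OF L])
    moreover have "vec k (\<lambda>i. \<Sum>j<k. g $$ (i, j) * x j) + c \<cdot>\<^sub>v vec k (\<lambda>i. \<Sum>j<k. g $$ (i, j) * y j)
        = vec k (\<lambda>i. \<Sum>j<k. g $$ (i, j) * (x j + c * y j))"
      by (rule eq_vecI) (auto simp: distrib_left sum.distrib sum_distrib_left mult_ac)
    ultimately show "(\<lambda>j. x j + c * y j) \<in> ?X" by simp
  next
    fix e assume "e \<in> pivots k L"
    then obtain l where l: "l \<in> L" "has_pivot k e l" and e: "e < k" by (auto simp: pivots_def)
    have "\<exists>x. (\<forall>j. Suc e \<le> j \<longrightarrow> x j = 0) \<and> (\<forall>a<k. (\<Sum>j<k. g $$ (a, j) * x j) = l $ a)"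
      by (rule upper_triangular_solve[OF g]) (use e l in \<open>auto simp: has_pivot_def\<close>)
    then obtain x where x: "\<And>j. Suc e \<le> j \<Longrightarrow> x j = 0" "\<And>a. a < k \<Longrightarrow> (\<Sum>j<k. g $$ (a, j) * x j) = l $ a"
      by blast
    have "vec k (\<lambda>i. \<Sum>j<k. g $$ (i, j) * x j) = l"
      using l csubspaceD(1)[OF L] x(2) by (intro eq_vecI) auto
    then have "x \<in> ?X" using l by simp
    moreover have "x e \<noteq> 0"
    proof
      assume "x e = 0"
      have "g $$ (e, j) * x j = 0" if "j < k" for j
        using that g e x(1)[of j] \<open>x e = 0\<close> by (cases j e rule: linorder_cases) (auto simp: GL_flag_iff)
      then have "(\<Sum>j<k. g $$ (e, j) * x j) = 0" by (intro sum.neutral) auto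
      then have "l $ e = 0" using x(2)[OF e] by simp
      then show False using l by (simp add: has_pivot_def)
    qed
    ultimately show "\<exists>x\<in>?X. x e \<noteq> 0 \<and> (\<forall>j. e < j \<longrightarrow> j < k \<longrightarrow> x j = 0)"
      using x(1) by (intro bexI[of _ x]) auto
  qed
  then show ?thesis by simp
qed

context scaling_problem
begin

text \<open>Moves the scalings from the Kraus operator to the vectors: \<open>x\<close> becomes
  \<open>g x\<close> and \<open>y\<close> becomes \<open>h y\<close>, which are the vectors known to
  lie in \<open>L\<close> and \<open>R\<close>.\<close>

lemma scaled_entry_bilinear:
  "(\<Sum>a<m. \<Sum>c<n. cnj (x a) * scaled_entry g h l a c * y c)
    = (\<Sum>j<n. (\<Sum>i<m. cnj (\<Sum>e<m. g i e * x e) * A l $$ (i, j)) * (\<Sum>e<n. h j e * y e))"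
proof -
  have "(\<Sum>a<m. \<Sum>c<n. cnj (x a) * scaled_entry g h l a c * y c)
      = (\<Sum>c<n. (\<Sum>a<m. cnj (x a) * scaled_entry g h l a c) * y c)"
    unfolding sum_distrib_right by (rule sum.swap)
  also have "\<dots> = scaled_entry (\<lambda>i a. \<Sum>e<m. g i e * x e) (\<lambda>j c. \<Sum>e<n. h j e * y e) l 0 0"
    unfolding scaled_entry_left[of g "\<lambda>e a. x e" h l 0, symmetric] scaled_entry_right[of _ h "\<lambda>e c. y e" l 0 0]
    by (simp add: scaled_entry_left)
  finally show ?thesis by (simp add: scaled_entry_def)
qed

lemma independent_bilinear_zero:
  assumes ind: "cp_independent m n r A L R" and l: "l \<in> {1..r}"
    and u: "vec m u \<in> L" and v: "vec n v \<in> R"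
  shows "(\<Sum>j<n. (\<Sum>i<m. cnj (u i) * A l $$ (i, j)) * v j) = 0"
proof -
  have "vec m u \<in> orth_compl m ((\<lambda>v. A l *\<^sub>v v) ` R)"
    using ind l u unfolding cp_independent_def by blast
  then have "vec m u \<bullet>c (A l *\<^sub>v vec n v) = 0" using v unfolding orth_compl_def by blast
  moreover have "vec m u \<bullet>c (A l *\<^sub>v vec n v) = (\<Sum>i<m. u i * cnj (\<Sum>j<n. A l $$ (i, j) * v j))"
    using kraus[OF l] by (simp add: scalar_prod_def mult_mat_vec_def lessThan_atLeast0)
  ultimately have "cnj (\<Sum>i<m. u i * cnj (\<Sum>j<n. A l $$ (i, j) * v j)) = 0" by simp
  then have "(\<Sum>i<m. \<Sum>j<n. cnj (u i) * A l $$ (i, j) * v j) = 0"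
    by (simp add: sum_distrib_left mult.assoc)
  then show ?thesis unfolding sum_distrib_right by (subst sum.swap)
qed

lemma scalable_imp_rank_nondecreasing:
  assumes sc: "approx_scalable m n r A (GL_flag m) (GL_flag n)
    (1\<^sub>m n) (seq_diag m q) (1\<^sub>m m) (seq_diag n p)"
  shows "rank_nondecreasing m n r A p q"
  unfolding rank_nondecreasing_def
proof (intro allI impI)
  fix L R assume ind: "cp_independent m n r A L R"
  then have L: "csubspace m L" and R: "csubspace n R" by (auto simp: cp_independent_def)
  let ?E = "pivots m L" and ?F = "pivots n R"
  have E: "?E \<subseteq> {..<m}" "finite ?E" and F: "?F \<subseteq> {..<n}" "finite ?F" by (auto simp: pivots_def)
  \<comment> \<open>Each pivot loses at most \<epsilon>, which accounts for m and one n; the other n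
    comes from bounding the trace of the dual at the identity entry by entry.\<close>
  have key: "(\<Sum>e\<in>?E. q (Suc e)) + (\<Sum>f\<in>?F. p (Suc f)) \<le> (\<Sum>i<n. p (Suc i)) + (m + n + n) * \<epsilon>"
    if \<epsilon>: "0 < \<epsilon>" for \<epsilon> :: real
  proof -
    obtain g h where g: "g \<in> GL_flag m" and h: "h \<in> GL_flag n"
      and l1: "hs_norm (scaled_map g h (cp_map m r A) (1\<^sub>m n) - seq_diag m q) \<le> \<epsilon>"
      and l2: "hs_norm (cp_dual n r (scaled_kraus g h A) (1\<^sub>m m) - seq_diag n p) \<le> \<epsilon>"
      using sc \<epsilon> unfolding approx_scalable_def by blast
    have gc: "g \<in> carrier_mat m m" and hc: "h \<in> carrier_mat n n" using g h by (auto simp: GL_flag_iff)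
    let ?M = "left_gram (entries g) (entries h)" and ?N = "right_gram (entries g) (entries h)"
    let ?B = "\<lambda>l a c. scaled_entry (entries g) (entries h) l a c"
    have M: "(\<Sum>a<m. \<Sum>b<m. (cmod (?M a b - (if a = b then of_real (q (Suc a)) else 0)))\<^sup>2) \<le> \<epsilon>\<^sup>2"
      using l1 \<epsilon> unfolding hs_norm_scaled_map[OF gc hc] by (simp add: sqrt_le_D)
    have N: "(\<Sum>a<n. \<Sum>b<n. (cmod (?N a b - (if a = b then of_real (p (Suc a)) else 0)))\<^sup>2) \<le> \<epsilon>\<^sup>2"
      using l2 \<epsilon> unfolding hs_norm_scaled_dual[OF gc hc] by (simp add: sqrt_le_D)
    obtain x where x: "orthonormal m ?E x"
      "\<And>e. e \<in> ?E \<Longrightarrow> vec m (\<lambda>i. \<Sum>j<m. g $$ (i, j) * x e j) \<in> L"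
      "\<And>e j. e \<in> ?E \<Longrightarrow> e < j \<Longrightarrow> j < m \<Longrightarrow> x e j = 0"
      using pulled_back_orthonormal[OF g L] by blast
    obtain y where y: "orthonormal n ?F y"
      "\<And>e. e \<in> ?F \<Longrightarrow> vec n (\<lambda>i. \<Sum>j<n. h $$ (i, j) * y e j) \<in> R"
      "\<And>e j. e \<in> ?F \<Longrightarrow> e < j \<Longrightarrow> j < n \<Longrightarrow> y e j = 0"
      using pulled_back_orthonormal[OF h R] by blast
    have bl: "(\<Sum>e\<in>?E. \<Sum>c<n. (cmod (\<Sum>a<m. cnj (x e a) * ?B l a c))\<^sup>2)
        + (\<Sum>f\<in>?F. \<Sum>a<m. (cmod (\<Sum>c<n. ?B l a c * y f c))\<^sup>2) \<le> (\<Sum>a<m. \<Sum>c<n. (cmod (?B l a c))\<^sup>2)"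
      if l: "l \<in> {1..r}" for l
    proof (rule orthogonal_blocks_le[OF F(2) y(1) E(2) x(1)])
      fix e f assume "e \<in> ?E" "f \<in> ?F"
      then show "(\<Sum>a<m. \<Sum>c<n. cnj (x e a) * ?B l a c * y f c) = 0"
        unfolding scaled_entry_bilinear by (intro independent_bilinear_zero[OF ind l] x(2) y(2))
    qed
    have Mx: "Re (quad_form m ?M (x e)) = (\<Sum>l = 1..r. \<Sum>c<n. (cmod (\<Sum>a<m. cnj (x e a) * ?B l a c))\<^sup>2)" for e
    proof -
      have "cmod (\<Sum>b<m. cnj (?B l b c) * x e b) = cmod (\<Sum>a<m. cnj (x e a) * ?B l a c)" for l c
      proof -
        have "(\<Sum>b<m. cnj (?B l b c) * x e b) = cnj (\<Sum>a<m. cnj (x e a) * ?B l a c)"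
          by (simp add: mult.commute)
        then show ?thesis by (simp only: complex_mod_cnj)
      qed
      then have "Re (quad_form m ?M (x e)) = (\<Sum>c<n. \<Sum>l = 1..r. (cmod (\<Sum>a<m. cnj (x e a) * ?B l a c))\<^sup>2)"
        unfolding left_gram_def quad_form_gram Re_complex_of_real
        by (simp add: sum.cartesian_product split_def)
      then show ?thesis by (simp only: sum.swap[of _ "{..<n}"])
    qed
    have Ny: "Re (quad_form n ?N (y f)) = (\<Sum>l = 1..r. \<Sum>a<m. (cmod (\<Sum>c<n. ?B l a c * y f c))\<^sup>2)" for f
    proof -
      have "Re (quad_form n ?N (y f)) = (\<Sum>a<m. \<Sum>l = 1..r. (cmod (\<Sum>c<n. ?B l a c * y f c))\<^sup>2)"
        unfolding right_gram_def quad_form_gram Re_complex_of_real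
        by (simp add: sum.cartesian_product split_def)
      then show ?thesis by (simp only: sum.swap[of _ "{..<m}"])
    qed
    have "(\<Sum>e\<in>?E. Re (quad_form m ?M (x e))) + (\<Sum>f\<in>?F. Re (quad_form n ?N (y f)))
      = (\<Sum>l = 1..r. (\<Sum>e\<in>?E. \<Sum>c<n. (cmod (\<Sum>a<m. cnj (x e a) * ?B l a c))\<^sup>2)
          + (\<Sum>f\<in>?F. \<Sum>a<m. (cmod (\<Sum>c<n. ?B l a c * y f c))\<^sup>2))"
      unfolding Mx Ny sum.distrib by (simp only: sum.swap[of _ "{1..r}"])
    also have "\<dots> \<le> energy (entries g) (entries h)"
      unfolding energy_def using bl by (intro sum_mono) auto
    also have "\<dots> = (\<Sum>c<n. Re (?N c c))" by (rule energy_trace(2)[symmetric])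
    also have "\<dots> \<le> (\<Sum>c<n. p (Suc c) + \<epsilon>)"
    proof (rule sum_mono)
      fix c assume c: "c \<in> {..<n}"
      let ?f = "\<lambda>a b. (cmod (?N a b - (if a = b then of_real (p (Suc a)) else 0)))\<^sup>2"
      have "(cmod (?N c c - of_real (p (Suc c))))\<^sup>2 = ?f c c" by simp
      also have "\<dots> \<le> (\<Sum>b<n. ?f c b)" using c by (intro member_le_sum[of c _ "?f c"]) auto
      also have "\<dots> \<le> (\<Sum>a<n. \<Sum>b<n. ?f a b)"
        using c by (intro member_le_sum[of c _ "\<lambda>a. \<Sum>b<n. ?f a b"]) (auto intro!: sum_nonneg)
      also have "\<dots> \<le> \<epsilon>\<^sup>2" by (rule N)
      finally have "cmod (?N c c - of_real (p (Suc c))) \<le> \<epsilon>" using \<epsilon> by (rule power2_le_imp_le[OF _ less_imp_le])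
      then show "Re (?N c c) \<le> p (Suc c) + \<epsilon>"
        using abs_Re_le_cmod[of "?N c c - of_real (p (Suc c))"] by simp
    qed
    finally have up: "(\<Sum>e\<in>?E. Re (quad_form m ?M (x e))) + (\<Sum>f\<in>?F. Re (quad_form n ?N (y f)))
      \<le> (\<Sum>c<n. p (Suc c)) + n * \<epsilon>" by (simp add: sum.distrib)
    have "(\<Sum>e\<in>?E. q (Suc e) - \<epsilon>) \<le> (\<Sum>e\<in>?E. Re (quad_form m ?M (x e)))"
    proof (rule sum_mono)
      fix e assume e: "e \<in> ?E"
      show "q (Suc e) - \<epsilon> \<le> Re (quad_form m ?M (x e))"
        using e E x(3)[OF e] orthonormalD[OF x(1) e e] \<epsilon> by (intro adapted_quad_form_ge[OF wq _ _ _ M]) auto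
    qed
    moreover have "(\<Sum>f\<in>?F. p (Suc f) - \<epsilon>) \<le> (\<Sum>f\<in>?F. Re (quad_form n ?N (y f)))"
    proof (rule sum_mono)
      fix e assume e: "e \<in> ?F"
      show "p (Suc e) - \<epsilon> \<le> Re (quad_form n ?N (y e))"
        using e F y(3)[OF e] orthonormalD[OF y(1) e e] \<epsilon> by (intro adapted_quad_form_ge[OF wp _ _ _ N]) auto
    qed
    moreover have "real (card ?E) * \<epsilon> \<le> real m * \<epsilon>" "real (card ?F) * \<epsilon> \<le> real n * \<epsilon>"
      using \<epsilon> card_mono[OF finite_lessThan E(1)] card_mono[OF finite_lessThan F(1)]
      by (auto intro!: mult_right_mono)
    ultimately show ?thesis using up by (simp add: sum_subtractf algebra_simps)
  qed
  have "(\<Sum>e\<in>?E. q (Suc e)) + (\<Sum>f\<in>?F. p (Suc f)) \<le> (\<Sum>i<n. p (Suc i))"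
  proof (rule field_le_epsilon)
    fix \<epsilon> :: real assume \<epsilon>: "0 < \<epsilon>"
    \<comment> \<open>The summand 1 makes the divisor positive even for m = n = 0.\<close>
    define K where "K = real (m + n + n) + 1"
    have K: "0 < K" by (simp add: K_def)
    have "real (m + n + n) * (\<epsilon> / K) \<le> K * (\<epsilon> / K)"
      using \<epsilon> K by (intro mult_right_mono) (auto simp: K_def)
    then have "real (m + n + n) * (\<epsilon> / K) \<le> \<epsilon>" using K by simp
    then show "(\<Sum>e\<in>?E. q (Suc e)) + (\<Sum>f\<in>?F. p (Suc f)) \<le> (\<Sum>i<n. p (Suc i)) + \<epsilon>"
      using key[of "\<epsilon> / K"] \<epsilon> K by simp
  qed
  moreover have "(\<Sum>i = 1..m. seq_diff m q i * real (subspace_dim m (flag_space m i \<inter> L))) = (\<Sum>e\<in>?E. q (Suc e))"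
    unfolding sum_seq_diff_card[OF E(1), symmetric] by (intro sum.cong refl) (simp add: dim_flag_space_Int[OF L])
  moreover have "(\<Sum>j = 1..n. seq_diff n p j * real (subspace_dim n (flag_space n j \<inter> R))) = (\<Sum>f\<in>?F. p (Suc f))"
    unfolding sum_seq_diff_card[OF F(1), symmetric] by (intro sum.cong refl) (simp add: dim_flag_space_Int[OF R])
  ultimately show "(\<Sum>i = 1..m. seq_diff m q i * real (subspace_dim m (flag_space m i \<inter> L)))
      + (\<Sum>j = 1..n. seq_diff n p j * real (subspace_dim n (flag_space n j \<inter> R))) \<le> Re (mat_trace (seq_diag n p))"
    by (simp add: mat_trace_seq_diag)
qed

end


section \<open>Greedy selection of rows\<close>

text \<open>The greedy basis: \<open>t\<close> is kept when its row, cut to \<open>j\<close>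
  coordinates, is not in the span of the rows of smaller rank \<rho>. This is expressed dually, by a
  test vector killed by the earlier rows but not by row \<open>t\<close>; the test vectors are used
  again for determinants.\<close>

definition row_pivots :: "nat \<Rightarrow> 'i set \<Rightarrow> ('i \<Rightarrow> nat) \<Rightarrow> ('i \<Rightarrow> nat \<Rightarrow> complex) \<Rightarrow> 'i set" where
  "row_pivots j I \<rho> w = {t \<in> I. \<exists>x. (\<forall>s\<in>I. \<rho> s < \<rho> t \<longrightarrow> (\<Sum>b<j. w s b * x b) = 0) \<and> (\<Sum>b<j. w t b * x b) \<noteq> 0}"

text \<open>The kept rows of rank below \<open>u\<close> already impose all equations of rank below
  \<open>u\<close>: a first violated row would, by definition, have been kept.\<close>

lemma row_pivots_annihilate:
  assumes x: "\<And>s. s \<in> row_pivots j I \<rho> w \<Longrightarrow> \<rho> s < u \<Longrightarrow> (\<Sum>b<j. w s b * x b) = 0"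
    and t: "t \<in> I" "\<rho> t < u"
  shows "(\<Sum>b<j. w t b * x b) = 0"
  using t
proof (induction "\<rho> t" arbitrary: t rule: less_induct)
  case less
  show ?case
  proof (rule ccontr)
    assume nz: "(\<Sum>b<j. w t b * x b) \<noteq> 0"
    have "(\<Sum>b<j. w s b * x b) = 0" if "s \<in> I" "\<rho> s < \<rho> t" for s
      using less.hyps[OF that(2,1)] that(2) less.prems(2) by simp
    then have "t \<in> row_pivots j I \<rho> w" using nz less.prems(1) unfolding row_pivots_def by blast
    then show False using x less.prems(2) nz by blast
  qed
qed

lemma increasing_enumeration:
  fixes \<rho> :: "'i \<Rightarrow> nat"
  assumes "finite K" "inj_on \<rho> K"
  obtains \<kappa> where "bij_betw \<kappa> {..<card K} K" "\<And>e f. e < f \<Longrightarrow> f < card K \<Longrightarrow> \<rho> (\<kappa> e) < \<rho> (\<kappa> f)"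
proof -
  define xs where "xs = sorted_list_of_set (\<rho> ` K)"
  have xs: "set xs = \<rho> ` K" "distinct xs" "sorted_wrt (<) xs"
    unfolding xs_def using assms(1) by auto
  have len: "length xs = card K"
    using distinct_card[OF xs(2)] xs(1) card_image[OF assms(2)] by simp
  let ?\<kappa> = "the_inv_into K \<rho> \<circ> (!) xs"
  have "bij_betw ((!) xs) {..<card K} (\<rho> ` K)"
    using xs len by (intro bij_betw_nth) auto
  moreover have "bij_betw (the_inv_into K \<rho>) (\<rho> ` K) K"
    by (intro bij_betw_the_inv_into) (simp add: bij_betw_def assms(2))
  ultimately have "bij_betw ?\<kappa> {..<card K} K" by (rule bij_betw_trans)
  moreover have "\<rho> (?\<kappa> e) < \<rho> (?\<kappa> f)" if "e < f" "f < card K" for e f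
  proof -
    have "\<rho> (?\<kappa> e) = xs ! e" if "e < card K" for e
    proof -
      have "xs ! e \<in> \<rho> ` K" using xs(1) that len nth_mem by metis
      then show ?thesis using assms(2) by (simp add: f_the_inv_into_f)
    qed
    then show ?thesis using that sorted_wrt_nth_less[OF xs(3), of e f] len by simp
  qed
  ultimately show thesis by (rule that)
qed

text \<open>Pairing the kept rows, in increasing rank, with their test vectors gives a lower
  triangular matrix with nonzero diagonal. It factors through \<open>j\<close> coordinates, which
  bounds the number of rows and, in the square case, makes the minor nonzero.\<close>

lemma row_pivots_basis:
  fixes j :: nat and \<rho> :: "'i \<Rightarrow> nat" and w :: "'i \<Rightarrow> nat \<Rightarrow> complex"
  assumes I: "finite I" and \<rho>: "inj_on \<rho> I"
  defines "K \<equiv> row_pivots j I \<rho> w"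
  shows "card K \<le> j" and "card K = j \<Longrightarrow> \<exists>\<kappa>. bij_betw \<kappa> {..<j} K \<and> fdet j (\<lambda>e. w (\<kappa> e)) \<noteq> 0"
proof -
  have KI: "K \<subseteq> I" by (auto simp: K_def row_pivots_def)
  have K: "finite K" "inj_on \<rho> K"
    using finite_subset[OF KI I] inj_on_subset[OF \<rho> KI] by auto
  define c where "c = card K"
  obtain \<kappa> where \<kappa>: "bij_betw \<kappa> {..<c} K" "\<And>e f. e < f \<Longrightarrow> f < c \<Longrightarrow> \<rho> (\<kappa> e) < \<rho> (\<kappa> f)"
    using increasing_enumeration[OF K] unfolding c_def by blast
  have "\<forall>e\<in>{..<c}. \<exists>x. (\<forall>s\<in>I. \<rho> s < \<rho> (\<kappa> e) \<longrightarrow> (\<Sum>b<j. w s b * x b) = 0) \<and> (\<Sum>b<j. w (\<kappa> e) b * x b) \<noteq> 0"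
    using bij_betwE[OF \<kappa>(1)] unfolding K_def row_pivots_def by blast
  from bchoice[OF this] obtain x where
    x: "\<And>e s. e < c \<Longrightarrow> s \<in> I \<Longrightarrow> \<rho> s < \<rho> (\<kappa> e) \<Longrightarrow> (\<Sum>b<j. w s b * x e b) = 0"
    "\<And>e. e < c \<Longrightarrow> (\<Sum>b<j. w (\<kappa> e) b * x e b) \<noteq> 0" by auto
  have "fdet c (\<lambda>e f. \<Sum>b<j. w (\<kappa> e) b * x f b) = (\<Prod>e<c. \<Sum>b<j. w (\<kappa> e) b * x e b)"
  proof (rule fdet_lower_triangular)
    fix e f assume ef: "e < f" "f < c"
    then have "\<kappa> e \<in> I" using bij_betwE[OF \<kappa>(1)] KI by auto
    then show "(\<Sum>b<j. w (\<kappa> e) b * x f b) = 0" using x(1)[OF ef(2)] \<kappa>(2)[OF ef] by blast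
  qed
  also have "\<dots> \<noteq> 0" using x(2) by simp
  finally have nz: "fdet c (\<lambda>e f. \<Sum>b<j. w (\<kappa> e) b * x f b) \<noteq> 0" .
  show "card K \<le> j"
  proof (rule ccontr)
    assume "\<not> card K \<le> j"
    then have jc: "j < c" by (simp add: c_def)
    \<comment> \<open>Padding with zero columns makes both factors square; column \<open>j\<close>
      of the first one vanishes.\<close>
    have "fdet c (\<lambda>e f. \<Sum>b<j. w (\<kappa> e) b * x f b)
        = fdet c (\<lambda>e f. \<Sum>b<c. (if b < j then w (\<kappa> e) b else 0) * x f b)"
    proof (rule fdet_cong)
      fix e f
      have "(\<Sum>b<c. (if b < j then w (\<kappa> e) b else 0) * x f b) = (\<Sum>b<j. (if b < j then w (\<kappa> e) b else 0) * x f b)"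
        using jc by (intro sum.mono_neutral_right) auto
      then show "(\<Sum>b<j. w (\<kappa> e) b * x f b) = (\<Sum>b<c. (if b < j then w (\<kappa> e) b else 0) * x f b)" by simp
    qed
    also have "\<dots> = fdet c (\<lambda>e b. if b < j then w (\<kappa> e) b else 0) * fdet c (\<lambda>b f. x f b)"
      by (rule fdet_mult)
    also have "fdet c (\<lambda>e b. if b < j then w (\<kappa> e) b else 0) = 0"
      using jc by (intro fdet_zero_column[of j]) auto
    finally show False using nz by simp
  qed
  assume "card K = j"
  then have "c = j" by (simp add: c_def)
  moreover have "fdet j (\<lambda>e f. \<Sum>b<j. w (\<kappa> e) b * x f b) = fdet j (\<lambda>e. w (\<kappa> e)) * fdet j (\<lambda>b f. x f b)"
    by (rule fdet_mult)
  ultimately show "\<exists>\<kappa>. bij_betw \<kappa> {..<j} K \<and> fdet j (\<lambda>e. w (\<kappa> e)) \<noteq> 0"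
    using nz \<kappa>(1) by auto
qed

section \<open>Pivoted Gram--Schmidt orthogonalisation\<close>

text \<open>
  The construction makes \<open>U\<close> a unit lower triangular matrix up to a permutation of its rows \<open>I\<close>, so that
  \<open>U\<close> and its inverse \<open>V\<close> stay in a compact set.  Row \<open>k\<close> of \<open>W\<close> has norm one or, if \<open>s k = 0\<close>, vanishes.
\<close>

definition pivoted_factorization ::
  "nat \<Rightarrow> nat set \<Rightarrow> nat \<Rightarrow> (nat \<Rightarrow> nat \<Rightarrow> complex) \<Rightarrow> real \<Rightarrow> (nat \<Rightarrow> nat \<Rightarrow> complex) \<Rightarrow>
    (nat \<Rightarrow> nat \<Rightarrow> complex) \<Rightarrow> (nat \<Rightarrow> real) \<Rightarrow> (nat \<Rightarrow> nat \<Rightarrow> complex) \<Rightarrow> bool" where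
  "pivoted_factorization N I n b C U V s W \<longleftrightarrow>
    (\<forall>i\<in>I. \<forall>c<N. b i c = (\<Sum>k<n. U i k * of_real (s k) * W k c)) \<and>
    (\<forall>k<n. 0 \<le> s k) \<and> (\<forall>k. Suc k < n \<longrightarrow> s (Suc k) \<le> s k) \<and>
    (\<forall>\<beta>\<ge>0. (\<forall>i\<in>I. (\<Sum>c<N. (cmod (b i c))\<^sup>2) \<le> \<beta>\<^sup>2) \<longrightarrow> (\<forall>k<n. s k \<le> \<beta>)) \<and>
    (\<forall>i\<in>I. \<forall>k<n. cmod (U i k) \<le> 1) \<and>
    (\<forall>k<n. (\<Sum>c<N. (cmod (W k c))\<^sup>2) \<le> 1 \<and> s k * (\<Sum>c<N. (cmod (W k c))\<^sup>2) = s k) \<and>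
    (\<forall>k<n. \<forall>l<n. k \<noteq> l \<longrightarrow> (\<Sum>c<N. W k c * cnj (W l c)) = 0) \<and>
    (\<forall>k<n. \<forall>l<n. (\<Sum>i\<in>I. V k i * U i l) = (if k = l then 1 else 0)) \<and>
    (\<forall>k<n. \<forall>i\<in>I. cmod (V k i) \<le> C) \<and>
    (\<forall>x. (\<forall>i\<in>I. (\<Sum>c<N. b i c * x c) = 0) \<longrightarrow> (\<forall>k<n. (\<Sum>c<N. W k c * x c) = 0))"

lemma pivoted_factorizationD:
  assumes "pivoted_factorization N I n b C U V s W"
  shows "i \<in> I \<Longrightarrow> c < N \<Longrightarrow> b i c = (\<Sum>k<n. U i k * of_real (s k) * W k c)"
    and "k < n \<Longrightarrow> 0 \<le> s k"
    and "Suc k < n \<Longrightarrow> s (Suc k) \<le> s k"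
    and "i \<in> I \<Longrightarrow> k < n \<Longrightarrow> cmod (U i k) \<le> 1"
    and "k < n \<Longrightarrow> (\<Sum>c<N. (cmod (W k c))\<^sup>2) \<le> 1 \<and> s k * (\<Sum>c<N. (cmod (W k c))\<^sup>2) = s k"
    and "k < n \<Longrightarrow> l < n \<Longrightarrow> k \<noteq> l \<Longrightarrow> (\<Sum>c<N. W k c * cnj (W l c)) = 0"
    and "k < n \<Longrightarrow> l < n \<Longrightarrow> (\<Sum>i\<in>I. V k i * U i l) = (if k = l then 1 else 0)"
    and "k < n \<Longrightarrow> i \<in> I \<Longrightarrow> cmod (V k i) \<le> C"
    and "0 \<le> \<beta> \<Longrightarrow> (\<And>i. i \<in> I \<Longrightarrow> (\<Sum>c<N. (cmod (b i c))\<^sup>2) \<le> \<beta>\<^sup>2) \<Longrightarrow> k < n \<Longrightarrow> s k \<le> \<beta>"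
    and "(\<And>i. i \<in> I \<Longrightarrow> (\<Sum>c<N. b i c * x c) = 0) \<Longrightarrow> k < n \<Longrightarrow> (\<Sum>c<N. W k c * x c) = 0"
proof -
  note F = assms[unfolded pivoted_factorization_def]
  show "i \<in> I \<Longrightarrow> c < N \<Longrightarrow> b i c = (\<Sum>k<n. U i k * of_real (s k) * W k c)"
    using F[THEN conjunct1] by blast
  show "k < n \<Longrightarrow> 0 \<le> s k"
    using F[THEN conjunct2, THEN conjunct1] by blast
  show "Suc k < n \<Longrightarrow> s (Suc k) \<le> s k"
    using F[THEN conjunct2, THEN conjunct2, THEN conjunct1] by blast
  show "i \<in> I \<Longrightarrow> k < n \<Longrightarrow> cmod (U i k) \<le> 1"
    using F[THEN conjunct2, THEN conjunct2, THEN conjunct2, THEN conjunct2, THEN conjunct1] by blast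
  show "k < n \<Longrightarrow> (\<Sum>c<N. (cmod (W k c))\<^sup>2) \<le> 1 \<and> s k * (\<Sum>c<N. (cmod (W k c))\<^sup>2) = s k"
    using F[THEN conjunct2, THEN conjunct2, THEN conjunct2, THEN conjunct2, THEN conjunct2, THEN conjunct1] by blast
  show "k < n \<Longrightarrow> l < n \<Longrightarrow> k \<noteq> l \<Longrightarrow> (\<Sum>c<N. W k c * cnj (W l c)) = 0"
    using F[THEN conjunct2, THEN conjunct2, THEN conjunct2, THEN conjunct2, THEN conjunct2, THEN conjunct2, THEN conjunct1] by blast
  show "k < n \<Longrightarrow> l < n \<Longrightarrow> (\<Sum>i\<in>I. V k i * U i l) = (if k = l then 1 else 0)"
    using F[THEN conjunct2, THEN conjunct2, THEN conjunct2, THEN conjunct2, THEN conjunct2, THEN conjunct2, THEN conjunct2, THEN conjunct1] by blast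
  show "k < n \<Longrightarrow> i \<in> I \<Longrightarrow> cmod (V k i) \<le> C"
    using F[THEN conjunct2, THEN conjunct2, THEN conjunct2, THEN conjunct2, THEN conjunct2, THEN conjunct2, THEN conjunct2, THEN conjunct2, THEN conjunct1] by blast
  show "0 \<le> \<beta> \<Longrightarrow> (\<And>i. i \<in> I \<Longrightarrow> (\<Sum>c<N. (cmod (b i c))\<^sup>2) \<le> \<beta>\<^sup>2) \<Longrightarrow> k < n \<Longrightarrow> s k \<le> \<beta>"
    using F[THEN conjunct2, THEN conjunct2, THEN conjunct2, THEN conjunct1] by blast
  show "(\<And>i. i \<in> I \<Longrightarrow> (\<Sum>c<N. b i c * x c) = 0) \<Longrightarrow> k < n \<Longrightarrow> (\<Sum>c<N. W k c * x c) = 0"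
    using F[THEN conjunct2, THEN conjunct2, THEN conjunct2, THEN conjunct2, THEN conjunct2, THEN conjunct2, THEN conjunct2, THEN conjunct2, THEN conjunct2] by blast
qed

text \<open>Every row is projected off the longest row \<open>b i0\<close>. Maximality and
  Cauchy-Schwarz give multipliers \<open>u i\<close> of modulus at most 1. The clause about \<beta>
  yields \<open>s k \<le> s0\<close>, and the clause about \<open>x\<close> says that each
  \<open>W k\<close> is a combination of the projected rows, hence orthogonal to \<open>w\<close>.
  The inverse acquires the sum of \<open>V k l * u l\<close>, with n terms of modulus at most
  \<open>C\<close>, which explains the new constant.\<close>

lemma pivoted_factorization_step:
  fixes N :: nat and i0 :: nat and b :: "nat \<Rightarrow> nat \<Rightarrow> complex"
  assumes I: "finite I" "i0 \<in> I"
    and max: "\<And>i. i \<in> I \<Longrightarrow> (\<Sum>c<N. (cmod (b i c))\<^sup>2) \<le> (\<Sum>c<N. (cmod (b i0 c))\<^sup>2)"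
    and C: "0 \<le> C" and n: "card (I - {i0}) = n"
  defines "s0 \<equiv> sqrt (\<Sum>c<N. (cmod (b i0 c))\<^sup>2)"
  defines "w \<equiv> \<lambda>c. b i0 c / of_real s0"
  defines "\<beta> \<equiv> \<lambda>i. \<Sum>c<N. b i c * cnj (w c)"
  defines "u \<equiv> \<lambda>i. \<beta> i / of_real s0"
  assumes IH: "pivoted_factorization N (I - {i0}) n (\<lambda>i c. b i c - u i * b i0 c) C U V s W"
  shows "pivoted_factorization N I (Suc n) b (1 + real (Suc n) * C)
    (\<lambda>i. case_nat (if i = i0 then 1 else u i) (\<lambda>k. if i = i0 then 0 else U i k))
    (\<lambda>k i. case k of 0 \<Rightarrow> if i = i0 then 1 else 0
       | Suc k \<Rightarrow> if i = i0 then - (\<Sum>l\<in>I - {i0}. V k l * u l) else V k i)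
    (case_nat s0 s) (case_nat w W)"
proof -
  define \<nu> where "\<nu> i = (\<Sum>c<N. (cmod (b i c))\<^sup>2)" for i
  have \<nu>0: "0 \<le> \<nu> i" for i unfolding \<nu>_def by (intro sum_nonneg) auto
  have s0: "0 \<le> s0" "s0\<^sup>2 = \<nu> i0" using \<nu>0[of i0] by (auto simp: s0_def \<nu>_def)
  \<comment> \<open>When the longest row is zero, division by zero sets \<open>w\<close> and
    \<open>u\<close> to 0 and the identities below remain valid.\<close>
  have s0_zero: "b i0 c = 0" if "s0 = 0" "c < N" for c
  proof -
    have "(\<Sum>c<N. (cmod (b i0 c))\<^sup>2) = 0" using that(1) s0 by (simp add: \<nu>_def)
    then show ?thesis using that(2) by (subst (asm) sum_nonneg_eq_0_iff) auto
  qed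
  have s0w: "of_real s0 * w c = b i0 c" if "c < N" for c
    using s0_zero[OF _ that] by (cases "s0 = 0") (auto simp: w_def)
  have ub: "u i * b i0 c = \<beta> i * w c" if "c < N" for i c
    unfolding s0w[OF that, symmetric] by (cases "s0 = 0") (auto simp: u_def w_def)
  have ww: "(\<Sum>c<N. (cmod (w c))\<^sup>2) = (if s0 = 0 then 0 else 1)"
  proof (cases "s0 = 0")
    case True then show ?thesis by (simp add: w_def)
  next
    case False
    have "(\<Sum>c<N. (cmod (w c))\<^sup>2) = \<nu> i0 / s0\<^sup>2"
      using s0(1) by (simp add: w_def \<nu>_def norm_divide power_divide sum_divide_distrib)
    then show ?thesis using False by (simp add: s0(2)[symmetric])
  qed
  have ww': "(\<Sum>c<N. w c * cnj (w c)) = (if s0 = 0 then 0 else 1)"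
  proof -
    have "(\<Sum>c<N. w c * cnj (w c)) = of_real (\<Sum>c<N. (cmod (w c))\<^sup>2)"
      unfolding of_real_sum complex_norm_square ..
    then show ?thesis unfolding ww by simp
  qed
  let ?b = "\<lambda>i c. b i c - u i * b i0 c"
  have defect: "(\<Sum>c<N. (cmod (?b i c))\<^sup>2) = \<nu> i - (cmod (\<beta> i))\<^sup>2" for i
  proof (cases "s0 = 0")
    case True
    then have "u i = 0" "\<beta> i = 0" by (auto simp: u_def \<beta>_def w_def)
    then show ?thesis by (simp add: \<nu>_def)
  next
    case False
    have "orthonormal N {0} (\<lambda>_ c. cnj (w c))"
      using ww' False by (simp add: orthonormal_def)
    then have "(\<Sum>c<N. (cmod (b i c - (\<Sum>f\<in>{0::nat}. \<beta> i * cnj (cnj (w c)))))\<^sup>2)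
        = (\<Sum>c<N. (cmod (b i c))\<^sup>2) - (\<Sum>f\<in>{0::nat}. (cmod (\<beta> i))\<^sup>2)"
      by (intro projection_defect) (auto simp: \<beta>_def)
    then show ?thesis by (simp add: ub \<nu>_def)
  qed
  have \<beta>s: "cmod (\<beta> i) \<le> s0" if "i \<in> I" for i
  proof -
    have "0 \<le> (\<Sum>c<N. (cmod (?b i c))\<^sup>2)" by (intro sum_nonneg) auto
    then have "(cmod (\<beta> i))\<^sup>2 \<le> s0\<^sup>2" using defect[of i] max[OF that] s0(2) by (simp add: \<nu>_def)
    then show ?thesis using s0(1) by (rule power2_le_imp_le)
  qed
  have u1: "cmod (u i) \<le> 1" if "i \<in> I" for i
    using \<beta>s[OF that] s0(1) by (cases "s0 = 0") (auto simp: u_def norm_divide divide_le_eq_1)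
  note f1 = pivoted_factorizationD(1)[OF IH] and f2 = pivoted_factorizationD(2)[OF IH]
    and f3 = pivoted_factorizationD(3)[OF IH] and f4 = pivoted_factorizationD(9)[OF IH]
    and f5 = pivoted_factorizationD(4)[OF IH] and f6 = pivoted_factorizationD(5)[OF IH]
    and f7 = pivoted_factorizationD(6)[OF IH] and f8 = pivoted_factorizationD(7)[OF IH]
    and f9 = pivoted_factorizationD(8)[OF IH] and f10 = pivoted_factorizationD(10)[OF IH]
  have ss0: "s k \<le> s0" if "k < n" for k
  proof (rule f4[OF s0(1) _ that])
    fix i assume "i \<in> I - {i0}"
    then have "\<nu> i \<le> \<nu> i0" using max[of i] by (simp add: \<nu>_def)
    then show "(\<Sum>c<N. (cmod (?b i c))\<^sup>2) \<le> s0\<^sup>2"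
      unfolding defect s0(2) using zero_le_power2[of "cmod (\<beta> i)"] by linarith
  qed
  have Ww: "(\<Sum>c<N. W k c * cnj (w c)) = 0" if "k < n" for k
  proof (rule f10[OF _ that])
    fix i
    have "(\<Sum>c<N. ?b i c * cnj (w c)) = (\<Sum>c<N. b i c * cnj (w c) - \<beta> i * (w c * cnj (w c)))"
      by (intro sum.cong refl) (simp only: ub lessThan_iff left_diff_distrib mult.assoc)
    also have "\<dots> = \<beta> i - \<beta> i * (\<Sum>c<N. w c * cnj (w c))"
      by (simp add: sum_subtractf sum_distrib_left \<beta>_def)
    also have "\<dots> = 0" unfolding ww' by (cases "s0 = 0") (auto simp: \<beta>_def w_def)
    finally show "(\<Sum>c<N. ?b i c * cnj (w c)) = 0" .
  qed
  have wW: "(\<Sum>c<N. w c * cnj (W k c)) = 0" if "k < n" for k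
  proof -
    have "(\<Sum>c<N. w c * cnj (W k c)) = cnj (\<Sum>c<N. W k c * cnj (w c))" by (simp add: mult.commute)
    then show ?thesis using Ww[OF that] by simp
  qed
  have all_Suc: "(\<forall>k<Suc n. P k) \<longleftrightarrow> P 0 \<and> (\<forall>k<n. P (Suc k))" for P
    by (auto simp: less_Suc_eq_0_disj)
  have split: "(\<Sum>i\<in>I. F i) = F i0 + (\<Sum>i\<in>I - {i0}. F i)" for F :: "nat \<Rightarrow> complex"
    by (rule sum.remove[OF I])
  have rest: "(\<Sum>i\<in>I - {i0}. (if i = i0 then a i else x i) * (if i = i0 then a' i else y i)) = (\<Sum>i\<in>I - {i0}. x i * y i)"
    for a a' x y :: "nat \<Rightarrow> complex" by (intro sum.cong) auto
  have K: "1 \<le> 1 + real (Suc n) * C" "C \<le> 1 + real (Suc n) * C" "real n * C \<le> 1 + real (Suc n) * C"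
    using C mult_nonneg_nonneg[of "real n" C] by (auto simp: algebra_simps)
  show ?thesis
    unfolding pivoted_factorization_def
  proof (intro conjI)
    show "\<forall>i\<in>I. \<forall>c<N. b i c = (\<Sum>k<Suc n. (case k of 0 \<Rightarrow> if i = i0 then 1 else u i | Suc k \<Rightarrow> if i = i0 then 0 else U i k)
        * of_real (case_nat s0 s k) * case_nat w W k c)"
    proof (intro ballI allI impI)
      fix i c assume i: "i \<in> I" and c: "c < N"
      show "b i c = (\<Sum>k<Suc n. (case k of 0 \<Rightarrow> if i = i0 then 1 else u i | Suc k \<Rightarrow> if i = i0 then 0 else U i k)
        * of_real (case_nat s0 s k) * case_nat w W k c)"
        unfolding sum.lessThan_Suc_shift
        using s0w[OF c] f1[OF _ c, of i] i by (cases "i = i0") (auto simp: mult.assoc algebra_simps)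
    qed
    show "\<forall>k<Suc n. 0 \<le> case_nat s0 s k" unfolding all_Suc using s0 f2 by auto
    show "\<forall>k. Suc k < Suc n \<longrightarrow> case_nat s0 s (Suc k) \<le> case_nat s0 s k"
      using ss0 f3 by (auto split: nat.split)
    show "\<forall>\<beta>\<ge>0. (\<forall>i\<in>I. (\<Sum>c<N. (cmod (b i c))\<^sup>2) \<le> \<beta>\<^sup>2) \<longrightarrow> (\<forall>k<Suc n. case_nat s0 s k \<le> \<beta>)"
    proof (intro allI impI)
      fix \<beta> :: real and k assume \<beta>: "0 \<le> \<beta>" "\<forall>i\<in>I. (\<Sum>c<N. (cmod (b i c))\<^sup>2) \<le> \<beta>\<^sup>2" and k: "k < Suc n"
      have "s0\<^sup>2 \<le> \<beta>\<^sup>2" using \<beta>(2) I(2) s0(2) by (simp add: \<nu>_def)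
      then have "s0 \<le> \<beta>" using \<beta>(1) by (rule power2_le_imp_le)
      then show "case_nat s0 s k \<le> \<beta>" using ss0 k by (auto split: nat.split intro: order_trans)
    qed
    show "\<forall>i\<in>I. \<forall>k<Suc n. cmod (case k of 0 \<Rightarrow> if i = i0 then 1 else u i | Suc k \<Rightarrow> if i = i0 then 0 else U i k) \<le> 1"
      unfolding all_Suc using u1 f5 by auto
    show "\<forall>k<Suc n. (\<Sum>c<N. (cmod (case_nat w W k c))\<^sup>2) \<le> 1
      \<and> case_nat s0 s k * (\<Sum>c<N. (cmod (case_nat w W k c))\<^sup>2) = case_nat s0 s k"
      unfolding all_Suc using f6 ww by auto
    show "\<forall>k<Suc n. \<forall>l<Suc n. k \<noteq> l \<longrightarrow> (\<Sum>c<N. case_nat w W k c * cnj (case_nat w W l c)) = 0"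
      unfolding all_Suc using f7 Ww wW by auto
    show "\<forall>k<Suc n. \<forall>l<Suc n. (\<Sum>i\<in>I. (case k of 0 \<Rightarrow> if i = i0 then 1 else 0
       | Suc k \<Rightarrow> if i = i0 then - (\<Sum>l\<in>I - {i0}. V k l * u l) else V k i) *
         (case l of 0 \<Rightarrow> if i = i0 then 1 else u i | Suc k \<Rightarrow> if i = i0 then 0 else U i k)) = (if k = l then 1 else 0)"
      unfolding all_Suc split using f8 by (auto simp: rest)
    show "\<forall>k<Suc n. \<forall>i\<in>I. cmod (case k of 0 \<Rightarrow> if i = i0 then 1 else 0
       | Suc k \<Rightarrow> if i = i0 then - (\<Sum>l\<in>I - {i0}. V k l * u l) else V k i) \<le> 1 + real (Suc n) * C"
      unfolding all_Suc
    proof (intro conjI allI impI ballI)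
      fix i
      show "cmod (case 0 of 0 \<Rightarrow> if i = i0 then 1 else 0
         | Suc k \<Rightarrow> if i = i0 then - (\<Sum>l\<in>I - {i0}. V k l * u l) else V k i) \<le> 1 + real (Suc n) * C"
        using K(1) by simp
    next
      fix k i assume k: "k < n" and i: "i \<in> I"
      have "cmod (\<Sum>l\<in>I - {i0}. V k l * u l) \<le> (\<Sum>l\<in>I - {i0}. C * 1)"
      proof (rule sum_norm_le)
        fix l assume "l \<in> I - {i0}"
        then show "cmod (V k l * u l) \<le> C * 1"
          unfolding norm_mult using f9[OF k, of l] u1[of l] C by (intro mult_mono) auto
      qed
      also have "\<dots> = real n * C" using n by simp
      finally have "cmod (\<Sum>l\<in>I - {i0}. V k l * u l) \<le> 1 + real (Suc n) * C"
        using K(3) by (rule order_trans)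
      moreover have "cmod (V k i) \<le> 1 + real (Suc n) * C" if "i \<noteq> i0"
        using f9[OF k, of i] i that K(2) by simp
      ultimately show "cmod (case Suc k of 0 \<Rightarrow> if i = i0 then 1 else 0
         | Suc k \<Rightarrow> if i = i0 then - (\<Sum>l\<in>I - {i0}. V k l * u l) else V k i) \<le> 1 + real (Suc n) * C"
        by (cases "i = i0") (simp_all only: nat.case if_True if_False norm_minus_cancel simp_thms)
    qed
    show "\<forall>x. (\<forall>i\<in>I. (\<Sum>c<N. b i c * x c) = 0) \<longrightarrow> (\<forall>k<Suc n. (\<Sum>c<N. case_nat w W k c * x c) = 0)"
      unfolding all_Suc
    proof (intro allI impI conjI)
      fix x assume x: "\<forall>i\<in>I. (\<Sum>c<N. b i c * x c) = 0"
      have "(\<Sum>c<N. w c * x c) = (\<Sum>c<N. b i0 c * x c) / of_real s0"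
        by (simp add: w_def sum_divide_distrib)
      then show "(\<Sum>c<N. case_nat w W 0 c * x c) = 0" using x I(2) by simp
      fix k assume k: "k < n"
      have "(\<Sum>c<N. W k c * x c) = 0"
      proof (rule f10[OF _ k])
        fix i assume "i \<in> I - {i0}"
        moreover have "(\<Sum>c<N. ?b i c * x c) = (\<Sum>c<N. b i c * x c) - u i * (\<Sum>c<N. b i0 c * x c)"
          by (simp add: left_diff_distrib sum_subtractf sum_distrib_left mult.assoc)
        ultimately show "(\<Sum>c<N. ?b i c * x c) = 0" using x I(2) by simp
      qed
      then show "(\<Sum>c<N. case_nat w W (Suc k) c * x c) = 0" by simp
    qed
  qed
qed

text \<open>The order of quantifiers is essential: \<open>C\<close> depends on \<open>n\<close>
  alone, so one compact set contains the bases for all matrices.\<close>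

lemma pivoted_factorization_exists:
  "\<exists>C\<ge>0. \<forall>N I b. finite I \<and> card I = n \<longrightarrow> (\<exists>U V s W. pivoted_factorization N I n b C U V s W)"
proof (induction n)
  case 0
  show ?case by (intro exI[of _ 0]) (auto simp: pivoted_factorization_def)
next
  case (Suc n)
  obtain C where IH: "0 \<le> C \<and> (\<forall>N I b. finite I \<and> card I = n \<longrightarrow> (\<exists>U V s W. pivoted_factorization N I n b C U V s W))"
    using Suc.IH by (rule exE)
  have C: "0 \<le> C" using IH by (rule conjunct1)
  have fact: "\<exists>U V s W. pivoted_factorization N I n b C U V s W" if "finite I" "card I = n" for N I b
    by (rule IH[THEN conjunct2, THEN spec, THEN spec, THEN spec, THEN mp, OF conjI[OF that]])
  have "\<exists>U V s W. pivoted_factorization N I (Suc n) b (1 + real (Suc n) * C) U V s W"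
    if I: "finite I" "card I = Suc n" for N I b
  proof -
    let ?\<nu> = "\<lambda>i. \<Sum>c<N. (cmod (b i c))\<^sup>2"
    have ne: "I \<noteq> {}" using I by auto
    have "Max (?\<nu> ` I) \<in> ?\<nu> ` I" using I(1) ne by (intro Max_in) auto
    then obtain i0 where i0: "i0 \<in> I" "?\<nu> i0 = Max (?\<nu> ` I)" by auto
    have max: "?\<nu> i \<le> ?\<nu> i0" if "i \<in> I" for i
      unfolding i0(2) using I(1) that by (intro Max_ge) auto
    have n: "card (I - {i0}) = n" using I i0(1) by simp
    let ?b = "\<lambda>i c. b i c - (\<Sum>c<N. b i c * cnj (b i0 c / of_real (sqrt (?\<nu> i0)))) / of_real (sqrt (?\<nu> i0)) * b i0 c"
    have "\<exists>U V s W. pivoted_factorization N (I - {i0}) n ?b C U V s W"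
      by (rule fact[OF finite_Diff[OF I(1)] n])
    then obtain U V s W where "pivoted_factorization N (I - {i0}) n ?b C U V s W"
      by (elim exE) (rule that)
    from pivoted_factorization_step[OF I(1) i0(1) max C n this] show ?thesis by (intro exI)
  qed
  then show ?case using C by (intro exI[of _ "1 + real (Suc n) * C"]) auto
qed

lemma bounded_family_convergent_subsequence:
  fixes f :: "nat \<Rightarrow> 'j \<Rightarrow> complex"
  assumes "finite J" "\<And>N j. j \<in> J \<Longrightarrow> cmod (f N j) \<le> C"
  shows "\<exists>\<sigma> L. strict_mono (\<sigma> :: nat \<Rightarrow> nat) \<and> (\<forall>j\<in>J. (\<lambda>N. f (\<sigma> N) j) \<longlonglongrightarrow> L j)"
  using assms
proof (induction J)
  case empty
  show ?case by (intro exI[of _ id]) (auto simp: strict_mono_def)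
next
  case (insert j J)
  then have "\<exists>\<sigma> L. strict_mono (\<sigma> :: nat \<Rightarrow> nat) \<and> (\<forall>j\<in>J. (\<lambda>N. f (\<sigma> N) j) \<longlonglongrightarrow> L j)" by simp
  then obtain \<sigma> L where \<sigma>: "strict_mono \<sigma>" "\<And>i. i \<in> J \<Longrightarrow> (\<lambda>N. f (\<sigma> N) i) \<longlonglongrightarrow> L i" by blast
  have "bounded (range (\<lambda>N. f (\<sigma> N) j))"
    using insert.prems by (auto simp: bounded_iff)
  then obtain l \<tau> where \<tau>: "strict_mono \<tau>" "((\<lambda>N. f (\<sigma> N) j) \<circ> \<tau>) \<longlonglongrightarrow> l"
    using bounded_imp_convergent_subsequence by blast
  have "(\<lambda>N. f ((\<sigma> \<circ> \<tau>) N) i) \<longlonglongrightarrow> (L(j := l)) i" if "i \<in> insert j J" for i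
  proof (cases "i = j")
    case True
    then show ?thesis using \<tau>(2) by (simp add: o_def)
  next
    case False
    then have "(\<lambda>N. f (\<sigma> N) i) \<longlonglongrightarrow> L i" using \<sigma>(2) that by auto
    from LIMSEQ_subseq_LIMSEQ[OF this \<tau>(1)] show ?thesis using False by (simp add: o_def)
  qed
  then show ?case using strict_mono_o[OF \<sigma>(1) \<tau>(1)] by blast
qed


section \<open>Rank non-decrease implies positive capacity\<close>

text \<open>Abel summation for the exponents, written multiplicatively so that \<open>d k = 0\<close> is allowed.\<close>

lemma prod_pw_abel:
  assumes "\<And>k. k < n \<Longrightarrow> 0 \<le> d k" "\<And>k. Suc k < n \<Longrightarrow> d (Suc k) \<le> d k"
    and "\<And>k. k < n \<Longrightarrow> 0 \<le> \<alpha> k" "\<And>k. k < n \<Longrightarrow> 0 \<le> \<beta> k"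
    and "\<And>t. t \<le> n \<Longrightarrow> (\<Sum>k<t. \<beta> k) \<le> (\<Sum>k<t. \<alpha> k)"
  shows "(\<Prod>k<n. pw (d k) (\<beta> k)) * pw (d (n - 1)) ((\<Sum>k<n. \<alpha> k) - (\<Sum>k<n. \<beta> k)) \<le> (\<Prod>k<n. pw (d k) (\<alpha> k))"
  using assms
proof (induction n)
  case (Suc n)
  define e where "e = (\<Sum>k<n. \<alpha> k) - (\<Sum>k<n. \<beta> k)"
  have e0: "0 \<le> e" using Suc.prems(5)[of n] by (simp add: e_def)
  have e1: "0 \<le> e + \<alpha> n - \<beta> n" using Suc.prems(5)[of "Suc n"] by (simp add: e_def)
  have IH: "(\<Prod>k<n. pw (d k) (\<beta> k)) * pw (d (n - 1)) e \<le> (\<Prod>k<n. pw (d k) (\<alpha> k))"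
    unfolding e_def using Suc.prems by (intro Suc.IH) auto
  have "pw (d n) e \<le> pw (d (n - 1)) e"
  \<comment> \<open>For n = 0 the truncated \<open>n - 1\<close> is again 0 and both sides
    coincide.\<close>
  proof (cases n)
    case 0
    then show ?thesis by simp
  next
    case (Suc k)
    then show ?thesis using e0 Suc.prems(1)[of n] Suc.prems(2)[of k] by (intro pw_mono) auto
  qed
  then have "(\<Prod>k<n. pw (d k) (\<beta> k)) * pw (d n) e \<le> (\<Prod>k<n. pw (d k) (\<beta> k)) * pw (d (n - 1)) e"
    by (intro mult_left_mono prod_nonneg) auto
  then have "(\<Prod>k<n. pw (d k) (\<beta> k)) * pw (d n) e \<le> (\<Prod>k<n. pw (d k) (\<alpha> k))"
    using IH by (rule order_trans)
  then have "(\<Prod>k<n. pw (d k) (\<beta> k)) * pw (d n) e * pw (d n) (\<alpha> n) \<le> (\<Prod>k<n. pw (d k) (\<alpha> k)) * pw (d n) (\<alpha> n)"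
    by (intro mult_right_mono) auto
  moreover have "pw (d n) e * pw (d n) (\<alpha> n) = pw (d n) (\<beta> n) * pw (d n) (e + \<alpha> n - \<beta> n)"
    using pw_add[OF e0 Suc.prems(3)[of n], of "d n"] pw_add[OF Suc.prems(4)[of n] e1, of "d n"] by simp
  moreover have "(\<Sum>k<Suc n. \<alpha> k) - (\<Sum>k<Suc n. \<beta> k) = e + \<alpha> n - \<beta> n" by (simp add: e_def)
  ultimately show ?case by (simp only: prod.lessThan_Suc mult.assoc diff_Suc_1)
qed simp

section \<open>Flag products as monomials in the scales\<close>

lemma pw_prod_fibres:
  fixes f :: "'a \<Rightarrow> nat"
  assumes S: "finite S" "f ` S \<subseteq> {..<n}" and a: "0 \<le> a" and d: "\<And>k. k < n \<Longrightarrow> 0 \<le> d k"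
  shows "pw (\<Prod>t\<in>S. d (f t)) a = (\<Prod>k<n. pw (d k) (a * real (card {t \<in> S. f t = k})))"
proof -
  have "pw (\<Prod>t\<in>S. d (f t)) a = (\<Prod>t\<in>S. pw (d (f t)) a)"
    using S(2) d by (intro pw_prod) auto
  also have "\<dots> = (\<Prod>k<n. \<Prod>t\<in>{t \<in> S. f t = k}. pw (d (f t)) a)"
    by (rule prod.group[OF S(1) finite_lessThan S(2), symmetric])
  also have "\<dots> = (\<Prod>k<n. pw (d k) (a * real (card {t \<in> S. f t = k})))"
  proof (intro prod.cong refl)
    fix k
    have "(\<Prod>t\<in>{t \<in> S. f t = k}. pw (d (f t)) a) = (\<Prod>t\<in>{t \<in> S. f t = k}. pw (d k) a)"
      by (intro prod.cong) auto
    also have "\<dots> = pw (d k) (\<Sum>t\<in>{t \<in> S. f t = k}. a)" using a by (intro pw_sum[symmetric])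
    finally show "(\<Prod>t\<in>{t \<in> S. f t = k}. pw (d (f t)) a) = pw (d k) (a * real (card {t \<in> S. f t = k}))"
      by (simp add: mult.commute)
  qed
  finally show ?thesis .
qed

text \<open>Collects equal factors: the exponent of \<open>d l\<close> is the weighted number of
  selected rows that belong to scale \<open>l\<close>. Its partial sums over \<open>l\<close> are
  the quantities compared by the rank condition.\<close>

lemma flag_prod_fibres:
  fixes f :: "'a \<Rightarrow> nat"
  assumes w: "weights k a" and d: "\<And>l. l < n \<Longrightarrow> 0 \<le> d l"
    and S: "\<And>i. finite (S i)" "\<And>i. f ` S i \<subseteq> {..<n}"
  shows "flag_prod k a (\<lambda>i. \<Prod>t\<in>S i. d (f t))
    = (\<Prod>l<n. pw (d l) (\<Sum>i = 1..k. seq_diff k a i * real (card {t \<in> S i. f t = l})))"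
proof -
  have "flag_prod k a (\<lambda>i. \<Prod>t\<in>S i. d (f t))
      = (\<Prod>i = 1..k. \<Prod>l<n. pw (d l) (seq_diff k a i * real (card {t \<in> S i. f t = l})))"
    unfolding flag_prod_def using S d seq_diff_nonneg[OF w] by (intro prod.cong pw_prod_fibres) auto
  also have "\<dots> = (\<Prod>l<n. \<Prod>i = 1..k. pw (d l) (seq_diff k a i * real (card {t \<in> S i. f t = l})))"
    by (rule prod.swap)
  also have "\<dots> = (\<Prod>l<n. pw (d l) (\<Sum>i = 1..k. seq_diff k a i * real (card {t \<in> S i. f t = l})))"
    using seq_diff_nonneg[OF w] by (intro prod.cong refl pw_sum[symmetric]) auto
  finally show ?thesis .
qed

lemma sum_card_fibres:
  fixes f :: "'a \<Rightarrow> nat"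
  assumes "finite S"
  shows "(\<Sum>k<t. real (card {x \<in> S. f x = k})) = real (card {x \<in> S. f x < t})"
proof (induction t)
  case (Suc t)
  have "{x \<in> S. f x < Suc t} = {x \<in> S. f x < t} \<union> {x \<in> S. f x = t}" by auto
  moreover have "card ({x \<in> S. f x < t} \<union> {x \<in> S. f x = t}) = card {x \<in> S. f x < t} + card {x \<in> S. f x = t}"
    using assms by (intro card_Un_disjoint) auto
  ultimately show ?case using Suc.IH by simp
qed simp

lemma sum_seq_diff_fibres:
  fixes f :: "'a \<Rightarrow> nat"
  assumes "\<And>i. finite (S i)"
  shows "(\<Sum>l<t. \<Sum>i = 1..k. seq_diff k a i * real (card {x \<in> S i. f x = l}))
    = (\<Sum>i = 1..k. seq_diff k a i * real (card {x \<in> S i. f x < t}))"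
proof -
  have "(\<Sum>l<t. \<Sum>i = 1..k. seq_diff k a i * real (card {x \<in> S i. f x = l}))
      = (\<Sum>i = 1..k. \<Sum>l<t. seq_diff k a i * real (card {x \<in> S i. f x = l}))"
    by (rule sum.swap)
  then show ?thesis unfolding sum_distrib_left[symmetric] sum_card_fibres[OF assms] .
qed

text \<open>The rows of \<open>W\<close> are orthogonal and of norm one except where the scale
  vanishes; the clause \<open>s k * norm = s k\<close> treats both cases together.\<close>

lemma pivoted_factorization_gram:
  assumes F: "pivoted_factorization N I n b C U V s W" and ij: "i \<in> I" "j \<in> I"
  shows "(\<Sum>c<N. b i c * cnj (b j c)) = (\<Sum>k<n. of_real ((s k)\<^sup>2) * U i k * cnj (U j k))"
proof -
  note b = pivoted_factorizationD(1)[OF F] and W = pivoted_factorizationD(6)[OF F]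
  have WW: "of_real (s k) * (\<Sum>c<N. W k c * cnj (W k c)) = of_real (s k)" if "k < n" for k
  proof -
    have "(\<Sum>c<N. W k c * cnj (W k c)) = of_real (\<Sum>c<N. (cmod (W k c))\<^sup>2)"
      unfolding of_real_sum complex_norm_square ..
    moreover have "s k * (\<Sum>c<N. (cmod (W k c))\<^sup>2) = s k"
      using pivoted_factorizationD(5)[OF F that] by simp
    ultimately show ?thesis by (simp only: of_real_mult[symmetric])
  qed
  have "(\<Sum>c<N. b i c * cnj (b j c))
      = (\<Sum>c<N. \<Sum>k<n. \<Sum>l<n. U i k * of_real (s k) * cnj (U j l) * of_real (s l) * (W k c * cnj (W l c)))"
    by (intro sum.cong refl) (simp add: b ij sum_product mult_ac)
  also have "\<dots> = (\<Sum>k<n. \<Sum>c<N. \<Sum>l<n. U i k * of_real (s k) * cnj (U j l) * of_real (s l) * (W k c * cnj (W l c)))"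
    by (rule sum.swap)
  also have "\<dots> = (\<Sum>k<n. \<Sum>l<n. \<Sum>c<N. U i k * of_real (s k) * cnj (U j l) * of_real (s l) * (W k c * cnj (W l c)))"
    by (intro sum.cong[OF refl] sum.swap)
  also have "\<dots> = (\<Sum>k<n. \<Sum>l<n. if l = k then of_real ((s k)\<^sup>2) * U i k * cnj (U j k) else 0)"
  proof (intro sum.cong refl)
    fix k l assume kl: "k \<in> {..<n}" "l \<in> {..<n}"
    show "(\<Sum>c<N. U i k * of_real (s k) * cnj (U j l) * of_real (s l) * (W k c * cnj (W l c)))
        = (if l = k then of_real ((s k)\<^sup>2) * U i k * cnj (U j k) else 0)"
    proof (cases "l = k")
      case True
      have "(\<Sum>c<N. U i k * of_real (s k) * cnj (U j k) * of_real (s k) * (W k c * cnj (W k c)))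
          = U i k * of_real (s k) * cnj (U j k) * (of_real (s k) * (\<Sum>c<N. W k c * cnj (W k c)))"
        by (simp add: sum_distrib_left mult.assoc)
      also have "of_real (s k) * (\<Sum>c<N. W k c * cnj (W k c)) = of_real (s k)"
        using kl by (intro WW) simp
      finally show ?thesis using True by (simp add: power2_eq_square mult_ac)
    next
      case False
      then show ?thesis using W kl by (simp add: sum_distrib_left[symmetric])
    qed
  qed
  also have "\<dots> = (\<Sum>k<n. of_real ((s k)\<^sup>2) * U i k * cnj (U j k))"
    by (intro sum.cong refl) simp
  finally show ?thesis .
qed

text \<open>From V b = diag(s) W: a minor of \<open>V\<close> in the rows \<kappa> times the leading
  minor of \<open>b\<close> equals the product of the scales times a minor of \<open>W\<close>,
  whose entries have modulus at most 1. The factorial comes from the Leibniz expansion of the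
  latter.\<close>

lemma pivoted_factorization_minor:
  assumes F: "pivoted_factorization n {..<n} n b C U V s W" and b0: "\<And>i c. c < i \<Longrightarrow> i < n \<Longrightarrow> b i c = 0"
    and j: "j \<le> n" and \<kappa>: "\<And>e. e < j \<Longrightarrow> \<kappa> e < n"
  shows "(cmod (fdet j (\<lambda>e. V (\<kappa> e))))\<^sup>2 * (\<Prod>c<j. (cmod (b c c))\<^sup>2) \<le> (\<Prod>e<j. (s (\<kappa> e))\<^sup>2) * (fact j)\<^sup>2"
proof -
  have b: "b i c = (\<Sum>k<n. U i k * of_real (s k) * W k c)" if "i < n" "c < n" for i c
    using pivoted_factorizationD(1)[OF F] that by simp
  note VU = pivoted_factorizationD(7)[OF F] and s = pivoted_factorizationD(2)[OF F]
  have W1: "cmod (W k c) \<le> 1" if "k < n" "c < n" for k c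
  proof -
    have "(cmod (W k c))\<^sup>2 \<le> (\<Sum>c<n. (cmod (W k c))\<^sup>2)" using that by (intro member_le_sum) auto
    also have "\<dots> \<le> 1" using pivoted_factorizationD(5)[OF F that(1)] by simp
    finally show ?thesis by (simp add: power_le_one_iff)
  qed
  have "(\<Sum>i<j. V (\<kappa> e) i * b i c) = of_real (s (\<kappa> e)) * W (\<kappa> e) c" if "e < j" "c < j" for e c
  proof -
    \<comment> \<open>The first \<open>j\<close> columns of \<open>b\<close> vanish from row
      \<open>j\<close> on, so cutting \<open>V\<close> to its first \<open>j\<close> columns loses
      nothing.\<close>
    have "(\<Sum>i<j. V (\<kappa> e) i * b i c) = (\<Sum>i<n. V (\<kappa> e) i * b i c)"
      using that j b0 by (intro sum.mono_neutral_left) auto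
    also have "\<dots> = (\<Sum>i<n. \<Sum>k<n. V (\<kappa> e) i * U i k * (of_real (s k) * W k c))"
      using that j by (intro sum.cong refl) (simp add: b sum_distrib_left mult.assoc)
    also have "\<dots> = (\<Sum>k<n. (\<Sum>i<n. V (\<kappa> e) i * U i k) * (of_real (s k) * W k c))"
      unfolding sum_distrib_right by (rule sum.swap)
    also have "\<dots> = (\<Sum>k<n. if k = \<kappa> e then of_real (s k) * W k c else 0)"
      using VU \<kappa>[OF that(1)] by (intro sum.cong refl) auto
    also have "\<dots> = of_real (s (\<kappa> e)) * W (\<kappa> e) c" using \<kappa>[OF that(1)] by simp
    finally show ?thesis .
  qed
  then have "fdet j (\<lambda>e c. \<Sum>i<j. V (\<kappa> e) i * b i c) = fdet j (\<lambda>e c. of_real (s (\<kappa> e)) * W (\<kappa> e) c)"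
    by (intro fdet_cong)
  also have "\<dots> = of_real (\<Prod>e<j. s (\<kappa> e)) * fdet j (\<lambda>e. W (\<kappa> e))"
    by (simp add: fdet_scale_rows)
  also have "fdet j (\<lambda>e c. \<Sum>i<j. V (\<kappa> e) i * b i c) = fdet j (\<lambda>e. V (\<kappa> e)) * fdet j b"
    by (rule fdet_mult)
  also have "fdet j b = (\<Prod>c<j. b c c)"
    using b0 j by (intro fdet_upper_triangular) auto
  finally have eq: "fdet j (\<lambda>e. V (\<kappa> e)) * (\<Prod>c<j. b c c) = of_real (\<Prod>e<j. s (\<kappa> e)) * fdet j (\<lambda>e. W (\<kappa> e))" .
  have s0: "0 \<le> (\<Prod>e<j. s (\<kappa> e))" using s \<kappa> by (intro prod_nonneg) auto
  have "cmod (fdet j (\<lambda>e. V (\<kappa> e))) * (\<Prod>c<j. cmod (b c c)) = cmod (fdet j (\<lambda>e. V (\<kappa> e)) * (\<Prod>c<j. b c c))"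
    by (simp only: norm_mult prod_norm)
  also have "\<dots> = (\<Prod>e<j. s (\<kappa> e)) * cmod (fdet j (\<lambda>e. W (\<kappa> e)))"
    unfolding eq norm_mult norm_of_real using s0 by simp
  also have "\<dots> \<le> (\<Prod>e<j. s (\<kappa> e)) * fact j"
    using s \<kappa> W1 j by (intro mult_left_mono fdet_bound prod_nonneg) auto
  finally have "(cmod (fdet j (\<lambda>e. V (\<kappa> e))) * (\<Prod>c<j. cmod (b c c)))\<^sup>2 \<le> ((\<Prod>e<j. s (\<kappa> e)) * fact j)\<^sup>2"
    by (intro power_mono mult_nonneg_nonneg prod_nonneg) auto
  then show ?thesis by (simp add: power_mult_distrib prod_power_distrib)
qed

lemma left_inverse_imp_right_inverse:
  fixes U V :: "nat \<Rightarrow> nat \<Rightarrow> complex"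
  assumes VU: "\<And>k l. k < n \<Longrightarrow> l < n \<Longrightarrow> (\<Sum>i<n. V k i * U i l) = (if k = l then 1 else 0)"
    and ij: "i < n" "j < n"
  shows "(\<Sum>k<n. U i k * V k j) = (if i = j then 1 else 0)"
proof -
  let ?V = "mat n n (\<lambda>(k, i). V k i)" and ?U = "mat n n (\<lambda>(i, k). U i k)"
  have inv: "?V * ?U = 1\<^sub>m n"
    
  proof (rule eq_matI)
    fix k l assume "k < dim_row (1\<^sub>m n :: complex mat)" "l < dim_col (1\<^sub>m n :: complex mat)"
    then show "(?V * ?U) $$ (k, l) = 1\<^sub>m n $$ (k, l)"
      using VU[of k l] by (simp add: scalar_prod_def lessThan_atLeast0)
  qed simp_all
  have "?U * ?V = 1\<^sub>m n" by (rule mat_mult_left_right_inverse[OF _ _ inv]) simp_all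
  moreover have "(?U * ?V) $$ (i, j) = (\<Sum>k<n. U i k * V k j)"
    using ij by (simp add: scalar_prod_def lessThan_atLeast0)
  ultimately show ?thesis using ij by simp
qed

context scaling_problem
begin

text \<open>The columns of \<open>h\<close>, multiplied by the square roots of the weights, form a
  matrix \<open>b\<close> with \<open>b b^\<dagger> = h P h^\<dagger>\<close>; its pivoted
  factorisation expresses the same matrix through \<open>U\<close> and the squared scales.\<close>

lemma image_det_factorization:
  assumes h: "h \<in> GL_flag n"
    and F: "pivoted_factorization n {..<n} n (\<lambda>i c. h $$ (i, c) * of_real (sqrt (p (Suc c)))) C U V s W"
  shows "image_det h = rdet m q (gram ({..<n} \<times> {1..r}) (\<lambda>t. (s (fst t))\<^sup>2) (kraus_vec n A U))"
  unfolding image_det_def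
proof (rule rdet_cong)
  fix a b assume ab: "a < m" "b < m"
  have hc: "h \<in> carrier_mat n n" using h by (simp add: GL_flag_iff)
  let ?X = "h * seq_diag n p * mat_adjoint h"
  have X: "?X \<in> carrier_mat n n"
    using hc mat_adjoint_carrier[OF hc] by (intro mult_carrier_mat) (auto simp: seq_diag_def)
  have XU: "?X $$ (i, j) = (\<Sum>k<n. of_real ((s k)\<^sup>2) * U i k * cnj (U j k))" if "i < n" "j < n" for i j
  proof -
    have "?X $$ (i, j) = (\<Sum>c<n. (h $$ (i, c) * of_real (sqrt (p (Suc c)))) * cnj (h $$ (j, c) * of_real (sqrt (p (Suc c)))))"
      unfolding diag_congruence_index[OF hc that]
    proof (intro sum.cong refl)
      fix c assume "c \<in> {..<n}"
      then have "complex_of_real (p (Suc c)) = of_real (sqrt (p (Suc c))) * of_real (sqrt (p (Suc c)))"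
        using p_nonneg[of c] by (simp flip: of_real_mult)
      then show "of_real (p (Suc c)) * h $$ (i, c) * cnj (h $$ (j, c))
        = (h $$ (i, c) * of_real (sqrt (p (Suc c)))) * cnj (h $$ (j, c) * of_real (sqrt (p (Suc c))))"
        by (simp only: complex_cnj_mult complex_cnj_complex_of_real mult_ac)
    qed
    then show ?thesis using pivoted_factorization_gram[OF F] that by simp
  qed
  show "gram ({..<n} \<times> {1..r}) (\<lambda>t. p (Suc (fst t))) (kraus_vec n A (entries h)) a b
      = gram ({..<n} \<times> {1..r}) (\<lambda>t. (s (fst t))\<^sup>2) (kraus_vec n A U) a b"
    using cp_map_gram[OF kraus X diag_congruence_index[OF hc] ab] cp_map_gram[OF kraus X XU ab] by simp
qed

text \<open>The numerator is at least a constant times the monomial with exponents \<alpha>, the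
  denominator at most a constant times the one with exponents \<beta>. All constants come from
  \<delta>, \<gamma> and \<open>p\<close>, none from \<open>h\<close> or the scales.\<close>

lemma capacity_bound_from_minors:
  assumes h: "h \<in> GL_flag n"
    and F: "pivoted_factorization n {..<n} n (\<lambda>i c. h $$ (i, c) * of_real (sqrt (p (Suc c)))) C U V s W"
    and S: "\<And>i. S i \<subseteq> {..<n} \<times> {1..r}"
      "\<And>i. 1 \<le> i \<Longrightarrow> i \<le> m \<Longrightarrow> seq_diff m q i \<noteq> 0 \<Longrightarrow> bij_betw (\<kappa> i) {..<i} (S i)
        \<and> \<delta> i \<le> (cmod (fdet i (\<lambda>e. kraus_vec n A U (\<kappa> i e))))\<^sup>2"
    and K: "\<And>j. K j \<subseteq> {..<n}"
      "\<And>j. 1 \<le> j \<Longrightarrow> j \<le> n \<Longrightarrow> bij_betw (\<mu> j) {..<j} (K j) \<and> \<gamma> j \<le> (cmod (fdet j (\<lambda>e. V (\<mu> j e))))\<^sup>2"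
    and pos: "\<And>i. 0 < \<delta> i" "\<And>j. 0 < \<gamma> j"
    and part: "\<And>t. t \<le> n \<Longrightarrow> (\<Sum>j = 1..n. seq_diff n p j * real (card {k \<in> K j. k < t}))
      \<le> (\<Sum>i = 1..m. seq_diff m q i * real (card {t' \<in> S i. fst t' < t}))"
    and tot: "(\<Sum>j = 1..n. seq_diff n p j * real (card {k \<in> K j. k < n}))
      = (\<Sum>i = 1..m. seq_diff m q i * real (card {t' \<in> S i. fst t' < n}))"
  shows "flag_prod m q \<delta> * (\<Prod>c<n. pw (p (Suc c)) (p (Suc c))) * flag_weight n p h
    \<le> flag_prod n p (\<lambda>j. (fact j)\<^sup>2 / \<gamma> j) * image_det h"
proof -
  let ?b = "\<lambda>i c. h $$ (i, c) * complex_of_real (sqrt (p (Suc c)))"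
  define d where "d k = (s k)\<^sup>2" for k
  note s = pivoted_factorizationD(2)[OF F] and sd = pivoted_factorizationD(3)[OF F]
  have d0: "0 \<le> d k" for k by (simp add: d_def)
  have dd: "d (Suc k) \<le> d k" if "Suc k < n" for k
    unfolding d_def using sd[OF that] s[OF that] by (intro power_mono) auto
  have finS: "finite (S i)" for i using S(1) by (rule finite_subset) auto
  have finK: "finite (K j)" for j using K(1) by (rule finite_subset) auto
  have fS: "fst ` S i \<subseteq> {..<n}" for i using S(1)[of i] by auto
  have fK: "(\<lambda>k. k) ` K j \<subseteq> {..<n}" for j using K(1) by auto
  define \<alpha> where "\<alpha> l = (\<Sum>i = 1..m. seq_diff m q i * real (card {t \<in> S i. fst t = l}))" for l
  define \<beta> where "\<beta> l = (\<Sum>j = 1..n. seq_diff n p j * real (card {k \<in> K j. k = l}))" for l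
  have sum\<alpha>: "(\<Sum>l<t. \<alpha> l) = (\<Sum>i = 1..m. seq_diff m q i * real (card {t' \<in> S i. fst t' < t}))" for t
    unfolding \<alpha>_def by (rule sum_seq_diff_fibres[OF finS])
  have sum\<beta>: "(\<Sum>l<t. \<beta> l) = (\<Sum>j = 1..n. seq_diff n p j * real (card {k \<in> K j. k < t}))" for t
    unfolding \<beta>_def by (rule sum_seq_diff_fibres[OF finK])
  have abel: "(\<Prod>l<n. pw (d l) (\<beta> l)) \<le> (\<Prod>l<n. pw (d l) (\<alpha> l))"
  proof -
    have "(\<Prod>l<n. pw (d l) (\<beta> l)) * pw (d (n - 1)) ((\<Sum>l<n. \<alpha> l) - (\<Sum>l<n. \<beta> l)) \<le> (\<Prod>l<n. pw (d l) (\<alpha> l))"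
    proof (rule prod_pw_abel[of n d \<alpha> \<beta>])
      show "0 \<le> d k" for k by (rule d0)
      show "d (Suc k) \<le> d k" if "Suc k < n" for k using that by (rule dd)
      show "0 \<le> \<alpha> l" for l unfolding \<alpha>_def
        using seq_diff_nonneg[OF wq] by (intro sum_nonneg mult_nonneg_nonneg) auto
      show "0 \<le> \<beta> l" for l unfolding \<beta>_def
        using seq_diff_nonneg[OF wp] by (intro sum_nonneg mult_nonneg_nonneg) auto
    qed (simp_all only: sum\<alpha> sum\<beta> part)
    \<comment> \<open>Equal total degree leaves the last scale with exponent 0, hence with factor 1
      even if that scale vanishes.\<close>
    moreover have "(\<Sum>l<n. \<alpha> l) = (\<Sum>l<n. \<beta> l)" unfolding sum\<alpha> sum\<beta> by (rule tot[symmetric])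
    ultimately show ?thesis by simp
  qed
  have im: "flag_prod m q \<delta> * (\<Prod>l<n. pw (d l) (\<alpha> l)) \<le> image_det h"
  proof -
    let ?G = "gram ({..<n} \<times> {1..r}) (\<lambda>t. d (fst t)) (kraus_vec n A U)"
    have "flag_prod m q \<delta> * (\<Prod>l<n. pw (d l) (\<alpha> l)) = flag_prod m q \<delta> * flag_prod m q (\<lambda>i. \<Prod>t\<in>S i. d (fst t))"
      unfolding \<alpha>_def by (rule arg_cong[OF flag_prod_fibres[OF wq d0 finS fS, symmetric]])
    also have "\<dots> = flag_prod m q (\<lambda>i. \<delta> i * (\<Prod>t\<in>S i. d (fst t)))"
      using pos(1) d0 by (intro flag_prod_mult[symmetric] prod_nonneg) (auto intro: less_imp_le)
    also have "\<dots> \<le> flag_prod m q (\<lambda>i. pdet i ?G)"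
    proof (intro flag_prod_mono wq conjI)
      fix i assume i: "1 \<le> i" "i \<le> m" "seq_diff m q i \<noteq> 0"
      have P: "0 \<le> (\<Prod>t\<in>S i. d (fst t))" using d0 by (intro prod_nonneg) auto
      then show "0 \<le> \<delta> i * (\<Prod>t\<in>S i. d (fst t))" using pos(1)[of i] by simp
      have "\<delta> i * (\<Prod>t\<in>S i. d (fst t)) \<le> (cmod (fdet i (\<lambda>e. kraus_vec n A U (\<kappa> i e))))\<^sup>2 * (\<Prod>t\<in>S i. d (fst t))"
        using S(2)[OF i] P by (intro mult_right_mono) auto
      also have "\<dots> \<le> pdet i ?G"
        using pdet_gram_ge[of "{..<n} \<times> {1..r}" "\<lambda>t. d (fst t)" "\<kappa> i" i "S i" "kraus_vec n A U"] S(1) S(2)[OF i] d0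
        by (simp add: mult.commute)
      finally show "\<delta> i * (\<Prod>t\<in>S i. d (fst t)) \<le> pdet i ?G" .
    qed
    also have "\<dots> = image_det h"
      unfolding image_det_factorization[OF h F] rdet_def d_def ..
    finally show ?thesis .
  qed
  \<comment> \<open>The minors available are those of \<open>b\<close>, not of \<open>h\<close>,
    which accounts for the powers of the weights. Where \<open>p (Suc c) = 0\<close> the diagonal
    entry of \<open>b\<close> is 0 but its exponent is 0 too.\<close>
  have "(\<Prod>c<n. pw (p (Suc c)) (p (Suc c))) * flag_weight n p h = (\<Prod>c<n. pw ((cmod (?b c c))\<^sup>2) (p (Suc c)))"
    unfolding flag_weight_def prod.distrib[symmetric]
    using p_nonneg by (intro prod.cong refl) (simp add: norm_mult power_mult_distrib pw_mult mult.commute)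
  also have "\<dots> = flag_prod n p (\<lambda>j. \<Prod>c<j. (cmod (?b c c))\<^sup>2)"
    by (rule flag_prod_prefix[OF wp, symmetric]) simp
  also have "\<dots> \<le> flag_prod n p (\<lambda>j. (fact j)\<^sup>2 / \<gamma> j * (\<Prod>k\<in>K j. d k))"
  proof (intro flag_prod_mono wp conjI)
    fix j assume j: "1 \<le> j" "j \<le> n"
    let ?P = "\<Prod>c<j. (cmod (?b c c))\<^sup>2"
    show P: "0 \<le> ?P" by (intro prod_nonneg) auto
    have bij: "bij_betw (\<mu> j) {..<j} (K j)" using K(2)[OF j] by simp
    have "(cmod (fdet j (\<lambda>e. V (\<mu> j e))))\<^sup>2 * ?P \<le> (\<Prod>e<j. (s (\<mu> j e))\<^sup>2) * (fact j)\<^sup>2"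
    proof (rule pivoted_factorization_minor[OF F _ j(2)])
      show "?b i c = 0" if "c < i" "i < n" for i c using h that by (simp add: GL_flag_iff)
      show "\<mu> j e < n" if "e < j" for e using bij_betwE[OF bij] K(1)[of j] that by auto
    qed
    also have "(\<Prod>e<j. (s (\<mu> j e))\<^sup>2) = (\<Prod>k\<in>K j. d k)"
      unfolding d_def by (rule prod.reindex_bij_betw[OF bij])
    finally have "(cmod (fdet j (\<lambda>e. V (\<mu> j e))))\<^sup>2 * ?P \<le> (\<Prod>k\<in>K j. d k) * (fact j)\<^sup>2" .
    then have "\<gamma> j * ?P \<le> (\<Prod>k\<in>K j. d k) * (fact j)\<^sup>2"
      using mult_right_mono[OF conjunct2[OF K(2)[OF j]] P] by linarith
    then show "?P \<le> (fact j)\<^sup>2 / \<gamma> j * (\<Prod>k\<in>K j. d k)"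
      using pos(2)[of j] by (simp add: pos_le_divide_eq mult.commute)
  qed
  also have "\<dots> = flag_prod n p (\<lambda>j. (fact j)\<^sup>2 / \<gamma> j) * flag_prod n p (\<lambda>j. \<Prod>k\<in>K j. d k)"
    using pos(2) d0 by (intro flag_prod_mult prod_nonneg divide_nonneg_pos) auto
  also have "flag_prod n p (\<lambda>j. \<Prod>k\<in>K j. d k) = (\<Prod>l<n. pw (d l) (\<beta> l))"
    unfolding \<beta>_def by (rule flag_prod_fibres[OF wp d0 finK fK])
  finally have fw: "(\<Prod>c<n. pw (p (Suc c)) (p (Suc c))) * flag_weight n p h
    \<le> flag_prod n p (\<lambda>j. (fact j)\<^sup>2 / \<gamma> j) * (\<Prod>l<n. pw (d l) (\<beta> l))" .
  let ?\<Delta> = "flag_prod m q \<delta>" and ?\<Gamma> = "flag_prod n p (\<lambda>j. (fact j)\<^sup>2 / \<gamma> j)"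
  have \<Delta>: "0 \<le> ?\<Delta>" and \<Gamma>: "0 \<le> ?\<Gamma>" unfolding flag_prod_def by (intro prod_nonneg; simp)+
  have "?\<Delta> * ((\<Prod>c<n. pw (p (Suc c)) (p (Suc c))) * flag_weight n p h) \<le> ?\<Delta> * (?\<Gamma> * (\<Prod>l<n. pw (d l) (\<beta> l)))"
    using fw \<Delta> by (rule mult_left_mono)
  also have "\<dots> = ?\<Gamma> * (?\<Delta> * (\<Prod>l<n. pw (d l) (\<beta> l)))" by simp
  also have "\<dots> \<le> ?\<Gamma> * (?\<Delta> * (\<Prod>l<n. pw (d l) (\<alpha> l)))"
    using abel \<Delta> \<Gamma> by (intro mult_left_mono)
  also have "\<dots> \<le> ?\<Gamma> * image_det h"
    using im \<Gamma> by (rule mult_left_mono)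
  finally show ?thesis by (simp add: mult.assoc)
qed

text \<open>The rows of \<open>V\<close> are dual to the columns of \<open>U\<close>, so the second
  space is the span of the columns of \<open>U\<close> with index below \<open>t\<close>, and the
  first is the orthogonal complement of its images under the Kraus operators. Both are given by
  equations, the form in which pivots can be counted.\<close>

lemma independent_pair_of_bases:
  assumes UV: "\<And>i j. i < n \<Longrightarrow> j < n \<Longrightarrow> (\<Sum>k<n. U i k * V k j) = (if i = j then 1 else 0)"
  shows "cp_independent m n r A (annihilator m (kraus_vec n A U ` ({..<t} \<times> {1..r}))) (annihilator n (V ` {t..<n}))"
  unfolding cp_independent_def
proof (intro conjI ballI subsetI csubspace_annihilator)
  fix l x assume l: "l \<in> {1..r}" and x: "x \<in> annihilator m (kraus_vec n A U ` ({..<t} \<times> {1..r}))"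
  have xc: "x \<in> carrier_vec m" using x by (simp add: annihilator_def)
  show "x \<in> orth_compl m ((\<lambda>v. A l *\<^sub>v v) ` annihilator n (V ` {t..<n}))"
    unfolding orth_compl_def
  proof (intro CollectI conjI ballI xc)
    fix z assume "z \<in> (\<lambda>v. A l *\<^sub>v v) ` annihilator n (V ` {t..<n})"
    then obtain y where y: "y \<in> annihilator n (V ` {t..<n})" "z = A l *\<^sub>v y" by blast
    have yc: "y \<in> carrier_vec n" using y by (simp add: annihilator_def)
    define \<zeta> where "\<zeta> k = (\<Sum>j<n. V k j * y $ j)" for k
    have \<zeta>0: "\<zeta> k = 0" if "t \<le> k" "k < n" for k
      using y(1) that unfolding annihilator_def \<zeta>_def by auto
    have yU: "y $ i = (\<Sum>k<n. U i k * \<zeta> k)" if "i < n" for i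
    proof -
      have "(\<Sum>k<n. U i k * \<zeta> k) = (\<Sum>k<n. \<Sum>j<n. U i k * V k j * y $ j)"
        by (simp add: \<zeta>_def sum_distrib_left mult.assoc)
      also have "\<dots> = (\<Sum>j<n. (\<Sum>k<n. U i k * V k j) * y $ j)"
        unfolding sum_distrib_right by (rule sum.swap)
      also have "\<dots> = (\<Sum>j<n. if j = i then y $ j else 0)"
        using UV[OF that] by (intro sum.cong refl) auto
      finally show ?thesis using that by simp
    qed
    have "z $ a = (\<Sum>k<n. \<zeta> k * (\<Sum>i<n. A l $$ (a, i) * U i k))" if "a < m" for a
    proof -
      have "z $ a = (\<Sum>i<n. A l $$ (a, i) * y $ i)"
        using kraus[OF l] yc that y(2) by (simp add: scalar_prod_def lessThan_atLeast0)
      also have "\<dots> = (\<Sum>i<n. \<Sum>k<n. \<zeta> k * (A l $$ (a, i) * U i k))"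
        by (intro sum.cong refl) (simp add: yU sum_distrib_left mult_ac)
      also have "\<dots> = (\<Sum>k<n. \<zeta> k * (\<Sum>i<n. A l $$ (a, i) * U i k))"
        unfolding sum_distrib_left by (rule sum.swap)
      finally show ?thesis .
    qed
    then have "(\<Sum>a<m. x $ a * cnj (z $ a)) = (\<Sum>a<m. \<Sum>k<n. cnj (\<zeta> k) * (kraus_vec n A U (k, l) a * x $ a))"
      by (intro sum.cong refl) (simp add: kraus_vec_def sum_distrib_left mult_ac)
    also have "\<dots> = (\<Sum>k<n. cnj (\<zeta> k) * (\<Sum>a<m. kraus_vec n A U (k, l) a * x $ a))"
      unfolding sum_distrib_left by (rule sum.swap)
    also have "\<dots> = 0"
    proof (intro sum.neutral ballI)
      fix k assume "k \<in> {..<n}"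
      then show "cnj (\<zeta> k) * (\<Sum>a<m. kraus_vec n A U (k, l) a * x $ a) = 0"
        using \<zeta>0[of k] x l unfolding annihilator_def by (cases "k < t") auto
    qed
    finally have "(\<Sum>a<m. x $ a * cnj (z $ a)) = 0" .
    moreover have "dim_vec z = m" using kraus[OF l] y(2) by simp
    ultimately show "x \<bullet>c z = 0" by (simp add: scalar_prod_def lessThan_atLeast0)
  qed
qed

text \<open>
  The greedy sets of rows count dimensions: \<open>S i\<close> and \<open>K j\<close> below realise the ranks of the truncated
  families \<open>\<eta>\<^sub>i A\<^sub>l u\<^sub>k\<close> and \<open>v\<^sub>k\<close>, taken in the order of decreasing, respectively increasing, \<open>s k\<close>.
\<close>

lemma greedy_minors:
  assumes rn: "rank_nondecreasing m n r A p q"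
    and UV: "\<And>i j. i < n \<Longrightarrow> j < n \<Longrightarrow> (\<Sum>k<n. U i k * V k j) = (if i = j then 1 else 0)"
  obtains S K \<kappa> \<mu>
  where "\<And>i. S i \<subseteq> {..<n} \<times> {1..r}" "\<And>j. K j \<subseteq> {..<n}"
    "\<And>i. 1 \<le> i \<Longrightarrow> i \<le> m \<Longrightarrow> seq_diff m q i \<noteq> 0 \<Longrightarrow> bij_betw (\<kappa> i) {..<i} (S i)
      \<and> fdet i (\<lambda>e. kraus_vec n A U (\<kappa> i e)) \<noteq> 0"
    "\<And>j. 1 \<le> j \<Longrightarrow> j \<le> n \<Longrightarrow> bij_betw (\<mu> j) {..<j} (K j) \<and> fdet j (\<lambda>e. V (\<mu> j e)) \<noteq> 0"
    "\<And>t. t \<le> n \<Longrightarrow> (\<Sum>j = 1..n. seq_diff n p j * real (card {k \<in> K j. k < t}))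
      \<le> (\<Sum>i = 1..m. seq_diff m q i * real (card {t' \<in> S i. fst t' < t}))"
    "(\<Sum>j = 1..n. seq_diff n p j * real (card {k \<in> K j. k < n}))
      = (\<Sum>i = 1..m. seq_diff m q i * real (card {t' \<in> S i. fst t' < n}))"
proof -
  define I where "I = {..<n} \<times> {1..r}"
  \<comment> \<open>Lexicographic rank: the scale index decides, and the Kraus index, which is below
    \<open>Suc r\<close>, breaks ties. Large scales come first, as suits a lower bound for the
    numerator.\<close>
  define \<rho> where "\<rho> t = fst t * Suc r + snd t" for t :: "nat \<times> nat"
  define w where "w = kraus_vec n A U"
  define S where "S i = row_pivots i I \<rho> w" for i
  \<comment> \<open>The reversed order prefers small scales, since minors of \<open>h\<close> are
    bounded above by products of scales.\<close>
  define K where "K j = row_pivots j {..<n} (\<lambda>k. n - 1 - k) V" for j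
  define L where "L t = annihilator m (w ` ({..<t} \<times> {1..r}))" for t
  define R where "R t = annihilator n (V ` {t..<n})" for t
  have SI: "S i \<subseteq> I" for i by (auto simp: S_def row_pivots_def)
  have KI: "K j \<subseteq> {..<n}" for j by (auto simp: K_def row_pivots_def)
  have finS: "finite (S i)" for i using SI by (rule finite_subset) (simp add: I_def)
  have finK: "finite (K j)" for j using KI by (rule finite_subset) simp
  have \<rho>_div: "\<rho> t div Suc r = fst t" "\<rho> t mod Suc r = snd t" if "t \<in> I" for t
  proof -
    have "snd t < Suc r" using that unfolding I_def by (auto simp: mem_Times_iff)
    then show "\<rho> t div Suc r = fst t" "\<rho> t mod Suc r = snd t"
      unfolding \<rho>_def by (simp_all add: add.commute[of _ "snd t"] del: mult_Suc_right)
  qed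
  have \<rho>_inj: "inj_on \<rho> I"
    by (rule inj_onI) (metis \<rho>_div prod_eqI)
  have \<rho>_less: "\<rho> t < u * Suc r \<longleftrightarrow> fst t < u" if "t \<in> I" for t u
    using \<rho>_div(1)[OF that] by (metis div_less_iff_less_mult zero_less_Suc)
  \<comment> \<open>The kept rows with scale index below \<open>t\<close> impose all equations that
    define \<open>L t\<close> within the flag space of index \<open>i\<close>, so their number
    bounds the codimension there.\<close>
  have cL: "i \<le> card (pivots m (L t) \<inter> {..<i}) + card {t' \<in> S i. fst t' < t}" if i: "i \<le> m" and tn: "t \<le> n" for i t
  proof -
    let ?W = "w ` {t' \<in> S i. fst t' < t}"
    have "i \<le> card (pivots m (L t) \<inter> {..<i}) + card ?W"
    proof (rule card_pivots_ge[OF _ i])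
      show "finite ?W" using finS by simp
      fix x assume x: "x \<in> annihilator m ?W" "x \<in> coord_space m i"
      have trunc: "(\<Sum>a<m. v a * x $ a) = (\<Sum>a<i. v a * x $ a)" for v :: "nat \<Rightarrow> complex"
        using x(2) i by (intro sum.mono_neutral_right) (auto simp: coord_space_def)
      have "(\<Sum>a<i. w t' a * x $ a) = 0" if t': "t' \<in> {..<t} \<times> {1..r}" for t'
      proof (rule row_pivots_annihilate[where I = I and \<rho> = \<rho> and w = w and u = "t * Suc r" and x = "\<lambda>a. x $ a"])
        show "t' \<in> I" "\<rho> t' < t * Suc r" using t' tn \<rho>_less[of t' t] by (auto simp: I_def mem_Times_iff)
        fix s' assume s': "s' \<in> row_pivots i I \<rho> w" "\<rho> s' < t * Suc r"
        then have "s' \<in> S i" "s' \<in> I" using SI[of i] by (auto simp: S_def)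
        then have "s' \<in> {t' \<in> S i. fst t' < t}" using s'(2) \<rho>_less by simp
        then have "(\<Sum>a<m. w s' a * x $ a) = 0" using x(1) unfolding annihilator_def by blast
        then show "(\<Sum>a<i. w s' a * x $ a) = 0" unfolding trunc .
      qed
      then have "(\<Sum>a<m. w t' a * x $ a) = 0" if "t' \<in> {..<t} \<times> {1..r}" for t'
        unfolding trunc using that .
      then show "x \<in> L t"
        using x(1) unfolding L_def annihilator_def by blast
    qed
    then show ?thesis using card_image_le[of "{t' \<in> S i. fst t' < t}" w] finS[of i] by simp
  qed
  have cR: "j \<le> card (pivots n (R t) \<inter> {..<j}) + card {k \<in> K j. t \<le> k}" if j: "j \<le> n" and tn: "t \<le> n" for j t
  proof -
    let ?W = "V ` {k \<in> K j. t \<le> k}"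
    have "j \<le> card (pivots n (R t) \<inter> {..<j}) + card ?W"
    proof (rule card_pivots_ge[OF _ j])
      show "finite ?W" using finK by simp
      fix x assume x: "x \<in> annihilator n ?W" "x \<in> coord_space n j"
      have trunc: "(\<Sum>a<n. v a * x $ a) = (\<Sum>a<j. v a * x $ a)" for v :: "nat \<Rightarrow> complex"
        using x(2) j by (intro sum.mono_neutral_right) (auto simp: coord_space_def)
      have "(\<Sum>a<j. V k a * x $ a) = 0" if k: "k \<in> {t..<n}" for k
      proof (rule row_pivots_annihilate[where I = "{..<n}" and \<rho> = "\<lambda>k. n - 1 - k" and w = V and u = "n - t" and x = "\<lambda>a. x $ a"])
        show "k \<in> {..<n}" "n - 1 - k < n - t" using k by auto
        fix k' assume k': "k' \<in> row_pivots j {..<n} (\<lambda>k. n - 1 - k) V" "n - 1 - k' < n - t"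
        then have "k' \<in> K j" "k' < n" using KI[of j] by (auto simp: K_def)
        moreover have "t \<le> k'" using k'(2) \<open>k' < n\<close> by linarith
        ultimately have "k' \<in> {k \<in> K j. t \<le> k}" by simp
        then have "(\<Sum>a<n. V k' a * x $ a) = 0" using x(1) unfolding annihilator_def by blast
        then show "(\<Sum>a<j. V k' a * x $ a) = 0" unfolding trunc .
      qed
      then have "(\<Sum>a<n. V k a * x $ a) = 0" if "k \<in> {t..<n}" for k
        unfolding trunc using that .
      then show "x \<in> R t"
        using x(1) unfolding R_def annihilator_def by blast
    qed
    then show ?thesis using card_image_le[of "{k \<in> K j. t \<le> k}" V] finK[of j] by simp
  qed
  have inj_rev: "inj_on (\<lambda>k. n - 1 - k) {..<n}" by (rule inj_onI) auto
  \<comment> \<open>\<open>R 0\<close> is zero because \<open>V\<close> is invertible; the estimate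
    \<open>cR\<close> at t = 0 then shows that no \<open>K j\<close> has fewer than \<open>j\<close>
    elements.\<close>
  have R0: "pivots n (R 0) = {}"
  proof (rule ccontr)
    assume "pivots n (R 0) \<noteq> {}"
    then obtain e x where e: "e < n" "x \<in> R 0" "has_pivot n e x" by (auto simp: pivots_def)
    have "(\<Sum>j<n. V k j * x $ j) = 0" if "k < n" for k
      using e(2) that unfolding R_def annihilator_def by auto
    then have "0 = (\<Sum>k<n. U e k * (\<Sum>j<n. V k j * x $ j))" by simp
    also have "\<dots> = (\<Sum>k<n. \<Sum>j<n. U e k * V k j * x $ j)"
      by (simp add: sum_distrib_left mult.assoc)
    also have "\<dots> = (\<Sum>j<n. (\<Sum>k<n. U e k * V k j) * x $ j)"
      unfolding sum_distrib_right by (rule sum.swap)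
    also have "\<dots> = (\<Sum>j<n. if j = e then x $ j else 0)"
      using UV[OF e(1)] by (intro sum.cong refl) auto
    also have "\<dots> = x $ e" using e(1) by simp
    finally show False using e(3) by (simp add: has_pivot_def)
  qed
  have cardK: "card (K j) = j" if "j \<le> n" for j
  proof (rule antisym)
    show "card (K j) \<le> j" unfolding K_def by (rule row_pivots_basis(1)[OF finite_lessThan inj_rev])
    show "j \<le> card (K j)" using cR[OF that, of 0] R0 by simp
  qed
  have cardS: "card (S i) \<le> i" for i
    unfolding S_def by (rule row_pivots_basis(1)[OF _ \<rho>_inj]) (simp add: I_def)
  have prefix: "(\<Sum>i = 1..k. seq_diff k a i * real i) = (\<Sum>i<k. a (Suc i))" for k a
    using sum_seq_diff_prefix[of k a "\<lambda>_. 1"] by simp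
  have part: "(\<Sum>j = 1..n. seq_diff n p j * real (card {k \<in> K j. k < t}))
      \<le> (\<Sum>i = 1..m. seq_diff m q i * real (card {t' \<in> S i. fst t' < t}))" if tn: "t \<le> n" for t
  proof -
    have ind: "cp_independent m n r A (L t) (R t)"
      unfolding L_def R_def w_def by (rule independent_pair_of_bases[OF UV])
    then have sub: "csubspace m (L t)" "csubspace n (R t)" by (auto simp: cp_independent_def)
    \<comment> \<open>Lower bounds for both dimensions are put into the rank condition. The terms
      with \<open>real i\<close> sum to the trace of Q and cancel against its right side.\<close>
    have "(\<Sum>i = 1..m. seq_diff m q i * (real i - real (card {t' \<in> S i. fst t' < t})))
        + (\<Sum>j = 1..n. seq_diff n p j * real (card {k \<in> K j. k < t}))
      \<le> (\<Sum>i = 1..m. seq_diff m q i * real (subspace_dim m (flag_space m i \<inter> L t)))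
        + (\<Sum>j = 1..n. seq_diff n p j * real (subspace_dim n (flag_space n j \<inter> R t)))"
    proof (intro add_mono sum_mono mult_left_mono)
      fix i assume i: "i \<in> {1..m}"
      then show "real i - real (card {t' \<in> S i. fst t' < t}) \<le> real (subspace_dim m (flag_space m i \<inter> L t))"
        using cL[of i t] tn dim_flag_space_Int[OF sub(1), of i] by simp
      show "0 \<le> seq_diff m q i" using i seq_diff_nonneg[OF wq] by simp
    next
      fix j assume j: "j \<in> {1..n}"
      have "K j = {k \<in> K j. k < t} \<union> {k \<in> K j. t \<le> k}" by auto
      then have "card (K j) = card {k \<in> K j. k < t} + card {k \<in> K j. t \<le> k}"
        using card_Un_disjoint[of "{k \<in> K j. k < t}" "{k \<in> K j. t \<le> k}"] finK[of j] by fastforce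
      then show "real (card {k \<in> K j. k < t}) \<le> real (subspace_dim n (flag_space n j \<inter> R t))"
        using cR[of j t] tn j cardK[of j] dim_flag_space_Int[OF sub(2), of j] by simp
      show "0 \<le> seq_diff n p j" using j seq_diff_nonneg[OF wp] by simp
    qed
    also have "\<dots> \<le> (\<Sum>i<n. p (Suc i))"
      using rn ind unfolding rank_nondecreasing_def mat_trace_seq_diag by simp
    finally show ?thesis
      unfolding right_diff_distrib sum_subtractf prefix total by linarith
  qed
  have Kn: "{k \<in> K j. k < n} = K j" for j using KI[of j] by auto
  have Sn: "{t' \<in> S i. fst t' < n} = S i" for i using SI[of i] by (auto simp: I_def)
  have "(\<Sum>i<n. p (Suc i)) = (\<Sum>j = 1..n. seq_diff n p j * real (card (K j)))"
    unfolding prefix[symmetric] by (intro sum.cong) (auto simp: cardK)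
  also have "\<dots> \<le> (\<Sum>i = 1..m. seq_diff m q i * real (card (S i)))"
    using part[of n] unfolding Kn Sn by simp
  \<comment> \<open>The case t = n together with \<open>card (S i) \<le> i\<close> forces equality
    in every summand with nonzero exponent; exactly for those \<open>i\<close> a nonzero minor is
    needed.\<close>
  finally have ge: "(\<Sum>i<m. q (Suc i)) \<le> (\<Sum>i = 1..m. seq_diff m q i * real (card (S i)))"
    using total by simp
  have nn: "0 \<le> seq_diff m q i * (real i - real (card (S i)))" if "i \<in> {1..m}" for i
    using that seq_diff_nonneg[OF wq] cardS[of i] by (intro mult_nonneg_nonneg) auto
  have "(\<Sum>i = 1..m. seq_diff m q i * (real i - real (card (S i)))) \<le> 0"
    unfolding right_diff_distrib sum_subtractf prefix using ge by simp
  moreover have "0 \<le> (\<Sum>i = 1..m. seq_diff m q i * (real i - real (card (S i))))"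
    using nn by (rule sum_nonneg)
  ultimately have zero: "(\<Sum>i = 1..m. seq_diff m q i * (real i - real (card (S i)))) = 0" by linarith
  then have "\<forall>i\<in>{1..m}. seq_diff m q i * (real i - real (card (S i))) = 0"
    using nn by (subst (asm) sum_nonneg_eq_0_iff) auto
  then have eqS: "card (S i) = i" if "1 \<le> i" "i \<le> m" "seq_diff m q i \<noteq> 0" for i
    using that by auto
  have "\<exists>\<kappa>. 1 \<le> i \<and> i \<le> m \<and> seq_diff m q i \<noteq> 0 \<longrightarrow> bij_betw \<kappa> {..<i} (S i) \<and> fdet i (\<lambda>e. w (\<kappa> e)) \<noteq> 0" for i
    using row_pivots_basis(2)[OF _ \<rho>_inj, of i w] eqS[of i] unfolding S_def by (auto simp: I_def)
  then obtain \<kappa> where \<kappa>: "\<And>i. 1 \<le> i \<Longrightarrow> i \<le> m \<Longrightarrow> seq_diff m q i \<noteq> 0 \<Longrightarrow>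
      bij_betw (\<kappa> i) {..<i} (S i) \<and> fdet i (\<lambda>e. w (\<kappa> i e)) \<noteq> 0"
    by metis
  have "\<exists>\<kappa>. 1 \<le> j \<and> j \<le> n \<longrightarrow> bij_betw \<kappa> {..<j} (K j) \<and> fdet j (\<lambda>e. V (\<kappa> e)) \<noteq> 0" for j
  proof (cases "j \<le> n")
    case True
    then show ?thesis
      using row_pivots_basis(2)[OF finite_lessThan inj_rev, of j V, folded K_def, OF cardK[OF True]] by blast
  qed simp
  then obtain \<mu> where \<mu>: "\<And>j. 1 \<le> j \<Longrightarrow> j \<le> n \<Longrightarrow>
      bij_betw (\<mu> j) {..<j} (K j) \<and> fdet j (\<lambda>e. V (\<mu> j e)) \<noteq> 0"
    by metis
  show thesis
  proof (rule that[of S K \<kappa> \<mu>])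
    show "S i \<subseteq> {..<n} \<times> {1..r}" for i using SI by (simp add: I_def)
    have "(\<Sum>j = 1..n. seq_diff n p j * real (card (K j))) = (\<Sum>i<n. p (Suc i))"
      unfolding prefix[symmetric] by (intro sum.cong) (auto simp: cardK)
    moreover have "(\<Sum>i = 1..m. seq_diff m q i * real (card (S i))) = (\<Sum>i<m. q (Suc i))"
      using zero unfolding right_diff_distrib sum_subtractf prefix by simp
    ultimately show "(\<Sum>j = 1..n. seq_diff n p j * real (card {k \<in> K j. k < n}))
      = (\<Sum>i = 1..m. seq_diff m q i * real (card {t' \<in> S i. fst t' < n}))"
      unfolding Kn Sn using total by simp
  qed (use KI \<kappa> \<mu> part in \<open>simp_all add: w_def\<close>)
qed

text \<open>A sequence of matrices whose ratios tend to 0 is refuted. Only \<open>U\<close> and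
  \<open>V\<close> are made to converge; the scales may behave arbitrarily because the bound
  obtained from fixed minors does not involve them.\<close>

lemma rank_nondecreasing_imp_capacity:
  assumes rn: "rank_nondecreasing m n r A p q"
  shows "capacity m n (cp_map m r A) p q > 0"
proof (rule ccontr)
  assume neg: "\<not> capacity m n (cp_map m r A) p q > 0"
  have "\<exists>h. h \<in> GL_flag n \<and> image_det h < inverse (real (Suc N)) * flag_weight n p h" for N
  proof -
    have "\<not> (\<forall>h\<in>GL_flag n. inverse (real (Suc N)) * flag_weight n p h \<le> image_det h)"
      using neg unfolding capacity_pos_iff by (metis inverse_positive_iff_positive of_nat_0_less_iff zero_less_Suc)
    then show ?thesis by (auto simp: not_le)
  qed
  then obtain H where H: "\<And>N. H N \<in> GL_flag n" "\<And>N. image_det (H N) < inverse (real (Suc N)) * flag_weight n p (H N)"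
    by metis
  obtain C where C: "0 \<le> C \<and> (\<forall>N I b. finite I \<and> card I = n \<longrightarrow> (\<exists>U V s W. pivoted_factorization N I n b C U V s W))"
    using pivoted_factorization_exists[of n] by (rule exE)
  let ?b = "\<lambda>N i c. H N $$ (i, c) * complex_of_real (sqrt (p (Suc c)))"
  have ex: "\<exists>U V s W. pivoted_factorization n {..<n} n (?b N) C U V s W" for N
    by (rule C[THEN conjunct2, THEN spec, THEN spec, THEN spec, THEN mp]) simp
  have "\<forall>N. \<exists>x. pivoted_factorization n {..<n} n (?b N) C (fst x) (fst (snd x)) (fst (snd (snd x))) (snd (snd (snd x)))"
  proof
    fix N
    obtain U V s W where "pivoted_factorization n {..<n} n (?b N) C U V s W"
      using ex[of N] by (elim exE) (rule that)
    then show "\<exists>x. pivoted_factorization n {..<n} n (?b N) C (fst x) (fst (snd x)) (fst (snd (snd x))) (snd (snd (snd x)))"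
      by (intro exI[of _ "(U, V, s, W)"]) simp
  qed
  from choice[OF this] obtain X where
    X: "\<forall>N. pivoted_factorization n {..<n} n (?b N) C (fst (X N)) (fst (snd (X N))) (fst (snd (snd (X N)))) (snd (snd (snd (X N))))"
    by (rule exE)
  define U V s W where "U N = fst (X N)" and "V N = fst (snd (X N))" and "s N = fst (snd (snd (X N)))"
    and "W N = snd (snd (snd (X N)))" for N
  have F: "pivoted_factorization n {..<n} n (?b N) C (U N) (V N) (s N) (W N)" for N
    unfolding U_def V_def s_def W_def by (rule spec[OF X])
  have U1: "cmod (U N i k) \<le> 1" and VC: "cmod (V N k i) \<le> C" if "i < n" "k < n" for N i k
    using pivoted_factorizationD(4,8)[OF F] that by auto
  note VU = pivoted_factorizationD(7)[OF F]
  \<comment> \<open>The tag 0 or 1 distinguishes entries of \<open>U\<close> from entries of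
    \<open>V\<close>, so that one subsequence serves both.\<close>
  let ?J = "({0, 1::nat} \<times> {..<n}) \<times> {..<n}"
  let ?f = "\<lambda>N t. case t of ((b, i), k) \<Rightarrow> if b = 0 then U N i k else V N i k"
  have "\<exists>\<sigma> L. strict_mono (\<sigma> :: nat \<Rightarrow> nat) \<and> (\<forall>t\<in>?J. (\<lambda>N. ?f (\<sigma> N) t) \<longlonglongrightarrow> L t)"
  proof (rule bounded_family_convergent_subsequence[where C = "max 1 C"])
    fix N t assume "t \<in> ?J"
    then show "cmod (?f N t) \<le> max 1 C"
      using U1 VC by (auto simp: le_max_iff_disj)
  qed simp
  then obtain \<sigma> Lim where \<sigma>: "strict_mono \<sigma>" and lim: "\<And>t. t \<in> ?J \<Longrightarrow> (\<lambda>N. ?f (\<sigma> N) t) \<longlonglongrightarrow> Lim t"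
    by blast
  define U0 where "U0 i k = Lim ((0, i), k)" for i k
  define V0 where "V0 k i = Lim ((1, k), i)" for k i
  have limU: "(\<lambda>N. U (\<sigma> N) i k) \<longlonglongrightarrow> U0 i k" if "i < n" "k < n" for i k
    using lim[of "((0, i), k)"] that by (simp add: U0_def)
  have limV: "(\<lambda>N. V (\<sigma> N) k i) \<longlonglongrightarrow> V0 k i" if "i < n" "k < n" for i k
    using lim[of "((1, k), i)"] that by (simp add: V0_def)
  have VU0: "(\<Sum>i<n. V0 k i * U0 i l) = (if k = l then 1 else 0)" if kl: "k < n" "l < n" for k l
  proof (rule LIMSEQ_unique)
    show "(\<lambda>N. \<Sum>i<n. V (\<sigma> N) k i * U (\<sigma> N) i l) \<longlonglongrightarrow> (\<Sum>i<n. V0 k i * U0 i l)"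
      using kl by (intro tendsto_sum tendsto_mult limU limV) auto
    show "(\<lambda>N. \<Sum>i<n. V (\<sigma> N) k i * U (\<sigma> N) i l) \<longlonglongrightarrow> (if k = l then 1 else 0)"
      unfolding VU[OF kl] by (rule tendsto_const)
  qed
  note UV0 = left_inverse_imp_right_inverse[where U = U0 and V = V0, OF VU0]
  obtain S K \<kappa> \<mu> where S: "\<And>i. S i \<subseteq> {..<n} \<times> {1..r}" and K: "\<And>j. K j \<subseteq> {..<n}"
    and \<kappa>: "\<And>i. 1 \<le> i \<Longrightarrow> i \<le> m \<Longrightarrow> seq_diff m q i \<noteq> 0 \<Longrightarrow> bij_betw (\<kappa> i) {..<i} (S i)
      \<and> fdet i (\<lambda>e. kraus_vec n A U0 (\<kappa> i e)) \<noteq> 0"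
    and \<mu>: "\<And>j. 1 \<le> j \<Longrightarrow> j \<le> n \<Longrightarrow> bij_betw (\<mu> j) {..<j} (K j) \<and> fdet j (\<lambda>e. V0 (\<mu> j e)) \<noteq> 0"
    and part: "\<And>t. t \<le> n \<Longrightarrow> (\<Sum>j = 1..n. seq_diff n p j * real (card {k \<in> K j. k < t}))
      \<le> (\<Sum>i = 1..m. seq_diff m q i * real (card {t' \<in> S i. fst t' < t}))"
    and tot: "(\<Sum>j = 1..n. seq_diff n p j * real (card {k \<in> K j. k < n}))
      = (\<Sum>i = 1..m. seq_diff m q i * real (card {t' \<in> S i. fst t' < n}))"
    using greedy_minors[where U = U0 and V = V0, OF rn UV0] by blast
  \<comment> \<open>Half of the squared limiting minor is a lower bound that persists near the
    limit. The default 1 elsewhere merely keeps all values positive.\<close>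
  define \<delta> where "\<delta> i = (if 1 \<le> i \<and> i \<le> m \<and> seq_diff m q i \<noteq> 0
    then (cmod (fdet i (\<lambda>e. kraus_vec n A U0 (\<kappa> i e))))\<^sup>2 / 2 else 1)" for i
  define \<gamma> where "\<gamma> j = (if 1 \<le> j \<and> j \<le> n then (cmod (fdet j (\<lambda>e. V0 (\<mu> j e))))\<^sup>2 / 2 else 1)" for j
  have pos: "0 < \<delta> i" "0 < \<gamma> j" for i j using \<kappa> \<mu> by (auto simp: \<delta>_def \<gamma>_def)
  have half: "\<forall>\<^sub>F N in sequentially. (cmod z)\<^sup>2 / 2 \<le> (cmod (X N))\<^sup>2" if X: "X \<longlonglongrightarrow> z" and "z \<noteq> 0" for X z
  proof -
    have "(\<lambda>N. (cmod (X N))\<^sup>2) \<longlonglongrightarrow> (cmod z)\<^sup>2" using X by (intro tendsto_intros)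
    then have "\<forall>\<^sub>F N in sequentially. (cmod z)\<^sup>2 / 2 < (cmod (X N))\<^sup>2"
      by (rule order_tendstoD) (use \<open>z \<noteq> 0\<close> in simp)
    then show ?thesis by (rule eventually_mono) simp
  qed
  have ev\<delta>: "\<forall>\<^sub>F N in sequentially. \<forall>i\<in>{1..m}. seq_diff m q i \<noteq> 0 \<longrightarrow>
      \<delta> i \<le> (cmod (fdet i (\<lambda>e. kraus_vec n A (U (\<sigma> N)) (\<kappa> i e))))\<^sup>2"
  proof (rule eventually_ball_finite[OF finite_atLeastAtMost], rule ballI)
    fix i assume i: "i \<in> {1..m}"
    show "\<forall>\<^sub>F N in sequentially. seq_diff m q i \<noteq> 0 \<longrightarrow>
      \<delta> i \<le> (cmod (fdet i (\<lambda>e. kraus_vec n A (U (\<sigma> N)) (\<kappa> i e))))\<^sup>2"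
    proof (cases "seq_diff m q i = 0")
      case False
      then have k: "bij_betw (\<kappa> i) {..<i} (S i)" "fdet i (\<lambda>e. kraus_vec n A U0 (\<kappa> i e)) \<noteq> 0"
        using \<kappa> i by auto
      have "(\<lambda>N. fdet i (\<lambda>e. kraus_vec n A (U (\<sigma> N)) (\<kappa> i e))) \<longlonglongrightarrow> fdet i (\<lambda>e. kraus_vec n A U0 (\<kappa> i e))"
      proof (rule fdet_tendsto)
        fix e a assume "e < i"
        then have "fst (\<kappa> i e) < n" using bij_betwE[OF k(1)] S[of i] by (auto simp: mem_Times_iff)
        then show "(\<lambda>N. kraus_vec n A (U (\<sigma> N)) (\<kappa> i e) a) \<longlonglongrightarrow> kraus_vec n A U0 (\<kappa> i e) a"
          unfolding kraus_vec_def by (intro tendsto_cnj tendsto_sum tendsto_mult tendsto_const limU) auto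
      qed
      from half[OF this k(2)] show ?thesis using i False by (simp add: \<delta>_def)
    qed simp
  qed
  have ev\<gamma>: "\<forall>\<^sub>F N in sequentially. \<forall>j\<in>{1..n}. \<gamma> j \<le> (cmod (fdet j (\<lambda>e. V (\<sigma> N) (\<mu> j e))))\<^sup>2"
  proof (rule eventually_ball_finite[OF finite_atLeastAtMost], rule ballI)
    fix j assume j: "j \<in> {1..n}"
    then have k: "bij_betw (\<mu> j) {..<j} (K j)" "fdet j (\<lambda>e. V0 (\<mu> j e)) \<noteq> 0" using \<mu> by auto
    have "(\<lambda>N. fdet j (\<lambda>e. V (\<sigma> N) (\<mu> j e))) \<longlonglongrightarrow> fdet j (\<lambda>e. V0 (\<mu> j e))"
    proof (rule fdet_tendsto)
      fix e a assume "e < j" "a < j"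
      then have "\<mu> j e < n" "a < n" using bij_betwE[OF k(1)] K[of j] j by auto
      then show "(\<lambda>N. V (\<sigma> N) (\<mu> j e) a) \<longlonglongrightarrow> V0 (\<mu> j e) a" by (intro limV)
    qed
    from half[OF this k(2)] show "\<forall>\<^sub>F N in sequentially. \<gamma> j \<le> (cmod (fdet j (\<lambda>e. V (\<sigma> N) (\<mu> j e))))\<^sup>2"
      using j by (simp add: \<gamma>_def)
  qed
  let ?D = "flag_prod m q \<delta> * (\<Prod>c<n. pw (p (Suc c)) (p (Suc c)))"
  let ?G = "flag_prod n p (\<lambda>j. (fact j)\<^sup>2 / \<gamma> j)"
  have "0 < pw (p (Suc c)) (p (Suc c))" if "c < n" for c
    using p_nonneg[OF that] by (cases "p (Suc c) = 0") (auto intro: pw_pos)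
  then have D: "0 < ?D" unfolding flag_prod_def
    using pos by (intro mult_pos_pos prod_pos ballI) (auto intro: pw_pos)
  have G: "0 < ?G" unfolding flag_prod_def using pos by (intro prod_pos ballI pw_pos) auto
  \<comment> \<open>\<open>?D / ?G\<close> is a uniform lower bound for the ratios once the minors
    are close to their limits, while the chosen ratios eventually fall below it.\<close>
  have "\<forall>\<^sub>F N in sequentially. inverse (real (Suc N)) < ?D / ?G"
    by (rule order_tendstoD(2)[OF LIMSEQ_inverse_real_of_nat]) (use D G in simp)
  from eventually_conj[OF this eventually_conj[OF ev\<delta> ev\<gamma>]]
  obtain N where N: "inverse (real (Suc N)) < ?D / ?G"
    "\<And>i. 1 \<le> i \<Longrightarrow> i \<le> m \<Longrightarrow> seq_diff m q i \<noteq> 0 \<Longrightarrow> \<delta> i \<le> (cmod (fdet i (\<lambda>e. kraus_vec n A (U (\<sigma> N)) (\<kappa> i e))))\<^sup>2"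
    "\<And>j. 1 \<le> j \<Longrightarrow> j \<le> n \<Longrightarrow> \<gamma> j \<le> (cmod (fdet j (\<lambda>e. V (\<sigma> N) (\<mu> j e))))\<^sup>2"
    unfolding eventually_sequentially by fastforce
  let ?h = "H (\<sigma> N)"
  note fw = flag_weight_pos[OF H(1), of p "\<sigma> N"]
  have "?D * flag_weight n p ?h \<le> ?G * image_det ?h"
    by (rule capacity_bound_from_minors[where \<kappa> = \<kappa> and \<mu> = \<mu> and S = S and K = K, OF H(1) F S _ K _ pos part tot])
      (use \<kappa> \<mu> N in \<open>simp_all\<close>)
  then have "?D / ?G * flag_weight n p ?h \<le> image_det ?h"
    using G by (simp add: pos_divide_le_eq mult.commute)
  also have "\<dots> < inverse (real (Suc (\<sigma> N))) * flag_weight n p ?h" by (rule H(2))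
  also have "\<dots> \<le> inverse (real (Suc N)) * flag_weight n p ?h"
    using fw seq_suble[OF \<sigma>, of N] by (intro mult_right_mono le_imp_inverse_le) auto
  also have "\<dots> \<le> ?D / ?G * flag_weight n p ?h"
    using fw N(1) by (intro mult_right_mono) auto
  finally show False by simp
qed

end

theorem mainTheorem1:
  fixes m n r :: nat
    and A :: "nat \<Rightarrow> complex mat"
    and p q :: "nat \<Rightarrow> real"
  assumes kraus: "\<And>i. i \<in> {1..r} \<Longrightarrow> A i \<in> carrier_mat m n"
    and p_nonincreasing: "\<And>i j. 1 \<le> i \<Longrightarrow> i \<le> j \<Longrightarrow> j \<le> n \<Longrightarrow> p j \<le> p i"
    and p_nonneg: "\<And>i. 1 \<le> i \<Longrightarrow> i \<le> n \<Longrightarrow> 0 \<le> p i"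
    and q_nonincreasing: "\<And>i j. 1 \<le> i \<Longrightarrow> i \<le> j \<Longrightarrow> j \<le> m \<Longrightarrow> q j \<le> q i"
    and q_nonneg: "\<And>i. 1 \<le> i \<Longrightarrow> i \<le> m \<Longrightarrow> 0 \<le> q i"
    and trace_eq: "mat_trace (seq_diag n p) = mat_trace (seq_diag m q)"
  shows "(rank_nondecreasing m n r A p q \<longleftrightarrow> capacity m n (cp_map m r A) p q > 0) \<and>
    (capacity m n (cp_map m r A) p q > 0 \<longleftrightarrow>
      approx_scalable m n r A (GL_flag m) (GL_flag n)
        (1\<^sub>m n) (seq_diag m q) (1\<^sub>m m) (seq_diag n p))"
proof -
  interpret scaling_problem m n r A p q
  proof
    show "weights n p" using p_nonincreasing p_nonneg by (simp add: weights_def)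
    show "weights m q" using q_nonincreasing q_nonneg by (simp add: weights_def)
    show "(\<Sum>i<n. p (Suc i)) = (\<Sum>i<m. q (Suc i))"
      using trace_eq unfolding mat_trace_seq_diag of_real_eq_iff .
  qed (rule kraus)
  show ?thesis
    using rank_nondecreasing_imp_capacity capacity_imp_scalable scalable_imp_rank_nondecreasing by blast
qed


end
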